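(* There is an algorithm that, given a strongly connected weighted digraph $G=(V,E,w)$ with $n$ vertices, $m$ edges, unweighted diameter $d$ and edge weights in $[-w_{\max},w_{\max}]$, and an accuracy $\varepsilon>0$, computes a cycle $\sigma$ in $G$ satisfying $\bar w(\sigma)\le\mu(G)+\varepsilon$ using $\tilde O(m d w_{\max}/\varepsilon)$ arithmetic operations over $\tilde O(1)$-bit numbers.
   Context: For a directed cycle $\sigma$ in a weighted digraph, $\bar w(\sigma)=\frac{1}{|\sigma|}\sum_{e\in\sigma}w(e)$ and $\mu(G)=\min_{\text{cycle }\sigma}\bar w(\sigma)$. The unweighted diameter $d$ is the maximum over ordered pairs of vertices of the number of edges on a shortest directed path between them. The notation $\tilde O(\cdot)$ suppresses polylogarithmic factors in $n$, $1/\varepsilon$ and $w_{\max}$.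
   Formalization: The operation bound is proved with max(1,d) and max(1,w_max/ε) in place of d and w_max/ε, since the literal bound tends to 0 for large ε or w_max = 0; G is assumed to have at least one arc, so that a cycle exists. *)

theory Defs
  imports
    "HOL-Analysis.Analysis"
    "Graph_Theory.Digraph_Component"
    "Graph_Theory.Shortest_Path"
begin

section \<open>Mean weight of a cycle, minimum mean cycle, unweighted diameter\<close>

text \<open>
  A digraph with vertices \<open>0, ..., n - 1\<close> whose arcs are ordered pairs of vertices, presented by
  the list of its arcs. Loops are allowed; cycles are the library's \<^const>\<open>pre_digraph.cycle\<close>
  (nonempty closed walks without repeated vertices, as lists of arcs; a loop is a cycle of length 1).
\<close>

definition graph_of :: "nat \<Rightarrow> (nat \<times> nat) list \<Rightarrow> (nat, nat \<times> nat) pre_digraph" where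
  "graph_of n es = \<lparr>verts = {..<n}, arcs = set es, tail = fst, head = snd\<rparr>"

definition mean_weight :: "'b weight_fun \<Rightarrow> 'b list \<Rightarrow> real" where
  "mean_weight w p = wf_digraph.awalk_cost w p / real (length p)"

definition min_mean_cycle :: "('a, 'b) pre_digraph \<Rightarrow> 'b weight_fun \<Rightarrow> real" where
  "min_mean_cycle G w = Min (mean_weight w ` {p. pre_digraph.cycle G p})"

definition hop_dist :: "('a, 'b) pre_digraph \<Rightarrow> 'a \<Rightarrow> 'a \<Rightarrow> nat" where
  "hop_dist G u v = (LEAST k. \<exists>p. pre_digraph.awalk G u p v \<and> length p = k)"

definition diameter_hops :: "('a, 'b) pre_digraph \<Rightarrow> nat" where
  "diameter_hops G = Max {hop_dist G u v | u v. u \<in> verts G \<and> v \<in> verts G}"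


section \<open>Machine model: random access programs over B-bit integers\<close>

text \<open>
  The store consists of named integer arrays; a scalar is an array used at index 0 only.
  Programs are built from the integer operations \<open>+, -, *, div\<close>, array reads and writes,
  comparisons, conditionals and loops.

  Real-valued inputs are kept apart from the store. The only access to them is \<open>Fix x i k\<close>,
  which returns the real input \<open>x[i]\<close> as a fixed-point number with \<open>k\<close> fractional bits,
  that is, the integer \<open>\<lfloor>2^k * x[i]\<rfloor>\<close>.
\<close>

type_synonym store = "string \<Rightarrow> int \<Rightarrow> int"
type_synonym real_input = "string \<Rightarrow> int \<Rightarrow> real"

datatype arith_op = Plus | Minus | Times | Quot

datatype exp =
    Lit int
  | Rd string exp
  | Fix string exp exp
  | Op arith_op exp exp

datatype prog =
    Skip
  | Assign string exp exp
  | Seq prog prog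
  | If_less exp exp prog prog
  | While_less exp exp prog

fun apply_op :: "arith_op \<Rightarrow> int \<Rightarrow> int \<Rightarrow> int" where
  "apply_op Plus a b = a + b"
| "apply_op Minus a b = a - b"
| "apply_op Times a b = a * b"
| "apply_op Quot a b = a div b"

fun val :: "real_input \<Rightarrow> store \<Rightarrow> exp \<Rightarrow> int" where
  "val \<rho> s (Lit c) = c"
| "val \<rho> s (Rd x i) = s x (val \<rho> s i)"
| "val \<rho> s (Fix x i k) = \<lfloor>2 powi (val \<rho> s k) * \<rho> x (val \<rho> s i)\<rfloor>"
| "val \<rho> s (Op f a b) = apply_op f (val \<rho> s a) (val \<rho> s b)"

definition fits :: "nat \<Rightarrow> int \<Rightarrow> bool" where
  "fits B a \<longleftrightarrow> \<bar>a\<bar> < 2 ^ B"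

text \<open>
  Evaluation is safe for word length \<open>B\<close> if all values arising in it (array indices and the
  contents of the cells read included) are \<open>B\<close>-bit numbers. A real input may be inspected only
  down to its \<open>B\<close>-th fractional bit.
\<close>

fun safe :: "nat \<Rightarrow> real_input \<Rightarrow> store \<Rightarrow> exp \<Rightarrow> bool" where
  "safe B \<rho> s (Lit c) \<longleftrightarrow> fits B c"
| "safe B \<rho> s (Rd x i) \<longleftrightarrow> safe B \<rho> s i \<and> fits B (val \<rho> s (Rd x i))"
| "safe B \<rho> s (Fix x i k) \<longleftrightarrow> safe B \<rho> s i \<and> safe B \<rho> s k \<and> \<bar>val \<rho> s k\<bar> \<le> int B
     \<and> fits B (val \<rho> s (Fix x i k))"
| "safe B \<rho> s (Op f a b) \<longleftrightarrow> safe B \<rho> s a \<and> safe B \<rho> s b \<and> fits B (val \<rho> s (Op f a b))"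

fun ops :: "exp \<Rightarrow> nat" where
  "ops (Lit c) = 1"
| "ops (Rd x i) = 1 + ops i"
| "ops (Fix x i k) = 1 + ops i + ops k"
| "ops (Op f a b) = 1 + ops a + ops b"

text \<open>
  \<open>exec B \<rho> P s t s'\<close>: on a machine with word length \<open>B\<close> and real inputs \<open>\<rho>\<close>, program \<open>P\<close>
  started in store \<open>s\<close> halts in store \<open>s'\<close> after exactly \<open>t\<close> operations, and no number occurring
  during the run exceeds \<open>B\<close> bits. A run that overflows is stuck: it has no derivation. The word
  length is not accessible to the program.
\<close>

inductive exec :: "nat \<Rightarrow> real_input \<Rightarrow> prog \<Rightarrow> store \<Rightarrow> nat \<Rightarrow> store \<Rightarrow> bool"
  for B :: nat and \<rho> :: real_input where
  Skip: "exec B \<rho> Skip s 1 s"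
| Assign: "safe B \<rho> s i \<Longrightarrow> safe B \<rho> s a \<Longrightarrow>
    exec B \<rho> (Assign x i a) s (1 + ops i + ops a)
      (s(x := (s x)(val \<rho> s i := val \<rho> s a)))"
| Seq: "exec B \<rho> P s t s' \<Longrightarrow> exec B \<rho> Q s' t' s'' \<Longrightarrow> exec B \<rho> (Seq P Q) s (t + t') s''"
| If_true: "safe B \<rho> s a \<Longrightarrow> safe B \<rho> s b \<Longrightarrow> val \<rho> s a < val \<rho> s b \<Longrightarrow> exec B \<rho> P s t s' \<Longrightarrow>
    exec B \<rho> (If_less a b P Q) s (1 + ops a + ops b + t) s'"
| If_false: "safe B \<rho> s a \<Longrightarrow> safe B \<rho> s b \<Longrightarrow> \<not> val \<rho> s a < val \<rho> s b \<Longrightarrow> exec B \<rho> Q s t s' \<Longrightarrow>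
    exec B \<rho> (If_less a b P Q) s (1 + ops a + ops b + t) s'"
| While_false: "safe B \<rho> s a \<Longrightarrow> safe B \<rho> s b \<Longrightarrow> \<not> val \<rho> s a < val \<rho> s b \<Longrightarrow>
    exec B \<rho> (While_less a b P) s (1 + ops a + ops b) s"
| While_true: "safe B \<rho> s a \<Longrightarrow> safe B \<rho> s b \<Longrightarrow> val \<rho> s a < val \<rho> s b \<Longrightarrow>
    exec B \<rho> P s t s' \<Longrightarrow> exec B \<rho> (While_less a b P) s' t' s'' \<Longrightarrow>
    exec B \<rho> (While_less a b P) s (1 + ops a + ops b + t + t') s''"


section \<open>Input and output conventions\<close>

text \<open>
  The graph is handed to the program as an arc list in the initial store. The weights and the
  accuracy \<open>\<epsilon>\<close> are real inputs; \<open>\<epsilon>\<close> is given through \<open>1/\<epsilon>\<close>, the quantity in which the running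
  time and the word length are measured. Neither the diameter nor a bound on the weights is given
  to the program.
\<close>

definition input_store :: "nat \<Rightarrow> (nat \<times> nat) list \<Rightarrow> store" where
  "input_store n es = (\<lambda>x i.
     if x = ''n'' \<and> i = 0 then int n
     else if x = ''m'' \<and> i = 0 then int (length es)
     else if x = ''tail'' \<and> 0 \<le> i \<and> i < int (length es) then int (fst (es ! nat i))
     else if x = ''head'' \<and> 0 \<le> i \<and> i < int (length es) then int (snd (es ! nat i))
     else 0)"

definition input_reals :: "(nat \<times> nat) list \<Rightarrow> (nat \<times> nat) weight_fun \<Rightarrow> real \<Rightarrow> real_input" where
  "input_reals es w \<epsilon> = (\<lambda>x i.
     if x = ''w'' \<and> 0 \<le> i \<and> i < int (length es) then w (es ! nat i)
     else if x = ''inv_eps'' \<and> i = 0 then 1 / \<epsilon>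
     else 0)"

text \<open>The output is a sequence of arcs, each given by its position in the input arc list.\<close>

definition outputs :: "(nat \<times> nat) list \<Rightarrow> store \<Rightarrow> (nat \<times> nat) list \<Rightarrow> bool" where
  "outputs es s p \<longleftrightarrow> s ''len'' 0 = int (length p) \<and>
     (\<forall>j<length p. 0 \<le> s ''out'' (int j) \<and> s ''out'' (int j) < int (length es) \<and>
        p ! j = es ! nat (s ''out'' (int j)))"

text \<open>
  The polylogarithmic factor in \<open>n\<close>, \<open>1/\<epsilon>\<close> and \<open>w_max\<close> with exponent \<open>k\<close>; it is at least 1.
\<close>

definition polylog :: "nat \<Rightarrow> nat \<Rightarrow> real \<Rightarrow> real \<Rightarrow> real" where
  "polylog k n \<epsilon> wmax = log 2 (2 + real n + 1 / \<epsilon> + wmax) ^ k"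

end

theory Submission
  imports Defs
begin

text \<open>
  Round the weights to multiples of about \<open>\<epsilon>\<close> and let \<open>D\<close> be the sum of the eccentricities of vertex
  \<open>0\<close> in both directions, found by breadth-first search, so that \<open>D\<close> is of the order of the diameter.
  A minimum mean cycle has, by averaging over its starting points, a window of any length \<open>j\<close> of mean
  weight at most \<open>\<mu>\<close>. Going from \<open>0\<close> to such a window, along it and back to \<open>0\<close> adds at most \<open>D\<close> arcs,
  so for \<open>j\<close> of the order of \<open>D w\<^sub>m\<^sub>a\<^sub>x / \<epsilon>\<close> this closed walk has mean at most \<open>\<mu> + \<epsilon>\<close>. Dynamic programming
  over all walk lengths up to \<open>j + D\<close>, with \<open>O(m)\<close> work per length, finds a closed walk through \<open>0\<close> which
  is at least as good. Splitting it into cycles with a stack yields a cycle whose mean does not exceed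
  that of the walk. Closing the walk through \<open>0\<close> instead of taking an arbitrary light walk is what
  avoids a left-over path of up to \<open>n\<close> arcs.
\<close>

section \<open>Total-correctness reasoning about programs\<close>

text \<open>The program knows neither the diameter nor \<open>wmax\<close> and sees reals only
  through floors, so it measures its own parameters. Reading the weights at unit precision gives
  their rough size \<open>A\<close>; the scale \<open>p = 2 ^ k\<close> is then chosen above both
  \<open>4 / \<epsilon>\<close> and \<open>A\<close>. Dominating \<open>A\<close> as well keeps the
  product of the rounded weight bound and the rounded \<open>1 / \<epsilon>\<close> within a
  constant factor of \<open>p ^ 2 * max 1 (wmax / \<epsilon>)\<close>, so that the number of levels
  carries no further factor. Subtracting \<open>W + 1\<close> from all rounded weights makes them
  negative: it lowers every mean equally, and the untouched cells of a zero store can stand for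
  infinity without an initialisation pass. The length of the light closed walk is unknown, hence the
  selection over all lengths, by cross-multiplication to stay within integers. Half of
  \<open>\<epsilon>\<close> pays for the detour through 0, half for rounding. All numbers are
  polynomial in \<open>X = 2 + n + 1 / \<epsilon> + wmax\<close>, which makes
  \<open>O(log X)\<close> bits enough.\<close>

definition cap :: "nat \<Rightarrow> int" where "cap B = 2 ^ B"

text \<open>\<open>cap B\<close> hides the power \<open>2 ^ B\<close>, so that word-length
  conditions become linear inequalities over an atom.\<close>

lemma fits_cap: "fits B a \<longleftrightarrow> \<bar>a\<bar> < cap B"
  unfolding fits_def cap_def by simp

text \<open>A weakest precondition for total correctness: the existence of a run includes
  termination and the absence of overflow. The equations below let simp compute it for straight-line
  code, so that only loops call for invariants.\<close>

definition runs :: "nat \<Rightarrow> real_input \<Rightarrow> prog \<Rightarrow> store \<Rightarrow> (nat \<Rightarrow> store \<Rightarrow> bool) \<Rightarrow> bool" where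
  "runs B \<rho> P s Q \<longleftrightarrow> (\<exists>t s'. exec B \<rho> P s t s' \<and> Q t s')"

inductive_simps exec_Skip_iff: "exec B \<rho> Skip s t s'"
inductive_simps exec_Assign_iff: "exec B \<rho> (Assign x i a) s t s'"
inductive_simps exec_Seq_iff: "exec B \<rho> (Seq P R) s t s'"
inductive_simps exec_If_iff: "exec B \<rho> (If_less a b P R) s t s'"

lemma runs_Skip [simp]: "runs B \<rho> Skip s Q \<longleftrightarrow> Q 1 s"
  unfolding runs_def exec_Skip_iff by auto

lemma runs_Assign [simp]:
  "runs B \<rho> (Assign x i a) s Q \<longleftrightarrow> safe B \<rho> s i \<and> safe B \<rho> s a \<and>
     Q (1 + ops i + ops a) (s(x := (s x)(val \<rho> s i := val \<rho> s a)))"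
  unfolding runs_def exec_Assign_iff by auto

lemma runs_Seq [simp]:
  "runs B \<rho> (Seq P R) s Q \<longleftrightarrow> runs B \<rho> P s (\<lambda>t s'. runs B \<rho> R s' (\<lambda>t'. Q (t + t')))"
  unfolding runs_def exec_Seq_iff by blast

lemma runs_If [simp]:
  "runs B \<rho> (If_less a b P R) s Q \<longleftrightarrow> safe B \<rho> s a \<and> safe B \<rho> s b \<and>
     (val \<rho> s a < val \<rho> s b \<longrightarrow> runs B \<rho> P s (\<lambda>t. Q (1 + ops a + ops b + t))) \<and>
     (\<not> val \<rho> s a < val \<rho> s b \<longrightarrow> runs B \<rho> R s (\<lambda>t. Q (1 + ops a + ops b + t)))"
  unfolding runs_def exec_If_iff
  by (cases "val \<rho> s a < val \<rho> s b") auto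

lemma runs_mono: "runs B \<rho> P s Q \<Longrightarrow> (\<And>t s'. Q t s' \<Longrightarrow> Q' t s') \<Longrightarrow> runs B \<rho> P s Q'"
  unfolding runs_def by blast

fun writes :: "prog \<Rightarrow> string set" where
  "writes Skip = {}"
| "writes (Assign x i a) = {x}"
| "writes (Seq P Q) = writes P \<union> writes Q"
| "writes (If_less a b P Q) = writes P \<union> writes Q"
| "writes (While_less a b P) = writes P"

text \<open>The frame condition. Since every run satisfies it for \<open>writes P\<close>, loop
  invariants need not mention arrays that the body leaves alone.\<close>

definition agree :: "string set \<Rightarrow> store \<Rightarrow> store \<Rightarrow> bool" where
  "agree X s s' \<longleftrightarrow> (\<forall>x. x \<notin> X \<longrightarrow> s' x = s x)"

lemma agreeD: "agree X s s' \<Longrightarrow> x \<notin> X \<Longrightarrow> s' x = s x"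
  unfolding agree_def by blast

lemma agree_refl [simp]: "agree X s s"
  unfolding agree_def by blast

lemma agree_trans: "agree X s s' \<Longrightarrow> agree X s' s'' \<Longrightarrow> agree X s s''"
  unfolding agree_def by auto

lemma agree_upd [simp]:
  "x \<in> X \<Longrightarrow> agree X (s(x := f)) s' \<longleftrightarrow> agree X s s'"
  "x \<in> X \<Longrightarrow> agree X s (s'(x := f)) \<longleftrightarrow> agree X s s'"
  by (auto simp: agree_def)

lemma exec_agree: "exec B \<rho> P s t s' \<Longrightarrow> agree (writes P) s s'"
  by (induction rule: exec.induct) (auto simp: agree_def)

text \<open>\<open>N\<close> is merely an upper bound on the number of rounds: the guard has to
  imply \<open>i < N\<close>, and \<open>N - i\<close> is the variant. This suits loops such as the
  search, whose number of rounds depends on the graph.\<close>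

lemma runs_While:
  assumes init: "I 0 s"
    and body: "\<And>i s'. I i s' \<Longrightarrow> agree (writes P) s s' \<Longrightarrow>
      safe B \<rho> s' a \<and> safe B \<rho> s' b \<and>
      (val \<rho> s' a < val \<rho> s' b \<longrightarrow> i < N \<and> runs B \<rho> P s' (\<lambda>t s''. t \<le> T \<and> I (Suc i) s''))"
  shows "runs B \<rho> (While_less a b P) s
    (\<lambda>t s'. t \<le> N * (T + (1 + ops a + ops b)) + (1 + ops a + ops b) \<and>
       agree (writes P) s s' \<and> (\<exists>i\<le>N. I i s' \<and> \<not> val \<rho> s' a < val \<rho> s' b))"
proof -
  let ?c = "1 + ops a + ops b"
  have "\<exists>t s''. exec B \<rho> (While_less a b P) s' t s'' \<and> t \<le> (N - i) * (T + ?c) + ?c \<and>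
      (\<exists>i\<le>N. I i s'' \<and> \<not> val \<rho> s'' a < val \<rho> s'' b)"
    if "I i s'" "agree (writes P) s s'" "i \<le> N" for i s'
    using that
  proof (induction "N - i" arbitrary: i s')
    case 0
    then have "\<not> val \<rho> s' a < val \<rho> s' b" "safe B \<rho> s' a" "safe B \<rho> s' b"
      using body[of i s'] by auto
    then have "exec B \<rho> (While_less a b P) s' ?c s'" by (blast intro: exec.While_false)
    with 0 \<open>\<not> val \<rho> s' a < val \<rho> s' b\<close> show ?case by (metis le_add2)
  next
    case (Suc k)
    note b = body[OF Suc.prems(1,2)]
    show ?case
    proof (cases "val \<rho> s' a < val \<rho> s' b")
      case False
      then have "exec B \<rho> (While_less a b P) s' ?c s'" using b by (blast intro: exec.While_false)
      with False Suc.prems show ?thesis by (metis le_add2)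
    next
      case True
      with b obtain t1 s1 where 1: "exec B \<rho> P s' t1 s1" "t1 \<le> T" "I (Suc i) s1"
        unfolding runs_def by blast
      have ag: "agree (writes P) s s1"
        using exec_agree[OF 1(1)] Suc.prems(2) by (rule agree_trans[rotated])
      have k: "k = N - Suc i" "Suc i \<le> N" using Suc.hyps(2) by auto
      obtain t2 s2 where 2: "exec B \<rho> (While_less a b P) s1 t2 s2"
        "t2 \<le> (N - Suc i) * (T + ?c) + ?c" "\<exists>i\<le>N. I i s2 \<and> \<not> val \<rho> s2 a < val \<rho> s2 b"
        using Suc.hyps(1)[OF k(1) 1(3) ag k(2)] by blast
      have "N - i = Suc (N - Suc i)" using k by simp
      then have "?c + t1 + t2 \<le> (N - i) * (T + ?c) + ?c"
        using 1(2) 2(2) by simp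
      then show ?thesis
        using b True exec.While_true[OF _ _ True 1(1) 2(1)] 2(3) by blast
    qed
  qed
  from this[OF init] show ?thesis
    using exec_agree[of B \<rho> "While_less a b P" s] unfolding runs_def by fastforce
qed

text \<open>Counting loops: with the guard equivalent to \<open>i < N\<close>, the loop can only be
  left at exactly \<open>N\<close>.\<close>

lemma runs_for:
  assumes init: "I 0 s"
    and body: "\<And>i s'. I i s' \<Longrightarrow> agree (writes P) s s' \<Longrightarrow> i \<le> N \<Longrightarrow>
      safe B \<rho> s' a \<and> safe B \<rho> s' b \<and> (val \<rho> s' a < val \<rho> s' b \<longleftrightarrow> i < N) \<and>
      (i < N \<longrightarrow> runs B \<rho> P s' (\<lambda>t s''. t \<le> T \<and> I (Suc i) s''))"
  shows "runs B \<rho> (While_less a b P) s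
    (\<lambda>t s'. t \<le> N * (T + (1 + ops a + ops b)) + (1 + ops a + ops b) \<and> agree (writes P) s s' \<and> I N s')"
proof (rule runs_mono)
  define J where "J = (\<lambda>i s'. I i s' \<and> i \<le> N)"
  show "runs B \<rho> (While_less a b P) s
    (\<lambda>t s'. t \<le> N * (T + (1 + ops a + ops b)) + (1 + ops a + ops b) \<and>
       agree (writes P) s s' \<and> (\<exists>i\<le>N. J i s' \<and> \<not> val \<rho> s' a < val \<rho> s' b))"
  proof (rule runs_While)
    show "J 0 s" using init by (simp add: J_def)
    fix i s' assume "J i s'" "agree (writes P) s s'"
    with body[of i s'] show "safe B \<rho> s' a \<and> safe B \<rho> s' b \<and>
      (val \<rho> s' a < val \<rho> s' b \<longrightarrow> i < N \<and> runs B \<rho> P s' (\<lambda>t s''. t \<le> T \<and> J (Suc i) s''))"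
      by (auto simp: J_def Suc_le_eq elim!: runs_mono)
  qed
  fix t s' assume "t \<le> N * (T + (1 + ops a + ops b)) + (1 + ops a + ops b) \<and>
       agree (writes P) s s' \<and> (\<exists>i\<le>N. J i s' \<and> \<not> val \<rho> s' a < val \<rho> s' b)"
  with body show "t \<le> N * (T + (1 + ops a + ops b)) + (1 + ops a + ops b) \<and> agree (writes P) s s' \<and> I N s'"
    unfolding J_def by (metis le_neq_implies_less)
qed

section \<open>Notation for expressions and programs\<close>

abbreviation var :: "string \<Rightarrow> exp" where "var x \<equiv> Rd x (Lit 0)"
abbreviation put :: "string \<Rightarrow> exp \<Rightarrow> prog" where "put x a \<equiv> Assign x (Lit 0) a"
abbreviation plus_exp :: "exp \<Rightarrow> exp \<Rightarrow> exp" (infixl "[+]" 65) where "a [+] b \<equiv> Op Plus a b"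
abbreviation minus_exp :: "exp \<Rightarrow> exp \<Rightarrow> exp" (infixl "[-]" 65) where "a [-] b \<equiv> Op Minus a b"
abbreviation times_exp :: "exp \<Rightarrow> exp \<Rightarrow> exp" (infixl "[*]" 70) where "a [*] b \<equiv> Op Times a b"
abbreviation seq_prog :: "prog \<Rightarrow> prog \<Rightarrow> prog" (infixr ";;" 60) where "P ;; Q \<equiv> Seq P Q"

section \<open>Scaled weights\<close>

text \<open>The precision is read from the variable \<open>s\<close>, so the same code serves twice:
  with \<open>s\<close> still 0 for the rough size of the weights, and later with the final
  precision.\<close>

definition scan_body :: prog where
  "scan_body =
     put ''x'' (Fix ''w'' (var ''i'') (var ''s'')) ;;
     Assign ''b'' (var ''i'') (var ''x'') ;;
     If_less (var ''W'') (var ''x'') (put ''W'' (var ''x'')) Skip ;;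
     If_less (var ''W'') (Lit 0 [-] var ''x'') (put ''W'' (Lit 0 [-] var ''x'')) Skip ;;
     put ''i'' (var ''i'' [+] Lit 1)"

definition scan :: prog where
  "scan = put ''i'' (Lit 0) ;; put ''W'' (Lit 0) ;; While_less (var ''i'') (var ''m'') scan_body"

text \<open>\<open>U\<close> is a bound available to the analysis only. It excludes overflow, while
  the program continues with the maximum that it has found itself.\<close>

lemma runs_scan:
  fixes m k :: nat and a :: "nat \<Rightarrow> int"
  assumes m: "s ''m'' 0 = int m" "int m < cap B"
    and k: "s ''s'' 0 = int k" "k \<le> B" "int k < cap B"
    and a: "\<And>i. i < m \<Longrightarrow> \<lfloor>2 ^ k * \<rho> ''w'' (int i)\<rfloor> = a i" "\<And>i. i < m \<Longrightarrow> \<bar>a i\<bar> \<le> U"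
    and U: "0 \<le> U" "U < cap B"
    and B: "2 \<le> cap B"
  shows "runs B \<rho> scan s (\<lambda>t s'. t \<le> 60 * m + 40 \<and> agree {''i'', ''W'', ''x'', ''b''} s s' \<and>
     s' ''W'' 0 \<le> U \<and> 0 \<le> s' ''W'' 0 \<and> (\<forall>i<m. s' ''b'' (int i) = a i \<and> \<bar>a i\<bar> \<le> s' ''W'' 0))"
proof -
  define I where "I = (\<lambda>i (s'::store). s' ''i'' 0 = int i \<and> s' ''W'' 0 \<le> U \<and> 0 \<le> s' ''W'' 0 \<and>
     (\<forall>j<i. s' ''b'' (int j) = a j \<and> \<bar>a j\<bar> \<le> s' ''W'' 0))"
  define s0 where "s0 = s(''i'' := (s ''i'')(0 := 0), ''W'' := (s ''W'')(0 := 0))"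
  have w: "writes scan_body = {''i'', ''W'', ''x'', ''b''}" unfolding scan_body_def by auto
  have loop: "runs B \<rho> (While_less (var ''i'') (var ''m'') scan_body) s0
    (\<lambda>t s'. t \<le> m * (40 + (1 + ops (var ''i'') + ops (var ''m''))) + (1 + ops (var ''i'') + ops (var ''m'')) \<and>
       agree (writes scan_body) s0 s' \<and> I m s')"
  proof (rule runs_for)
    show "I 0 s0" by (simp add: I_def s0_def U)
    fix i s' assume p: "I i s'" "agree (writes scan_body) s0 s'" "i \<le> m"
    have e: "s' ''m'' 0 = int m" "s' ''s'' 0 = int k"
      using agreeD[OF p(2), of "''m''"] agreeD[OF p(2), of "''s''"] m k by (auto simp: w s0_def)
    have q: "s' ''i'' 0 = int i" "s' ''W'' 0 \<le> U" "0 \<le> s' ''W'' 0"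
      "\<And>j. j < i \<Longrightarrow> s' ''b'' (int j) = a j \<and> \<bar>a j\<bar> \<le> s' ''W'' 0"
      using p(1) by (auto simp: I_def)
    have f: "fits B 0" "fits B 1" "fits B (int i)" "fits B (int m)" "fits B (int k)" "fits B (s' ''W'' 0)"
      using q m k B U p(3) by (auto simp: fits_cap)
    have "runs B \<rho> scan_body s' (\<lambda>t s''. t \<le> 40 \<and> I (Suc i) s'')" if "i < m"
    proof -
      have "fits B (int i + 1)" "fits B (a i)" "fits B (- a i)"
        using that m a(2)[OF that] U by (auto simp: fits_cap)
      then show ?thesis
        unfolding scan_body_def using that k(2) U(1) a(2)[OF that] q(2,3)
        by (simp add: e q f a(1) I_def less_Suc_eq) (auto dest: q(4))
    qed
    then show "safe B \<rho> s' (var ''i'') \<and> safe B \<rho> s' (var ''m'') \<and>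
      (val \<rho> s' (var ''i'') < val \<rho> s' (var ''m'') \<longleftrightarrow> i < m) \<and>
      (i < m \<longrightarrow> runs B \<rho> scan_body s' (\<lambda>t s''. t \<le> 40 \<and> I (Suc i) s''))"
      by (simp add: e q f)
  qed
  have ag: "agree (writes scan_body) s0 s' \<longleftrightarrow> agree {''i'', ''W'', ''x'', ''b''} s s'" for s'
    unfolding w s0_def by simp
  show ?thesis
    unfolding scan_def using B
    apply (simp add: fits_cap flip: s0_def)
    apply (rule runs_mono[OF loop])
    apply (unfold ag I_def)
    apply simp
    done
qed

section \<open>Choice of the fixed-point precision\<close>

definition precision_body :: prog where
  "precision_body = put ''p'' (Lit 2 [*] var ''p'') ;; put ''s'' (var ''s'' [+] Lit 1)"

definition precision :: prog where
  "precision = put ''p'' (Lit 1) ;;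
     While_less (var ''p'') (Lit 4 [*] (Fix ''inv_eps'' (Lit 0) (Lit 0) [+] Lit 1) [+] var ''W'') precision_body"

text \<open>The least power of two above the target is found by doubling. As \<open>E + 1\<close>
  exceeds \<open>1 / \<epsilon>\<close>, one unit of the resulting scale is at most
  \<open>\<epsilon> / 4\<close>; minimality keeps the scale below twice the target and thus
  polynomial.\<close>

lemma runs_precision:
  fixes E V :: int
  assumes s: "s ''s'' 0 = 0" "s ''W'' 0 = V" "\<lfloor>\<rho> ''inv_eps'' 0\<rfloor> = E" "0 \<le> V" "0 \<le> E"
    and B: "2 * (4 * (E + 1) + V) \<le> cap B"
  obtains k :: nat where "4 * (E + 1) + V \<le> 2 ^ k" "2 ^ k < 2 * (4 * (E + 1) + V)"
    "runs B \<rho> precision s (\<lambda>t s'. t \<le> 40 * k + 40 \<and> agree {''p'', ''s''} s s' \<and>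
       s' ''s'' 0 = int k \<and> s' ''p'' 0 = 2 ^ k)"
proof -
  define Z where "Z = 4 * (E + 1) + V"
  have Z: "4 \<le> Z" "2 * Z \<le> cap B" using s B by (auto simp: Z_def)
  define N where "N = (LEAST k. Z \<le> 2 ^ k)"
  have "Z \<le> 2 ^ nat Z"
    using of_nat_less_two_power[of "nat Z", where 'a = int] Z by simp
  then have N: "Z \<le> 2 ^ N" unfolding N_def by (rule LeastI)
  have less: "2 ^ k < Z \<longleftrightarrow> k < N" for k
  proof
    assume "2 ^ k < Z"
    show "k < N"
    proof (rule ccontr)
      assume "\<not> k < N"
      then have "(2::int) ^ N \<le> 2 ^ k" by (intro power_increasing) auto
      with N \<open>2 ^ k < Z\<close> show False by linarith
    qed
  next
    assume "k < N"
    then show "2 ^ k < Z" using not_less_Least[of k "\<lambda>k. Z \<le> 2 ^ k"] by (simp add: N_def)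
  qed
  \<comment> \<open>The target is at least 4, so \<open>N - 1\<close> exists and its power is still
    below the target.\<close>
  have "N \<noteq> 0" using N Z by (cases N) auto
  then have "2 ^ N < 2 * Z" using less[of "N - 1"] by (cases N) auto
  define I where "I = (\<lambda>i (s'::store). s' ''p'' 0 = 2 ^ i \<and> s' ''s'' 0 = int i)"
  define s0 where "s0 = s(''p'' := (s ''p'')(0 := 1))"
  let ?b = "Lit 4 [*] (Fix ''inv_eps'' (Lit 0) (Lit 0) [+] Lit 1) [+] var ''W''"
  have w: "writes precision_body = {''p'', ''s''}" unfolding precision_body_def by auto
  have loop: "runs B \<rho> (While_less (var ''p'') ?b precision_body) s0
    (\<lambda>t s'. t \<le> N * (20 + (1 + ops (var ''p'') + ops ?b)) + (1 + ops (var ''p'') + ops ?b) \<and>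
       agree (writes precision_body) s0 s' \<and> I N s')"
  proof (rule runs_for)
    show "I 0 s0" by (simp add: I_def s0_def s)
    fix i s' assume p: "I i s'" "agree (writes precision_body) s0 s'" "i \<le> N"
    have e: "s' ''W'' 0 = V"
      using agreeD[OF p(2), of "''W''"] s by (auto simp: w s0_def)
    have q: "s' ''p'' 0 = 2 ^ i" "s' ''s'' 0 = int i"
      using p(1) by (auto simp: I_def)
    have "(2::int) ^ i \<le> 2 ^ N" using p(3) by (intro power_increasing) auto
    moreover have "int i < 2 ^ i" by simp
    ultimately have b: "(2::int) ^ i < 2 * Z" "int i < 2 * Z" using \<open>2 ^ N < 2 * Z\<close> by linarith+
    have "8 \<le> cap B" "2 ^ i < cap B" "int i < cap B" "4 * E + 4 + V < cap B"
      using b Z(1,2) s(4,5) unfolding Z_def by simp_all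
    then have f: "fits B 0" "fits B 1" "fits B 2" "fits B 4" "fits B (2 ^ i)" "fits B (int i)" "fits B V" "fits B E"
      "fits B (E + 1)" "fits B (4 * (E + 1))" "fits B (4 * (E + 1) + V)"
      using s(4,5) by (simp_all add: fits_cap)
    have "runs B \<rho> precision_body s' (\<lambda>t s''. t \<le> 20 \<and> I (Suc i) s'')" if "i < N"
    proof -
      have "2 ^ i < Z" using that less by simp
      moreover have "int i + 1 \<le> 2 ^ i" using \<open>int i < 2 ^ i\<close> by linarith
      ultimately have "fits B (2 * 2 ^ i)" "fits B (int i + 1)"
        using Z by (auto simp: fits_cap)
      then show ?thesis
        unfolding precision_body_def by (simp add: q f I_def)
    qed
    then show "safe B \<rho> s' (var ''p'') \<and> safe B \<rho> s' ?b \<and>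
      (val \<rho> s' (var ''p'') < val \<rho> s' ?b \<longleftrightarrow> i < N) \<and>
      (i < N \<longrightarrow> runs B \<rho> precision_body s' (\<lambda>t s''. t \<le> 20 \<and> I (Suc i) s''))"
      using less[of i] f(10,11) unfolding Z_def by (simp add: e q f s(3))
  qed
  have ag: "agree (writes precision_body) s0 s' \<longleftrightarrow> agree {''p'', ''s''} s s'" for s'
    unfolding w s0_def by simp
  have "runs B \<rho> precision s (\<lambda>t s'. t \<le> 40 * N + 40 \<and> agree {''p'', ''s''} s s' \<and>
       s' ''s'' 0 = int N \<and> s' ''p'' 0 = 2 ^ N)"
    unfolding precision_def using Z
    apply (simp add: fits_cap flip: s0_def)
    apply (rule runs_mono[OF loop])
    apply (unfold ag I_def)
    apply simp
    done
  with N \<open>2 ^ N < 2 * Z\<close> that show thesis unfolding Z_def by blast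
qed

section \<open>Breadth-first search\<close>

text \<open>The ball of radius \<open>k\<close> around 0 when arc \<open>e\<close> leads from
  \<open>f e\<close> to \<open>g e\<close>. Exchanging \<open>f\<close> and \<open>g\<close>
  replaces distances from 0 by distances to 0.\<close>

fun reach :: "nat \<Rightarrow> (nat \<Rightarrow> nat) \<Rightarrow> (nat \<Rightarrow> nat) \<Rightarrow> nat \<Rightarrow> nat set" where
  "reach m f g 0 = {0}"
| "reach m f g (Suc k) = reach m f g k \<union> g ` {e. e < m \<and> f e \<in> reach m f g k}"

lemma reach_mono: "i \<le> j \<Longrightarrow> reach m f g i \<subseteq> reach m f g j"
  by (induction rule: dec_induct) auto

lemma reach_less: "0 < n \<Longrightarrow> (\<And>e. e < m \<Longrightarrow> g e < n) \<Longrightarrow> reach m f g k \<subseteq> {..<n}"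
  by (induction k) auto

text \<open>
  In \<open>l\<close>, the entry \<open>0\<close> marks an unvisited vertex and \<open>i + 1\<close> a vertex at distance \<open>i\<close>; \<open>c\<close> counts the
  visited vertices.
\<close>

definition search_step :: "string \<Rightarrow> string \<Rightarrow> string \<Rightarrow> string \<Rightarrow> prog" where
  "search_step f g l r =
     If_less (Lit 0) (Rd l (Rd f (var ''i'')))
       (If_less (Rd l (Rd f (var ''i''))) (var r [+] Lit 1)
         (If_less (Rd l (Rd g (var ''i''))) (Lit 1)
           (Assign l (Rd g (var ''i'')) (var r [+] Lit 1) ;; put ''c'' (var ''c'' [+] Lit 1)) Skip)
         Skip)
       Skip ;;
     put ''i'' (var ''i'' [+] Lit 1)"

text \<open>Each level scans all arcs instead of a queue. This costs \<open>O(m)\<close> per level,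
  and with at most diameter many levels it stays within the \<open>m * d\<close> budget.\<close>

definition search_round :: "string \<Rightarrow> string \<Rightarrow> string \<Rightarrow> string \<Rightarrow> prog" where
  "search_round f g l r =
     put ''i'' (Lit 0) ;;
     While_less (var ''i'') (var ''m'') (search_step f g l r) ;;
     put r (var r [+] Lit 1)"

definition search :: "string \<Rightarrow> string \<Rightarrow> string \<Rightarrow> string \<Rightarrow> prog" where
  "search f g l r =
     put r (Lit 1) ;; put ''c'' (Lit 1) ;; Assign l (Lit 0) (Lit 1) ;;
     While_less (var ''c'') (var ''n'') (search_round f g l r)"

text \<open>\<open>R\<close> is the visited set at the start of the round, \<open>A\<close> the
  current one. Vertices found during the round get the label \<open>k + 2\<close>, which fails the
  test against \<open>r + 1\<close>, so they are not expanded in the same round and the rounds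
  follow \<open>reach\<close> exactly.\<close>

lemma runs_search_step:
  fixes m k :: nat and fe ge :: "nat \<Rightarrow> nat"
  assumes d: "distinct [f, g, l, r, ''i'', ''c'', ''m'', ''n'']"
    and e: "s f (int e) = int (fe e)" "s g (int e) = int (ge e)" "s r 0 = int k + 1" "s ''i'' 0 = int e"
      "s ''c'' 0 = int (card A)"
    and le: "fe e < n" "ge e < n" "e < m"
    and A: "A \<subseteq> {..<n}"
    and l: "\<And>v. 0 \<le> s l v" "\<And>v. s l v \<le> int k + 2" "\<And>v. 0 < s l (int v) \<longleftrightarrow> v \<in> A"
      "\<And>v. 0 < s l (int v) \<and> s l (int v) \<le> int k + 1 \<longleftrightarrow> v \<in> R"
    and B: "int n < cap B" "int m < cap B" "int k + 2 < cap B"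
  shows "runs B \<rho> (search_step f g l r) s (\<lambda>t s'. t \<le> 60 \<and> agree {l, ''c'', ''i''} s s' \<and> s' ''i'' 0 = int e + 1 \<and>
     (\<forall>v. 0 \<le> s' l v \<and> s' l v \<le> int k + 2) \<and>
     (\<forall>v. 0 < s' l (int v) \<longleftrightarrow> v \<in> (if fe e \<in> R then insert (ge e) A else A)) \<and>
     (\<forall>v. 0 < s' l (int v) \<and> s' l (int v) \<le> int k + 1 \<longleftrightarrow> v \<in> R) \<and>
     s' ''c'' 0 = int (card (if fe e \<in> R then insert (ge e) A else A)))"
proof -
  have finA: "finite A" using A finite_subset by blast
  have "card A \<le> n" using card_mono[OF _ A] by simp
  moreover have "card A < n" if "ge e \<notin> A"
    using psubset_card_mono[of "{..<n}" A] A that le by auto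
  moreover have "\<bar>s l v\<bar> < cap B" for v using l(1,2)[of v] B by linarith
  ultimately have f: "fits B 0" "fits B 1" "fits B (int e)" "fits B (int e + 1)" "fits B (int (fe e))" "fits B (int (ge e))"
    "fits B (s l v)" "fits B (int (card A))" "ge e \<notin> A \<Longrightarrow> fits B (int (card A) + 1)" "fits B (int k + 1)"
    "fits B (int k + 1 + 1)" "fits B (2 + int k)" for v
    using B le by (auto simp: fits_cap)
  have RA: "R \<subseteq> A" using l(3,4) by blast
  show ?thesis
  proof (cases "fe e \<in> R \<and> ge e \<notin> A")
    case True
    then have c: "0 < s l (int (fe e))" "s l (int (fe e)) < int k + 1 + 1" "s l (int (ge e)) < 1"
      using l(1)[of "int (ge e)"] l(3)[of "ge e"] l(4)[of "fe e"] by linarith+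
    have "ge e \<notin> R" using True RA by blast
    then show ?thesis
      unfolding search_step_def using d True c l finA by (auto simp: e f)
  next
    case False
    then have A': "(if fe e \<in> R then insert (ge e) A else A) = A" by auto
    have c: "\<not> (0 < s l (int (fe e)) \<and> s l (int (fe e)) < int k + 1 + 1 \<and> s l (int (ge e)) < 1)"
      using False l(1)[of "int (ge e)"] l(3)[of "ge e"] l(4)[of "fe e"] by linarith
    show ?thesis
      unfolding search_step_def A' using d c l
      by (cases "0 < s l (int (fe e))"; cases "s l (int (fe e)) < int k + 1 + 1") (simp_all add: e f)
  qed
qed


lemma runs_search_round:
  fixes m n k :: nat and fe ge :: "nat \<Rightarrow> nat"
  assumes d: "distinct [f, g, l, r, ''i'', ''c'', ''m'', ''n'']"
    and s: "s ''m'' 0 = int m" "\<And>e. e < m \<Longrightarrow> s f (int e) = int (fe e)" "\<And>e. e < m \<Longrightarrow> s g (int e) = int (ge e)"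
      "s r 0 = int k + 1" "s ''c'' 0 = int (card (reach m fe ge k))"
    and le: "\<And>e. e < m \<Longrightarrow> fe e < n" "\<And>e. e < m \<Longrightarrow> ge e < n" "0 < n"
    and l: "\<And>v. 0 \<le> s l v" "\<And>v. s l v \<le> int k + 1" "\<And>v. 0 < s l (int v) \<longleftrightarrow> v \<in> reach m fe ge k"
    and B: "int n < cap B" "int m < cap B" "int k + 2 < cap B"
  shows "runs B \<rho> (search_round f g l r) s (\<lambda>t s'. t \<le> 70 * m + 40 \<and> agree {l, ''c'', ''i'', r} s s' \<and>
     (\<forall>v. 0 \<le> s' l v \<and> s' l v \<le> int k + 2) \<and> s' r 0 = int k + 2 \<and>
     (\<forall>v. 0 < s' l (int v) \<longleftrightarrow> v \<in> reach m fe ge (Suc k)) \<and>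
     s' ''c'' 0 = int (card (reach m fe ge (Suc k))))"
proof -
  let ?R = "reach m fe ge k"
  define A where "A = (\<lambda>i. ?R \<union> ge ` {e. e < i \<and> fe e \<in> ?R})"
  have Rn: "?R \<subseteq> {..<n}" using reach_less[of n m ge fe k] le by auto
  have An: "A i \<subseteq> {..<n}" if "i \<le> m" for i using Rn le(2) that by (auto simp: A_def)
  have Am: "A m = reach m fe ge (Suc k)" by (auto simp: A_def)
  have AS: "A (Suc i) = (if fe i \<in> ?R then insert (ge i) (A i) else A i)" for i
    unfolding A_def by (auto simp: less_Suc_eq)
  define I where "I = (\<lambda>i (s'::store). s' ''i'' 0 = int i \<and> (\<forall>v. 0 \<le> s' l v \<and> s' l v \<le> int k + 2) \<and>
     (\<forall>v. 0 < s' l (int v) \<longleftrightarrow> v \<in> A i) \<and>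
     (\<forall>v. 0 < s' l (int v) \<and> s' l (int v) \<le> int k + 1 \<longleftrightarrow> v \<in> ?R) \<and> s' ''c'' 0 = int (card (A i)))"
  define s0 where "s0 = s(''i'' := (s ''i'')(0 := 0))"
  have w: "writes (search_step f g l r) = {l, ''c'', ''i''}" unfolding search_step_def by auto
  have dd: "f \<noteq> l" "f \<noteq> ''c''" "f \<noteq> ''i''" "g \<noteq> l" "g \<noteq> ''c''" "g \<noteq> ''i''" "r \<noteq> l" "r \<noteq> ''c''" "r \<noteq> ''i''"
    "l \<noteq> ''i''" "l \<noteq> ''m''" "r \<noteq> ''m''" "''i'' \<noteq> l" "''c'' \<noteq> l" "''m'' \<noteq> l" "''c'' \<noteq> r" "''i'' \<noteq> r" "l \<noteq> r"
    using d by auto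
  have loop: "runs B \<rho> (While_less (var ''i'') (var ''m'') (search_step f g l r)) s0
    (\<lambda>t s'. t \<le> m * (60 + (1 + ops (var ''i'') + ops (var ''m''))) + (1 + ops (var ''i'') + ops (var ''m'')) \<and>
       agree (writes (search_step f g l r)) s0 s' \<and> I m s')"
  proof (rule runs_for)
    show "I 0 s0" using l s dd by (force simp: I_def s0_def A_def intro: order_trans[OF l(2)])
    fix i s' assume p: "I i s'" "agree (writes (search_step f g l r)) s0 s'" "i \<le> m"
    have e: "s' ''m'' 0 = int m" "s' f = s f" "s' g = s g" "s' r = s r"
      using agreeD[OF p(2), of "''m''"] agreeD[OF p(2), of f] agreeD[OF p(2), of g] agreeD[OF p(2), of r] s dd
      by (auto simp: w s0_def)
    have i: "s' ''i'' 0 = int i" using p(1) by (simp add: I_def)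
    have f: "fits B 0" "fits B (int i)" "fits B (int m)" using B p(3) by (auto simp: fits_cap)
    have "runs B \<rho> (search_step f g l r) s' (\<lambda>t s''. t \<le> 60 \<and> I (Suc i) s'')" if "i < m"
    proof (rule runs_mono[OF runs_search_step[OF d, where fe = fe and ge = ge and A = "A i" and R = ?R and e = i and k = k and m = m and n = n]])
      show "s' ''i'' 0 = int i" by (fact i)
    qed (use p s e le that B An[OF p(3)] in \<open>auto simp: I_def AS\<close>)
    then show "safe B \<rho> s' (var ''i'') \<and> safe B \<rho> s' (var ''m'') \<and>
      (val \<rho> s' (var ''i'') < val \<rho> s' (var ''m'') \<longleftrightarrow> i < m) \<and>
      (i < m \<longrightarrow> runs B \<rho> (search_step f g l r) s' (\<lambda>t s''. t \<le> 60 \<and> I (Suc i) s''))"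
      by (simp add: e i f)
  qed
  have ag: "agree (writes (search_step f g l r)) s0 s' \<longleftrightarrow> agree {l, ''c'', ''i''} s s'" for s'
    unfolding w s0_def by simp
  have f: "fits B 0" "fits B 1" "fits B (int k + 1)" "fits B (int k + 1 + 1)" "fits B (2 + int k)"
    using B by (auto simp: fits_cap)
  show ?thesis
    unfolding search_round_def
    apply (simp add: f del: reach.simps flip: s0_def)
    apply (rule runs_mono[OF loop])
    apply (unfold ag)
    subgoal for t s'
      using agreeD[of "{l, ''c'', ''i''}" s s' r] dd s(4)
      by (auto simp: I_def f agree_def simp del: reach.simps simp flip: Am)
    done
qed

text \<open>Termination is detected by counting: \<open>reach\<close> never leaves
  \<open>{..<n}\<close>, so it is complete as soon as it has \<open>n\<close> elements. The level
  \<open>N\<close> known to be complete, later the diameter, appears only in the analysis.\<close>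

lemma runs_search:
  fixes m n N :: nat and fe ge :: "nat \<Rightarrow> nat"
  assumes d: "distinct [f, g, l, r, ''i'', ''c'', ''m'', ''n'']"
    and s: "s ''m'' 0 = int m" "s ''n'' 0 = int n" "\<And>e. e < m \<Longrightarrow> s f (int e) = int (fe e)"
      "\<And>e. e < m \<Longrightarrow> s g (int e) = int (ge e)" "s l = (\<lambda>_. 0)"
    and le: "\<And>e. e < m \<Longrightarrow> fe e < n" "\<And>e. e < m \<Longrightarrow> ge e < n" "0 < n"
    and N: "{..<n} \<subseteq> reach m fe ge N"
    and B: "int n < cap B" "int m < cap B" "int N + 2 < cap B"
  shows "runs B \<rho> (search f g l r) s (\<lambda>t s'. t \<le> 100 * ((N + 1) * (m + 1)) \<and> agree {l, ''c'', ''i'', r} s s' \<and>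
     (\<exists>k\<le>N. s' r 0 = int k + 1 \<and> {..<n} \<subseteq> reach m fe ge k))"
proof -
  let ?R = "reach m fe ge"
  define I where "I = (\<lambda>k (s'::store). s' r 0 = int k + 1 \<and> s' ''c'' 0 = int (card (?R k)) \<and>
     (\<forall>v. 0 \<le> s' l v \<and> s' l v \<le> int k + 1) \<and> (\<forall>v. 0 < s' l (int v) \<longleftrightarrow> v \<in> ?R k))"
  have Rn: "?R k \<subseteq> {..<n}" for k using reach_less[of n m ge fe k] le by auto
  have full: "card (?R k) < n \<longleftrightarrow> \<not> {..<n} \<subseteq> ?R k" for k
    using Rn[of k] card_mono[OF _ Rn[of k]] card_subset_eq[OF _ Rn[of k]]
    by (metis card_lessThan equalityI finite_lessThan nat_less_le order_refl)
  have w: "writes (search_round f g l r) = {l, ''c'', ''i'', r}" unfolding search_round_def search_step_def by auto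
  have dd: "f \<noteq> l" "f \<noteq> ''c''" "f \<noteq> ''i''" "g \<noteq> l" "g \<noteq> ''c''" "g \<noteq> ''i''" "r \<noteq> l" "r \<noteq> ''c''" "r \<noteq> ''i''"
    "l \<noteq> ''i''" "l \<noteq> ''m''" "r \<noteq> ''m''" "l \<noteq> ''n''" "r \<noteq> ''n''" "''i'' \<noteq> l" "''c'' \<noteq> l" "''m'' \<noteq> l" "''c'' \<noteq> r" "''i'' \<noteq> r" "l \<noteq> r"
    "f \<noteq> r" "g \<noteq> r" "''m'' \<noteq> r" "''n'' \<noteq> r" "''n'' \<noteq> l"
    using d by auto
  define s0 where "s0 = s(r := (s r)(0 := 1), ''c'' := (s ''c'')(0 := 1), l := (\<lambda>_. 0)(0 := 1))"
  let ?c = "1 + ops (var ''c'') + ops (var ''n'')"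
  have loop: "runs B \<rho> (While_less (var ''c'') (var ''n'') (search_round f g l r)) s0
    (\<lambda>t s'. t \<le> N * (70 * m + 40 + ?c) + ?c \<and> agree (writes (search_round f g l r)) s0 s' \<and>
       (\<exists>k\<le>N. I k s' \<and> \<not> val \<rho> s' (var ''c'') < val \<rho> s' (var ''n'')))"
  proof (rule runs_While)
    show "I 0 s0" using s dd by (auto simp: I_def s0_def)
    fix k s' assume p: "I k s'" "agree (writes (search_round f g l r)) s0 s'"
    have e: "s' ''m'' 0 = int m" "s' ''n'' 0 = int n" "s' f = s f" "s' g = s g"
      using agreeD[OF p(2), of "''m''"] agreeD[OF p(2), of "''n''"] agreeD[OF p(2), of f] agreeD[OF p(2), of g] s dd
      by (auto simp: w s0_def)
    have c: "s' ''c'' 0 = int (card (?R k))" using p(1) by (simp add: I_def)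
    have "card (?R k) \<le> n" using card_mono[OF _ Rn[of k]] by simp
    then have f: "fits B 0" "fits B (int (card (?R k)))" "fits B (int n)" using B by (auto simp: fits_cap)
    have "k < N \<and> runs B \<rho> (search_round f g l r) s' (\<lambda>t s''. t \<le> 70 * m + 40 \<and> I (Suc k) s'')"
      if "card (?R k) < n"
    proof
      show "k < N"
        using that full[of k] N reach_mono[of N k m fe ge] by (metis not_less order_trans)
      then show "runs B \<rho> (search_round f g l r) s' (\<lambda>t s''. t \<le> 70 * m + 40 \<and> I (Suc k) s'')"
        by (intro runs_mono[OF runs_search_round[OF d, where fe = fe and ge = ge and k = k and m = m and n = n]])
          (use p(1) s e le B in \<open>auto simp: I_def algebra_simps simp del: reach.simps\<close>)
    qed
    then show "safe B \<rho> s' (var ''c'') \<and> safe B \<rho> s' (var ''n'') \<and>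
      (val \<rho> s' (var ''c'') < val \<rho> s' (var ''n'') \<longrightarrow> k < N \<and>
        runs B \<rho> (search_round f g l r) s' (\<lambda>t s''. t \<le> 70 * m + 40 \<and> I (Suc k) s''))"
      by (simp add: e c f)
  qed
  have ag: "agree (writes (search_round f g l r)) s0 s' \<longleftrightarrow> agree {l, ''c'', ''i'', r} s s'" for s'
    unfolding w s0_def by simp
  have f: "fits B 0" "fits B 1" using B by (auto simp: fits_cap)
  show ?thesis
    unfolding search_def using dd
    apply (simp add: f s flip: s0_def)
    apply (rule runs_mono[OF loop])
    apply (unfold ag)
    subgoal for t s'
      using agreeD[of "{l, ''c'', ''i'', r}" s s' "''n''"] dd s(2)
      by (auto simp: I_def algebra_simps full simp del: reach.simps)
    done
qed

section \<open>Minimum-weight walks of prescribed length\<close>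

text \<open>Level \<open>l\<close> of a table occupies \<open>n\<close> consecutive cells of a
  one-dimensional array. The value 0 outside the columns makes a cell update an equation between
  functions, as in \<open>grid_upd\<close>.\<close>

definition grid :: "nat \<Rightarrow> (int \<Rightarrow> int) \<Rightarrow> nat \<Rightarrow> nat \<Rightarrow> int" where
  "grid n F = (\<lambda>l v. if v < n then F (int l * int n + int v) else 0)"

lemma cell_eq_iff:
  fixes l k u v n :: nat
  assumes "u < n" "v < n"
  shows "int l * int n + int u = int k * int n + int v \<longleftrightarrow> l = k \<and> u = v"
proof
  assume "int l * int n + int u = int k * int n + int v"
  then have "int (l * n + u) = int (k * n + v)" by simp
  then have eq: "l * n + u = k * n + v" by (simp only: of_nat_eq_iff)
  then have "(l * n + u) div n = (k * n + v) div n" "(l * n + u) mod n = (k * n + v) mod n" by simp_all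
  with assms show "l = k \<and> u = v" by simp
qed simp

lemma grid_upd:
  "h < n \<Longrightarrow> grid n (F(int k * int n + int h := x)) = (grid n F)(k := (grid n F k)(h := x))"
  by (auto simp: grid_def fun_eq_iff cell_eq_iff)

lemma grid_eq: "v < n \<Longrightarrow> grid n F l v = F (int l * int n + int v)"
  by (simp add: grid_def)

text \<open>In the intended instance \<open>\<omega> e\<close> is a rounded weight between
  \<open>- W\<close> and \<open>W\<close> lowered by \<open>W + 1\<close>, whence
  \<open>M = 2 * W + 1\<close>.\<close>

locale arc_data =
  fixes m n :: nat and te he :: "nat \<Rightarrow> nat" and \<omega> :: "nat \<Rightarrow> int" and M :: int
  assumes te: "\<And>e. e < m \<Longrightarrow> te e < n" and he: "\<And>e. e < m \<Longrightarrow> he e < n"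
    and \<omega>: "\<And>e. e < m \<Longrightarrow> - M \<le> \<omega> e" "\<And>e. e < m \<Longrightarrow> \<omega> e < 0"
    and n: "0 < n"
begin

text \<open>
  All weights are negative, so the initial value \<open>0\<close> of a cell represents \<open>\<infinity>\<close>. The value at
  level \<open>l\<close> is the minimal weight of a walk of length \<open>l\<close> from vertex \<open>0\<close>, lowered by \<open>1\<close> to make the
  empty walk negative as well.
\<close>

definition table :: "nat \<Rightarrow> nat \<Rightarrow> (nat \<Rightarrow> nat \<Rightarrow> int) \<Rightarrow> (nat \<Rightarrow> nat \<Rightarrow> int) \<Rightarrow> bool" where
  "table k i G P \<longleftrightarrow>
     (\<forall>v<n. G 0 v = (if v = 0 then - 1 else 0)) \<and>
     (\<forall>l. \<forall>v<n. - 1 - int l * M \<le> G l v \<and> G l v \<le> 0) \<and>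
     (\<forall>l. \<forall>v<n. G (Suc l) v < 0 \<longrightarrow> (\<exists>e<m. P (Suc l) v = int e \<and> he e = v \<and> G l (te e) < 0 \<and>
        G (Suc l) v = G l (te e) + \<omega> e)) \<and>
     (\<forall>l. \<forall>e<m. l < k \<or> l = k \<and> e < i \<longrightarrow> G l (te e) < 0 \<longrightarrow> G (Suc l) (he e) \<le> G l (te e) + \<omega> e) \<and>
     (\<forall>l>Suc k. \<forall>v<n. G l v = 0)"

lemma table_start:
  "0 \<le> M \<Longrightarrow> table 0 0 ((\<lambda>_ _. 0)(0 := (\<lambda>_. 0)(0 := - 1))) (\<lambda>_ _. 0)"
  using n mult_nonneg_nonneg[of "int _" M] by (auto simp: table_def intro: order_trans[of "- 1" 0])

lemma table_next: "table k m G P \<Longrightarrow> table (Suc k) 0 G P"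
  unfolding table_def by (auto simp: less_Suc_eq)

lemma table_skip:
  assumes "table k i G P" "G k (te i) < 0 \<longrightarrow> G (Suc k) (he i) \<le> G k (te i) + \<omega> i"
  shows "table k (Suc i) G P"
  using assms unfolding table_def by (auto simp: less_Suc_eq)

text \<open>Overwriting a cell of level \<open>Suc k\<close> is harmless: the level after it is
  still empty, so no parent pointer relies on the old value, and the new value is smaller, so the
  inequalities established before survive.\<close>

lemma table_improve:
  assumes t: "table k i G P" and i: "i < m" and neg: "G k (te i) < 0"
    and imp: "G k (te i) + \<omega> i < G (Suc k) (he i)"
  shows "table k (Suc i) (G(Suc k := (G (Suc k))(he i := G k (te i) + \<omega> i)))
           (P(Suc k := (P (Suc k))(he i := int i)))"
    (is "table _ _ ?G ?P")
proof -
  have t1: "\<And>v. v < n \<Longrightarrow> G 0 v = (if v = 0 then - 1 else 0)"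
    and t2: "\<And>l v. v < n \<Longrightarrow> - 1 - int l * M \<le> G l v \<and> G l v \<le> 0"
    and t3: "\<And>l v. v < n \<Longrightarrow> G (Suc l) v < 0 \<Longrightarrow> \<exists>e<m. P (Suc l) v = int e \<and> he e = v \<and> G l (te e) < 0 \<and>
        G (Suc l) v = G l (te e) + \<omega> e"
    and t4: "\<And>l e. e < m \<Longrightarrow> l < k \<or> l = k \<and> e < i \<Longrightarrow> G l (te e) < 0 \<Longrightarrow> G (Suc l) (he e) \<le> G l (te e) + \<omega> e"
    and t5: "\<And>l v. Suc k < l \<Longrightarrow> v < n \<Longrightarrow> G l v = 0"
    using t unfolding table_def by blast+
  have "- 1 - int (Suc k) * M \<le> G k (te i) + \<omega> i"
    using t2[OF te[OF i], of k] \<omega>(1)[OF i] by (simp add: algebra_simps)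
  moreover have "G k (te i) + \<omega> i \<le> 0" using neg \<omega>(2)[OF i] by linarith
  ultimately have 2: "- 1 - int l * M \<le> ?G l v \<and> ?G l v \<le> 0" if "v < n" for l v
    using t2[OF that, of l] by auto
  have 3: "\<exists>e<m. ?P (Suc l) v = int e \<and> he e = v \<and> ?G l (te e) < 0 \<and> ?G (Suc l) v = ?G l (te e) + \<omega> e"
    if v: "v < n" and g: "?G (Suc l) v < 0" for l v
  proof (cases "l = k \<and> v = he i")
    case True
    with i neg show ?thesis by auto
  next
    case False
    then have e: "?G (Suc l) v = G (Suc l) v" "?P (Suc l) v = P (Suc l) v" by auto
    have "l \<noteq> Suc k" using g t5[of "Suc l" v] v by (auto simp: e)
    with t3[OF v] g show ?thesis unfolding e by auto
  qed
  have 4: "?G (Suc l) (he e) \<le> ?G l (te e) + \<omega> e"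
    if "e < m" "l < k \<or> l = k \<and> e < Suc i" "?G l (te e) < 0" for l e
  proof -
    have l: "?G l (te e) = G l (te e)" using that by auto
    show ?thesis
    proof (cases "l = k \<and> e = i")
      case True
      then show ?thesis by simp
    next
      case False
      then have "G (Suc l) (he e) \<le> G l (te e) + \<omega> e" using t4[of e l] that l by auto
      moreover have "?G (Suc l) (he e) \<le> G (Suc l) (he e)" using imp by auto
      ultimately show ?thesis unfolding l by linarith
    qed
  qed
  show ?thesis
    unfolding table_def using t1 2 3 4 t5 by (intro conjI allI impI) (simp_all del: fun_upd_apply, simp_all)
qed

end

text \<open>\<open>u\<close> and \<open>v\<close> are the offsets of the current and the next level.
  The array \<open>b\<close> keeps the weights unshifted, hence the subtraction of
  \<open>g\<close>.\<close>

definition relax :: prog where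
  "relax =
     put ''y'' (var ''u'' [+] Rd ''tail'' (var ''i'')) ;;
     If_less (Rd ''F'' (var ''y'')) (Lit 0)
       (put ''x'' (Rd ''F'' (var ''y'') [+] Rd ''b'' (var ''i'') [-] var ''g'') ;;
        put ''z'' (var ''v'' [+] Rd ''head'' (var ''i'')) ;;
        If_less (var ''x'') (Rd ''F'' (var ''z''))
          (Assign ''F'' (var ''z'') (var ''x'') ;; Assign ''Q'' (var ''z'') (var ''i'')) Skip)
       Skip ;;
     put ''i'' (var ''i'' [+] Lit 1)"

definition relax_all :: prog where
  "relax_all =
     put ''i'' (Lit 0) ;;
     While_less (var ''i'') (var ''m'') relax ;;
     put ''k'' (var ''k'' [+] Lit 1) ;; put ''u'' (var ''v'') ;; put ''v'' (var ''v'' [+] var ''n'')"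

definition walks :: prog where
  "walks =
     Assign ''F'' (Lit 0) (Lit (- 1)) ;;
     put ''k'' (Lit 0) ;; put ''u'' (Lit 0) ;; put ''v'' (var ''n'') ;;
     While_less (var ''k'') (var ''K'') relax_all"

context arc_data
begin

definition loaded :: "store \<Rightarrow> bool" where
  "loaded s \<longleftrightarrow> s ''m'' 0 = int m \<and> s ''n'' 0 = int n \<and>
     (\<forall>e<m. s ''tail'' (int e) = int (te e) \<and> s ''head'' (int e) = int (he e) \<and>
        s ''b'' (int e) - s ''g'' 0 = \<omega> e \<and> \<bar>s ''b'' (int e)\<bar> \<le> M) \<and> 0 \<le> s ''g'' 0 \<and> s ''g'' 0 \<le> M"

lemma loaded_agree:
  "loaded s \<Longrightarrow> agree X s s' \<Longrightarrow> X \<inter> {''m'', ''n'', ''tail'', ''head'', ''b'', ''g''} = {} \<Longrightarrow> loaded s'"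
  using agreeD[of X s s' "''m''"] agreeD[of X s s' "''n''"] agreeD[of X s s' "''tail''"]
    agreeD[of X s s' "''head''"] agreeD[of X s s' "''b''"] agreeD[of X s s' "''g''"]
  unfolding loaded_def by auto

text \<open>The first product bounds array indices; the second bounds the products of a table entry
  and a walk length that are compared in \<open>select\<close>.\<close>

definition roomy :: "nat \<Rightarrow> nat \<Rightarrow> bool" where
  "roomy K B \<longleftrightarrow> (int K + 2) * int n < cap B \<and> (2 + (int K + 1) * M) * (int K + 1) < cap B \<and> int m < cap B"

lemma roomyD:
  assumes "roomy K B" "0 \<le> M"
  shows "int m < cap B" "int K + 1 < cap B" "l \<le> K + 1 \<Longrightarrow> v < n \<Longrightarrow> int l * int n + int v < cap B"
    "l \<le> K + 1 \<Longrightarrow> 1 + int l * M < cap B" "int n < cap B"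
    "l \<le> K \<Longrightarrow> j \<le> K + 1 \<Longrightarrow> (1 + int l * M) * int j < cap B" "l \<le> K + 2 \<Longrightarrow> int l * int n < cap B"
proof -
  have r: "(int K + 2) * int n < cap B" "(2 + (int K + 1) * M) * (int K + 1) < cap B" "int m < cap B"
    using assms by (auto simp: roomy_def)
  have "0 \<le> (int K + 1) * M" using assms by simp
  then have a: "(2 + 0) * (int K + 1) \<le> (2 + (int K + 1) * M) * (int K + 1)"
    by (intro mult_right_mono) auto
  then show "int K + 1 < cap B" using r by simp
  have b: "(2 + (int K + 1) * M) * 1 \<le> (2 + (int K + 1) * M) * (int K + 1)"
    using \<open>0 \<le> (int K + 1) * M\<close> by (intro mult_left_mono) auto
  have lM: "int l * M \<le> (int K + 1) * M" if "l \<le> K + 1" for l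
    using that assms by (intro mult_right_mono) auto
  have "2 + (int K + 1) * M < cap B" using b r by simp
  then show "1 + int l * M < cap B" if "l \<le> K + 1" using lM[OF that] by linarith
  have ln: "int l * int n \<le> (int K + 2) * int n" if "l \<le> K + 2" for l
    using that by (intro mult_right_mono) auto
  then show "int l * int n < cap B" if "l \<le> K + 2" using that r by fastforce
  show "int n < cap B" using ln[of 1] r by simp
  show "int l * int n + int v < cap B" if "l \<le> K + 1" "v < n"
  proof -
    have "int l * int n + int v \<le> int (l + 1) * int n" using that by (simp add: algebra_simps)
    also have "\<dots> \<le> (int K + 2) * int n" using that by (intro ln) simp
    finally show ?thesis using r by simp
  qed
  show "(1 + int l * M) * int j < cap B" if "l \<le> K" "j \<le> K + 1"
  proof -
    have "(1 + int l * M) * int j \<le> (2 + (int K + 1) * M) * (int K + 1)"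
      using that lM[of l] assms by (intro mult_mono) auto
    then show ?thesis using r by simp
  qed
  show "int m < cap B" by (fact r)
qed

lemma runs_relax:
  assumes l: "loaded s" and i: "s ''i'' 0 = int i" "i < m" and k: "k < K"
    and u: "s ''u'' 0 = int k * int n" "s ''v'' 0 = (int k + 1) * int n"
    and t: "table k i (grid n (s ''F'')) (grid n (s ''Q''))"
    and B: "roomy K B" and M: "1 \<le> M"
  shows "runs B \<rho> relax s (\<lambda>t s'. t \<le> 60 \<and> agree {''y'', ''x'', ''z'', ''F'', ''Q'', ''i''} s s' \<and> s' ''i'' 0 = int i + 1 \<and>
     table k (Suc i) (grid n (s' ''F'')) (grid n (s' ''Q'')))"
proof -
  have M0: "0 \<le> M" using M by simp
  note r = roomyD[OF B M0]
  let ?G = "grid n (s ''F'')"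
  have e: "s ''tail'' (int i) = int (te i)" "s ''head'' (int i) = int (he i)" "s ''b'' (int i) = \<omega> i + s ''g'' 0"
    "\<bar>s ''b'' (int i)\<bar> \<le> M" "0 \<le> s ''g'' 0" "s ''g'' 0 \<le> M"
    using l i by (auto simp: loaded_def algebra_simps)
  have G: "s ''F'' (int k * int n + int (te i)) = ?G k (te i)"
    "s ''F'' ((int k + 1) * int n + int (he i)) = ?G (Suc k) (he i)"
    using te he i by (auto simp: grid_eq algebra_simps)
  have G1: "- 1 - int k * M \<le> ?G k (te i)" "?G k (te i) \<le> 0"
    "- 1 - int (Suc k) * M \<le> ?G (Suc k) (he i)" "?G (Suc k) (he i) \<le> 0"
    using t te[OF i(2)] he[OF i(2)] unfolding table_def by blast+
  have kM: "int (Suc k) * M = int k * M + M" by (simp add: algebra_simps)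
  have kn: "(int k + 1) * int n = int (Suc k) * int n" by simp
  have "0 \<le> int k * M" using M by simp
  have "1 + (int k * M + M) < cap B" using r(4)[of "Suc k"] k kM by simp
  then have f1: "fits B (?G k (te i))" "fits B (?G (Suc k) (he i))" "fits B (\<omega> i + s ''g'' 0)" "fits B (s ''g'' 0)"
    "fits B (?G k (te i) + (\<omega> i + s ''g'' 0))" "fits B (?G k (te i) + \<omega> i)"
    using G1 e(3-6) \<open>0 \<le> int k * M\<close> M \<omega>[OF i(2)] unfolding fits_cap kM by (auto simp: abs_less_iff)
  have f2: "fits B 0" "fits B 1" "fits B (int i)" "fits B (int i + 1)" "fits B (int k * int n)"
    "fits B ((int k + 1) * int n)" "fits B (int (te i))" "fits B (int (he i))"
    "fits B (int k * int n + int (te i))" "fits B ((int k + 1) * int n + int (he i))"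
    using r(1,2,5) r(3)[of k "te i"] r(3)[of "Suc k" "he i"] r(7)[of k] r(7)[of "Suc k"] i k te[OF i(2)] he[OF i(2)]
    unfolding fits_cap kn by auto
  define h where "h = (int k + 1) * int n + int (he i)"
  have Gh: "s ''F'' h = ?G (Suc k) (he i)" unfolding h_def by (fact G(2))
  have up: "grid n ((s ''F'')(h := ?G k (te i) + \<omega> i)) = ?G(Suc k := (?G (Suc k))(he i := ?G k (te i) + \<omega> i))"
     "grid n ((s ''Q'')(h := int i)) = (grid n (s ''Q''))(Suc k := (grid n (s ''Q'') (Suc k))(he i := int i))"
    unfolding h_def kn using he[OF i(2)] by (rule grid_upd)+
  consider "?G k (te i) < 0" "?G k (te i) + \<omega> i < ?G (Suc k) (he i)" |
    "?G k (te i) < 0" "\<not> ?G k (te i) + \<omega> i < ?G (Suc k) (he i)" | "\<not> ?G k (te i) < 0" by blast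
  then show ?thesis
  proof cases
    case 1
    from table_improve[OF t i(2) 1] have "table k (Suc i) (grid n ((s ''F'')(h := ?G k (te i) + \<omega> i))) (grid n ((s ''Q'')(h := int i)))"
      unfolding up .
    then show ?thesis
      unfolding relax_def using 1 f2(9,10) G e(5,6)
      by (simp add: i u e(1-3) f1 f2(1-8) G Gh flip: h_def)
  next
    case 2
    then have "table k (Suc i) ?G (grid n (s ''Q''))" by (intro table_skip[OF t]) simp
    then show ?thesis
      unfolding relax_def using 2 f2(9,10) by (simp add: i u e(1-3) f1 f2(1-8) G Gh flip: h_def)
  next
    case 3
    then have "table k (Suc i) ?G (grid n (s ''Q''))" by (intro table_skip[OF t]) simp
    then show ?thesis
      unfolding relax_def using 3 f2(9,10) by (simp add: i u e(1-3) f1 f2(1-8) G Gh flip: h_def)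
  qed
qed


lemma runs_relax_all:
  assumes l: "loaded s" and k: "s ''k'' 0 = int k" "k < K"
    and u: "s ''u'' 0 = int k * int n" "s ''v'' 0 = (int k + 1) * int n"
    and t: "table k 0 (grid n (s ''F'')) (grid n (s ''Q''))"
    and B: "roomy K B" and M: "1 \<le> M"
  shows "runs B \<rho> relax_all s (\<lambda>t s'. t \<le> 70 * m + 70 \<and>
     agree {''y'', ''x'', ''z'', ''F'', ''Q'', ''i'', ''k'', ''u'', ''v''} s s' \<and> s' ''k'' 0 = int k + 1 \<and>
     s' ''u'' 0 = (int k + 1) * int n \<and> s' ''v'' 0 = (int k + 2) * int n \<and>
     table (Suc k) 0 (grid n (s' ''F'')) (grid n (s' ''Q'')))"
proof -
  note r = roomyD[OF B order_trans[OF zero_le_one M]]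
  define I where "I = (\<lambda>i (s'::store). s' ''i'' 0 = int i \<and> table k i (grid n (s' ''F'')) (grid n (s' ''Q'')))"
  define s0 where "s0 = s(''i'' := (s ''i'')(0 := 0))"
  have w: "writes relax = {''y'', ''x'', ''z'', ''F'', ''Q'', ''i''}" unfolding relax_def by auto
  have loop: "runs B \<rho> (While_less (var ''i'') (var ''m'') relax) s0
    (\<lambda>t s'. t \<le> m * (60 + (1 + ops (var ''i'') + ops (var ''m''))) + (1 + ops (var ''i'') + ops (var ''m'')) \<and>
       agree (writes relax) s0 s' \<and> I m s')"
  proof (rule runs_for)
    show "I 0 s0" using t by (simp add: I_def s0_def)
    fix i s' assume p: "I i s'" "agree (writes relax) s0 s'" "i \<le> m"
    have "loaded s0" using l by (simp add: loaded_def s0_def)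
    then have l': "loaded s'" using p(2) by (rule loaded_agree) (simp add: w)
    have e: "s' ''u'' 0 = int k * int n" "s' ''v'' 0 = (int k + 1) * int n" "s' ''i'' 0 = int i"
      using agreeD[OF p(2), of "''u''"] agreeD[OF p(2), of "''v''"] u p(1) by (simp_all add: w s0_def I_def)
    have f: "fits B 0" "fits B (int i)" "fits B (int m)" using r(1) p(3) by (auto simp: fits_cap)
    have "runs B \<rho> relax s' (\<lambda>t s''. t \<le> 60 \<and> I (Suc i) s'')" if "i < m"
      by (rule runs_mono[OF runs_relax[OF l' e(3) that k(2) e(1,2) _ B M]]) (use p(1) in \<open>auto simp: I_def\<close>)
    moreover have "s' ''m'' 0 = int m" using l' by (simp add: loaded_def)
    ultimately show "safe B \<rho> s' (var ''i'') \<and> safe B \<rho> s' (var ''m'') \<and>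
      (val \<rho> s' (var ''i'') < val \<rho> s' (var ''m'') \<longleftrightarrow> i < m) \<and>
      (i < m \<longrightarrow> runs B \<rho> relax s' (\<lambda>t s''. t \<le> 60 \<and> I (Suc i) s''))"
      by (simp add: e f)
  qed
  have ag: "agree (writes relax) s0 s' \<longleftrightarrow> agree {''y'', ''x'', ''z'', ''F'', ''Q'', ''i''} s s'" for s'
    unfolding w s0_def by simp
  have f: "fits B 0" "fits B 1" "fits B (int k)" "fits B (int k + 1)" "fits B (int n)" "fits B ((int k + 1) * int n)"
    "fits B ((int k + 1) * int n + int n)"
    using r(2,5) r(7)[of "Suc k"] r(7)[of "Suc (Suc k)"] k by (auto simp: fits_cap algebra_simps)
  show ?thesis
    unfolding relax_all_def
    apply (simp add: f flip: s0_def)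
    apply (rule runs_mono[OF loop])
    apply (unfold ag I_def)
    subgoal premises p for t s'
    proof -
      have a: "agree {''y'', ''x'', ''z'', ''F'', ''Q'', ''i''} s s'" using p by blast
      have e: "s' ''k'' 0 = int k" "s' ''v'' 0 = (int k + 1) * int n" "s' ''n'' 0 = int n"
        using agreeD[OF a, of "''k''"] agreeD[OF a, of "''v''"] agreeD[OF a, of "''n''"] k u l
        by (auto simp: loaded_def)
      have a': "agree {''y'', ''x'', ''z'', ''F'', ''Q'', ''i'', ''k'', ''u'', ''v''} s s'"
        using a by (auto simp: agree_def)
      show ?thesis
        using p a' table_next[of k] f(7) by (simp add: e f(1-6)) (simp add: algebra_simps)
    qed
    done
qed

lemma runs_walks:
  assumes l: "loaded s" and K: "s ''K'' 0 = int K" and F: "s ''F'' = (\<lambda>_. 0)" "s ''Q'' = (\<lambda>_. 0)"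
    and B: "roomy K B" and M: "1 \<le> M"
  shows "runs B \<rho> walks s (\<lambda>t s'. t \<le> 100 * (K + 1) * (m + 1) \<and>
     agree {''y'', ''x'', ''z'', ''F'', ''Q'', ''i'', ''k'', ''u'', ''v''} s s' \<and>
     table K 0 (grid n (s' ''F'')) (grid n (s' ''Q'')))"
proof -
  note r = roomyD[OF B order_trans[OF zero_le_one M]]
  define I where "I = (\<lambda>k (s'::store). s' ''k'' 0 = int k \<and> s' ''u'' 0 = int k * int n \<and>
     s' ''v'' 0 = (int k + 1) * int n \<and> table k 0 (grid n (s' ''F'')) (grid n (s' ''Q'')))"
  define s0 where "s0 = s(''F'' := (\<lambda>_. 0)(0 := - 1), ''k'' := (s ''k'')(0 := 0), ''u'' := (s ''u'')(0 := 0),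
     ''v'' := (s ''v'')(0 := int n))"
  have w: "writes relax_all = {''y'', ''x'', ''z'', ''F'', ''Q'', ''i'', ''k'', ''u'', ''v''}"
    unfolding relax_all_def relax_def by auto
  \<comment> \<open>The zero store is already a table with all cells infinite; only the cell of the
    empty walk has to be written.\<close>
  have "grid n ((\<lambda>_. 0)(0 := - 1)) = (\<lambda>_ _. 0)(0 := (\<lambda>_. 0)(0 := - 1))"
    using grid_upd[of 0 n "\<lambda>_. 0" 0 "- 1"] n by (simp add: grid_def)
  then have t0: "table 0 0 (grid n ((\<lambda>_. 0)(0 := - 1))) (grid n (\<lambda>_. 0))"
    using table_start M by (simp add: grid_def)
  let ?c = "1 + ops (var ''k'') + ops (var ''K'')"
  have loop: "runs B \<rho> (While_less (var ''k'') (var ''K'') relax_all) s0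
    (\<lambda>t s'. t \<le> K * (70 * m + 70 + ?c) + ?c \<and> agree (writes relax_all) s0 s' \<and> I K s')"
  proof (rule runs_for)
    show "I 0 s0" using t0 F by (simp add: I_def s0_def)
    fix k s' assume p: "I k s'" "agree (writes relax_all) s0 s'" "k \<le> K"
    have "loaded s0" using l by (simp add: loaded_def s0_def)
    then have l': "loaded s'" using p(2) by (rule loaded_agree) (simp add: w)
    have e: "s' ''k'' 0 = int k" "s' ''u'' 0 = int k * int n" "s' ''v'' 0 = (int k + 1) * int n" "s' ''K'' 0 = int K"
      "table k 0 (grid n (s' ''F'')) (grid n (s' ''Q''))"
      using agreeD[OF p(2), of "''K''"] K p(1) by (simp_all add: w s0_def I_def)
    have f: "fits B 0" "fits B (int k)" "fits B (int K)" using r(2) p(3) by (auto simp: fits_cap)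
    have "runs B \<rho> relax_all s' (\<lambda>t s''. t \<le> 70 * m + 70 \<and> I (Suc k) s'')" if "k < K"
      by (rule runs_mono[OF runs_relax_all[OF l' e(1) that e(2,3,5) B M]]) (auto simp: I_def add.commute)
    then show "safe B \<rho> s' (var ''k'') \<and> safe B \<rho> s' (var ''K'') \<and>
      (val \<rho> s' (var ''k'') < val \<rho> s' (var ''K'') \<longleftrightarrow> k < K) \<and>
      (k < K \<longrightarrow> runs B \<rho> relax_all s' (\<lambda>t s''. t \<le> 70 * m + 70 \<and> I (Suc k) s''))"
      by (simp add: e f)
  qed
  have ag: "agree (writes relax_all) s0 s' \<longleftrightarrow>
      agree {''y'', ''x'', ''z'', ''F'', ''Q'', ''i'', ''k'', ''u'', ''v''} s s'" for s'
    unfolding w s0_def by simp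
  have f: "fits B 0" "fits B (- 1)" "fits B (int n)"
    using r(2,5) by (auto simp: fits_cap)
  have n': "s ''n'' 0 = int n" using l by (simp add: loaded_def)
  show ?thesis
    unfolding walks_def
    apply (simp add: f F n' flip: s0_def)
    apply (rule runs_mono[OF loop])
    apply (unfold ag I_def)
    apply (simp add: algebra_simps)
    done
qed

end

section \<open>The best closed walk\<close>

text \<open>Closed walks through 0 sit in column 0, that is at index \<open>k * n\<close>. Adding 1
  undoes the offset of the table, so that \<open>R / d\<close> is the mean of an actual closed
  walk.\<close>

definition select_body :: prog where
  "select_body =
     If_less (Rd ''F'' (var ''u'')) (Lit 0)
       (If_less ((Rd ''F'' (var ''u'') [+] Lit 1) [*] var ''d'') (var ''R'' [*] var ''k'')
         (put ''R'' (Rd ''F'' (var ''u'') [+] Lit 1) ;; put ''d'' (var ''k'')) Skip)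
       Skip ;;
     put ''k'' (var ''k'' [+] Lit 1) ;; put ''u'' (var ''u'' [+] var ''n'')"

definition select :: prog where
  "select =
     put ''d'' (Lit 0) ;; put ''R'' (Lit 1) ;; put ''k'' (Lit 1) ;; put ''u'' (var ''n'') ;;
     While_less (var ''k'') (var ''K'' [+] Lit 1) select_body"

text \<open>The ratio \<open>R / d = 1 / 0\<close> stands for \<open>\<infinity>\<close>.\<close>

definition best :: "nat \<Rightarrow> (nat \<Rightarrow> nat \<Rightarrow> int) \<Rightarrow> int \<Rightarrow> nat \<Rightarrow> bool" where
  "best i G R d \<longleftrightarrow> (d = 0 \<and> R = 1 \<or> 0 < d \<and> d \<le> i \<and> G d 0 < 0 \<and> R = G d 0 + 1) \<and>
     (\<forall>l\<in>{1..i}. G l 0 < 0 \<longrightarrow> R * int l \<le> (G l 0 + 1) * int d)"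

lemma best_keep:
  assumes "best i G R d" "G (Suc i) 0 < 0 \<longrightarrow> \<not> (G (Suc i) 0 + 1) * int d < R * (int i + 1)"
  shows "best (Suc i) G R d"
  using assms unfolding best_def by (auto simp: le_Suc_eq atLeastAtMostSuc_conv algebra_simps)

text \<open>Transitivity of the order of fractions, obtained by multiplying through with the old
  denominator \<open>d\<close> and cancelling it.\<close>

lemma best_replace:
  assumes b: "best i G R d" and neg: "G (Suc i) 0 < 0" and less: "(G (Suc i) 0 + 1) * int d < R * (int i + 1)"
  shows "best (Suc i) G (G (Suc i) 0 + 1) (Suc i)"
proof -
  let ?N = "G (Suc i) 0 + 1"
  have "?N * int l \<le> (G l 0 + 1) * int (Suc i)" if l: "l \<in> {1..i}" "G l 0 < 0" for l
  proof -
    have *: "R * int l \<le> (G l 0 + 1) * int d" using b l unfolding best_def by blast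
    \<comment> \<open>With the initial ratio \<open>1 / 0\<close> the invariant at a finite cell of
      length \<open>l\<close> would read \<open>l \<le> 0\<close>.\<close>
    have "d \<noteq> 0"
    proof
      assume "d = 0"
      with b have "R = 1" unfolding best_def by auto
      with * \<open>d = 0\<close> l show False by simp
    qed
    have "?N * int l * int d = (?N * int d) * int l" by (simp add: algebra_simps)
    also have "\<dots> \<le> (R * (int i + 1)) * int l" using less by (intro mult_right_mono) auto
    also have "\<dots> = (R * int l) * (int i + 1)" by (simp add: algebra_simps)
    also have "\<dots> \<le> ((G l 0 + 1) * int d) * (int i + 1)" using * by (intro mult_right_mono) auto
    finally have "?N * int l * int d \<le> ((G l 0 + 1) * int (Suc i)) * int d" by (simp add: algebra_simps)
    with \<open>d \<noteq> 0\<close> show ?thesis by simp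
  qed
  with neg show ?thesis unfolding best_def by (auto simp: le_Suc_eq atLeastAtMostSuc_conv)
qed

context arc_data
begin

lemma runs_select:
  assumes l: "loaded s" and K: "s ''K'' 0 = int K"
    and t: "table K 0 (grid n (s ''F'')) (grid n (s ''Q''))"
    and B: "roomy K B" and M: "1 \<le> M"
  shows "runs B \<rho> select s (\<lambda>t s'. t \<le> 100 * (K + 1) \<and> agree {''d'', ''R'', ''k'', ''u''} s s' \<and>
     (\<exists>d. s' ''d'' 0 = int d \<and> best K (grid n (s ''F'')) (s' ''R'' 0) d))"
proof -
  note r = roomyD[OF B order_trans[OF zero_le_one M]]
  let ?G = "grid n (s ''F'')"
  define I where "I = (\<lambda>i (s'::store). s' ''k'' 0 = int i + 1 \<and> s' ''u'' 0 = (int i + 1) * int n \<and>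
     (\<exists>d. s' ''d'' 0 = int d \<and> best i ?G (s' ''R'' 0) d))"
  define s0 where "s0 = s(''d'' := (s ''d'')(0 := 0), ''R'' := (s ''R'')(0 := 1), ''k'' := (s ''k'')(0 := 1),
     ''u'' := (s ''u'')(0 := int n))"
  have w: "writes select_body = {''d'', ''R'', ''k'', ''u''}" unfolding select_body_def by auto
  have G: "- 1 - int l * M \<le> ?G l 0" "?G l 0 \<le> 0" for l
    using t n unfolding table_def by blast+
  let ?b = "var ''K'' [+] Lit 1"
  let ?c = "1 + ops (var ''k'') + ops ?b"
  have loop: "runs B \<rho> (While_less (var ''k'') ?b select_body) s0
    (\<lambda>t s'. t \<le> K * (70 + ?c) + ?c \<and> agree (writes select_body) s0 s' \<and> I K s')"
  proof (rule runs_for)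
    show "I 0 s0" by (simp add: I_def s0_def best_def)
    fix i s' assume p: "I i s'" "agree (writes select_body) s0 s'" "i \<le> K"
    have "loaded s0" using l by (simp add: loaded_def s0_def)
    then have l': "loaded s'" using p(2) by (rule loaded_agree) (simp add: w)
    obtain d where e: "s' ''k'' 0 = int i + 1" "s' ''u'' 0 = (int i + 1) * int n" "s' ''d'' 0 = int d"
      and b: "best i ?G (s' ''R'' 0) d"
      using p(1) by (auto simp: I_def)
    have e': "s' ''K'' 0 = int K" "s' ''F'' = s ''F''" "s' ''n'' 0 = int n"
      using agreeD[OF p(2), of "''K''"] agreeD[OF p(2), of "''F''"] K l' by (simp_all add: w s0_def loaded_def)
    have f: "fits B 0" "fits B 1" "fits B (int i + 1)" "fits B (int K)" "fits B (int K + 1)" "fits B (int n)"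
      using r(2,5) p(3) by (auto simp: fits_cap)
    have "runs B \<rho> select_body s' (\<lambda>t s''. t \<le> 70 \<and> I (Suc i) s'')" if "i < K"
    proof -
      let ?g = "?G (Suc i) 0" and ?R = "s' ''R'' 0"
      have g: "s ''F'' ((int i + 1) * int n) = ?g" using n by (simp add: grid_eq algebra_simps)
      have d: "d \<le> K" using b that unfolding best_def by auto
      have absg: "\<bar>?G l 0 + 1\<bar> \<le> 1 + int l * M" for l
      proof -
        have "0 \<le> int l * M" using M by simp
        then show ?thesis using G[of l] by linarith
      qed
      have absR: "\<bar>?R\<bar> \<le> 1 + int d * M"
      proof -
        have "0 \<le> int d * M" using M by simp
        then show ?thesis using b absg[of d] unfolding best_def by auto
      qed
      have "\<bar>(?g + 1) * int d\<bar> \<le> (1 + int (Suc i) * M) * int d"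
        unfolding abs_mult using absg[of "Suc i"] by (intro mult_mono) auto
      also have "\<dots> < cap B" using r(6)[of "Suc i" d] that d by simp
      finally have f1: "fits B ((?g + 1) * int d)" by (simp add: fits_cap)
      have "\<bar>?R * (int i + 1)\<bar> \<le> (1 + int d * M) * int (Suc i)"
        unfolding abs_mult using absR M by (intro mult_mono) auto
      also have "\<dots> < cap B" using r(6)[of d "Suc i"] that d by simp
      finally have f2: "fits B (?R * (int i + 1))" by (simp add: fits_cap)
      have "1 + int (Suc i) * M < cap B" using r(4)[of "Suc i"] that by simp
      then have f3: "fits B (?g + 1)" "fits B ?g"
        using absg[of "Suc i"] G[of "Suc i"] unfolding fits_cap by linarith+
      have f4: "fits B ?R" "fits B (int d)" "fits B ((int i + 1) * int n)" "fits B ((int i + 1) * int n + int n)"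
        "fits B (int i + 1 + 1)"
        using absR r(4)[of d] r(2) r(7)[of "Suc i"] r(7)[of "Suc (Suc i)"] d that
        by (auto simp: fits_cap algebra_simps)
      consider "?g < 0" "(?g + 1) * int d < ?R * (int i + 1)" | "?g < 0" "\<not> (?g + 1) * int d < ?R * (int i + 1)"
        | "\<not> ?g < 0" by blast
      then show ?thesis
      proof cases
        case 1
        have "int (Suc i) = int i + 1" by simp
        with best_replace[OF b 1] have "\<exists>d. int i + 1 = int d \<and> best (Suc i) ?G (?g + 1) d" by metis
        then show ?thesis
          unfolding select_body_def using 1 f1 f2 f3 f4
          by (simp add: e e' f g I_def) (simp add: algebra_simps)
      next
        case 2
        then have "best (Suc i) ?G ?R d" by (intro best_keep[OF b]) simp
        with 2 show ?thesis
          unfolding select_body_def using f1 f2 f3 f4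
          by (simp add: e e' f g I_def) (simp add: algebra_simps)
      next
        case 3
        then have "best (Suc i) ?G ?R d" by (intro best_keep[OF b]) simp
        with 3 show ?thesis
          unfolding select_body_def using f1 f2 f3 f4
          by (simp add: e e' f g I_def) (simp add: algebra_simps)
      qed
    qed
    then show "safe B \<rho> s' (var ''k'') \<and> safe B \<rho> s' ?b \<and>
      (val \<rho> s' (var ''k'') < val \<rho> s' ?b \<longleftrightarrow> i < K) \<and>
      (i < K \<longrightarrow> runs B \<rho> select_body s' (\<lambda>t s''. t \<le> 70 \<and> I (Suc i) s''))"
      by (auto simp: e e' f)
  qed
  have ag: "agree (writes select_body) s0 s' \<longleftrightarrow> agree {''d'', ''R'', ''k'', ''u''} s s'" for s'
    unfolding w s0_def by simp
  have f: "fits B 0" "fits B 1" "fits B (int n)"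
    using r(2,5) by (auto simp: fits_cap)
  have n': "s ''n'' 0 = int n" using l by (simp add: loaded_def)
  show ?thesis
    unfolding select_def
    apply (simp add: f n' flip: s0_def)
    apply (rule runs_mono[OF loop])
    apply (unfold ag I_def)
    apply simp
    done
qed

end

section \<open>Splitting a closed walk into cycles\<close>

text \<open>The stack holds the walk backwards, so reading it from the top writes the cycle in
  forward order.\<close>

definition copy_body :: prog where
  "copy_body = Assign ''out'' (var ''j'') (Rd ''st'' (var ''T'' [-] Lit 1 [-] var ''j'')) ;;
     put ''j'' (var ''j'' [+] Lit 1)"

definition copy :: prog where
  "copy = put ''len'' (var ''T'' [-] var ''i'') ;; put ''j'' (Lit 0) ;;
     While_less (var ''j'') (var ''len'') copy_body"

text \<open>\<open>ps\<close> holds prefix sums of the shifted weights along the stack, so the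
  weight of a top segment is a single subtraction, whatever its length.\<close>

definition push :: prog where
  "push =
     put ''e'' (Rd ''Q'' (var ''u'' [+] var ''y'')) ;;
     Assign ''st'' (var ''T'') (var ''e'') ;;
     Assign ''pos'' (var ''y'') (var ''T'') ;;
     Assign ''ps'' (var ''T'' [+] Lit 1) (Rd ''ps'' (var ''T'') [+] Rd ''b'' (var ''e'') [-] var ''g'') ;;
     put ''T'' (var ''T'' [+] Lit 1) ;;
     put ''y'' (Rd ''tail'' (var ''e'')) ;;
     put ''u'' (var ''u'' [-] var ''n'') ;;
     put ''k'' (var ''k'' [-] Lit 1) ;;
     put ''i'' (Rd ''pos'' (var ''y''))"

text \<open>
  Entries of \<open>pos\<close> are never erased: the one for \<open>y\<close> is meaningful only if the arc at that stack
  position has head \<open>y\<close>, and this is what the tests below establish.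
\<close>

definition pop :: prog where
  "pop =
     If_less (var ''i'') (var ''T'')
       (If_less (Rd ''head'' (Rd ''st'' (var ''i''))) (var ''y'' [+] Lit 1)
         (If_less (var ''y'') (Rd ''head'' (Rd ''st'' (var ''i'')) [+] Lit 1)
           (If_less ((Rd ''ps'' (var ''T'') [-] Rd ''ps'' (var ''i'')) [*] var ''d'')
              (var ''R'' [*] (var ''T'' [-] var ''i'') [+] Lit 1) copy Skip ;;
            put ''T'' (var ''i'')) Skip) Skip) Skip"

definition follow_body :: prog where
  "follow_body = push ;; pop"

definition follow :: prog where
  "follow =
     put ''T'' (Lit 0) ;; put ''y'' (Lit 0) ;; put ''k'' (var ''d'') ;; put ''u'' (var ''d'' [*] var ''n'') ;;
     While_less (Lit 0) (var ''k'') follow_body"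

lemma runs_copy:
  fixes p t n :: nat
  assumes s: "s ''T'' 0 = int t" "s ''i'' 0 = int p" "p < t" "t \<le> n"
    and st: "\<And>j. j < t \<Longrightarrow> fits B (s ''st'' (int j))" and B: "int n + 1 < cap B"
  shows "runs B \<rho> copy s (\<lambda>u s'. u \<le> 40 * (n + 1) \<and> agree {''len'', ''j'', ''out''} s s' \<and>
     s' ''len'' 0 = int (t - p) \<and> (\<forall>j<t - p. s' ''out'' (int j) = s ''st'' (int (t - 1 - j))))"
proof -
  define I where "I = (\<lambda>i (s'::store). s' ''j'' 0 = int i \<and> (\<forall>j<i. s' ''out'' (int j) = s ''st'' (int (t - 1 - j))))"
  define s0 where "s0 = s(''len'' := (s ''len'')(0 := int t - int p), ''j'' := (s ''j'')(0 := 0))"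
  have w: "writes copy_body = {''out'', ''j''}" unfolding copy_body_def by auto
  let ?c = "1 + ops (var ''j'') + ops (var ''len'')"
  have loop: "runs B \<rho> (While_less (var ''j'') (var ''len'') copy_body) s0
    (\<lambda>u s'. u \<le> (t - p) * (20 + ?c) + ?c \<and> agree (writes copy_body) s0 s' \<and> I (t - p) s')"
  proof (rule runs_for)
    show "I 0 s0" by (simp add: I_def s0_def)
    fix i s' assume q: "I i s'" "agree (writes copy_body) s0 s'" "i \<le> t - p"
    have e: "s' ''len'' 0 = int t - int p" "s' ''T'' 0 = int t" "s' ''st'' = s ''st''"
      using agreeD[OF q(2), of "''len''"] agreeD[OF q(2), of "''T''"] agreeD[OF q(2), of "''st''"] s
      by (simp_all add: w s0_def)
    have j: "s' ''j'' 0 = int i" using q(1) by (simp add: I_def)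
    have f: "fits B 0" "fits B 1" "fits B (int i)" "fits B (int i + 1)" "fits B (int t)" "fits B (int t - int p)"
      "fits B (int t - 1)"
      using B q(3) s(3,4) by (auto simp: fits_cap)
    have "runs B \<rho> copy_body s' (\<lambda>u s''. u \<le> 20 \<and> I (Suc i) s'')" if "i < t - p"
    proof -
      have "int t - 1 - int i = int (t - 1 - i)" using that by simp
      moreover have "fits B (int (t - 1 - i))" using B s(3,4) by (auto simp: fits_cap)
      moreover have "fits B (s ''st'' (int (t - 1 - i)))" using that by (intro st) simp
      ultimately show ?thesis
        unfolding copy_body_def using q(1) by (simp add: e j f I_def less_Suc_eq)
    qed
    then show "safe B \<rho> s' (var ''j'') \<and> safe B \<rho> s' (var ''len'') \<and>
      (val \<rho> s' (var ''j'') < val \<rho> s' (var ''len'') \<longleftrightarrow> i < t - p) \<and>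
      (i < t - p \<longrightarrow> runs B \<rho> copy_body s' (\<lambda>u s''. u \<le> 20 \<and> I (Suc i) s''))"
      by (auto simp: e j f)
  qed
  have ag: "agree (writes copy_body) s0 s' \<Longrightarrow> agree {''len'', ''j'', ''out''} s s' \<and> s' ''len'' 0 = int (t - p)" for s'
    using agreeD[of "writes copy_body" s0 s' "''len''"] s(3)
    by (auto simp: w s0_def agree_def)
  have f: "fits B 0" "fits B (int t)" "fits B (int p)" "fits B (int t - int p)"
    using B s(3,4) by (auto simp: fits_cap)
  show ?thesis
    unfolding copy_def
    apply (simp add: f s flip: s0_def)
    apply (rule runs_mono[OF loop])
    apply (use ag s(4) in \<open>auto simp: I_def\<close>)
    done
qed

context arc_data
begin

text \<open>The parent pointers are followed from the end of the walk, so the arcs on the stack form a reversed walk.\<close>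

fun linked :: "nat \<Rightarrow> nat list \<Rightarrow> nat \<Rightarrow> bool" where
  "linked v [] c \<longleftrightarrow> v = c"
| "linked v (x # xs) c \<longleftrightarrow> he x = v \<and> linked (te x) xs c"

lemma linked_append: "linked v (xs @ ys) c \<longleftrightarrow> (\<exists>u. linked v xs u \<and> linked u ys c)"
  by (induction xs arbitrary: v) auto

abbreviation weight :: "nat list \<Rightarrow> int" where "weight xs \<equiv> sum_list (map \<omega> xs)"

text \<open>Distinct heads make the closed reversed walk \<open>ys\<close> a simple cycle. The
  inequality bounds its mean by \<open>R / d\<close>, the mean of the selected closed walk, without
  division.\<close>

definition good :: "int \<Rightarrow> nat \<Rightarrow> store \<Rightarrow> bool" where
  "good R d s \<longleftrightarrow> (\<exists>ys v. ys \<noteq> [] \<and> set ys \<subseteq> {..<m} \<and> linked v ys v \<and> distinct (map he ys) \<and>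
     weight ys * int d \<le> R * int (length ys) \<and>
     s ''len'' 0 = int (length ys) \<and> (\<forall>j<length ys. s ''out'' (int j) = int (rev ys ! j)))"

text \<open>The trace starts at 0, the end of the walk, and currently stands at \<open>c\<close>.
  \<open>pos\<close> is exact at the heads on the stack; elsewhere only its range is recorded, so
  that reading a stale entry does not overflow.\<close>

definition stack :: "store \<Rightarrow> nat list \<Rightarrow> nat \<Rightarrow> bool" where
  "stack s xs c \<longleftrightarrow> set xs \<subseteq> {..<m} \<and> linked 0 xs c \<and> distinct (map he xs) \<and> c < n \<and>
     s ''T'' 0 = int (length xs) \<and> s ''y'' 0 = int c \<and>
     (\<forall>j<length xs. s ''st'' (int j) = int (xs ! j) \<and> s ''pos'' (int (he (xs ! j))) = int j) \<and>
     (\<forall>v. 0 \<le> s ''pos'' v \<and> s ''pos'' v \<le> int n) \<and>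
     (\<forall>j\<le>length xs. s ''ps'' (int j) = weight (take j xs))"

lemma length_stack:
  assumes "stack s xs c" shows "length xs \<le> n"
proof -
  have "length xs = card (set (map he xs))"
    using assms distinct_card unfolding stack_def by fastforce
  also have "\<dots> \<le> card {..<n}"
    using assms he unfolding stack_def by (intro card_mono) auto
  finally show ?thesis by simp
qed

lemma weight_bounds:
  assumes "set xs \<subseteq> {..<m}" shows "- (M * int (length xs)) \<le> weight xs" "weight xs \<le> 0"
  using assms
proof (induction xs)
  case (Cons x xs)
  {
    case 1
    then show ?case using Cons.IH(1) \<omega>(1)[of x] by (auto simp: algebra_simps)
  next
    case 2
    then show ?case using Cons.IH(2) \<omega>(2)[of x] by auto
  }
qed simp_all

text \<open>A single product from which the bounds of the splitting phase are drawn by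
  \<open>spacious_le\<close>, so that each of them only needs a factorisation.\<close>

definition spacious :: "nat \<Rightarrow> nat \<Rightarrow> bool" where
  "spacious K B \<longleftrightarrow> (int n + 2) * ((int K + 2) * (M + 1)) < cap B \<and> int m < cap B"

lemma spacious_le:
  assumes "spacious K B" "0 \<le> a" "0 \<le> b" "0 \<le> c" "a \<le> int n + 2" "b \<le> int K + 2" "c \<le> M + 1"
  shows "a * (b * c) < cap B"
proof -
  have "a * (b * c) \<le> (int n + 2) * ((int K + 2) * (M + 1))"
    using assms by (intro mult_mono) auto
  then show ?thesis using assms(1) unfolding spacious_def by linarith
qed

text \<open>\<open>bs\<close> is the removed cycle, empty if the current vertex closes none. Either
  a good cycle has been output, or \<open>bs\<close> is strictly heavier than the ratio
  \<open>R / d\<close>; the latter case is what \<open>runs_follow\<close> accumulates over all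
  steps.\<close>

lemma runs_pop:
  assumes l: "loaded s" and st: "stack s xs c"
    and i: "s ''i'' 0 = s ''pos'' (int c)" and R: "s ''R'' 0 = R" "\<bar>R\<bar> \<le> 1 + int K * M"
    and d: "s ''d'' 0 = int d" "d \<le> K" and B: "spacious K B" and M: "1 \<le> M"
  shows "runs B \<rho> pop s (\<lambda>t s'. t \<le> 40 * (n + 1) + 60 \<and> agree {''T'', ''len'', ''j'', ''out''} s s' \<and>
     (\<exists>us bs. xs = us @ bs \<and> stack s' us c \<and> c \<notin> he ` set us \<and>
        (good R d s' \<or> (good R d s \<longrightarrow> good R d s') \<and> (bs = [] \<or> R * int (length bs) < weight bs * int d))))"
proof -
  have stk: "set xs \<subseteq> {..<m}" "linked 0 xs c" "distinct (map he xs)" "c < n"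
     "s ''T'' 0 = int (length xs)" "s ''y'' 0 = int c"
     "\<And>j. j < length xs \<Longrightarrow> s ''st'' (int j) = int (xs ! j)" "\<And>j. j < length xs \<Longrightarrow> s ''pos'' (int (he (xs ! j))) = int j"
     "\<And>v. 0 \<le> s ''pos'' v" "\<And>v. s ''pos'' v \<le> int n"
     "\<And>j. j \<le> length xs \<Longrightarrow> s ''ps'' (int j) = weight (take j xs)"
    using st unfolding stack_def by auto
  have len: "length xs \<le> n" using length_stack[OF st] .
  define p where "p = nat (s ''pos'' (int c))"
  have p: "s ''i'' 0 = int p" "p \<le> n" using stk(9,10)[of "int c"] by (auto simp: p_def i)
  have Bn: "int n + 2 < cap B"
  proof -
    have "(int n + 2) * (1 * 1) < cap B" using M by (intro spacious_le[OF B]) auto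
    then show ?thesis by simp
  qed
  have Bm: "int m < cap B" using B by (simp add: spacious_def)
  have f: "fits B 0" "fits B 1" "fits B (int p)" "fits B (int (length xs))" "fits B (int c)" "fits B (int c + 1)"
    using p len stk(4) Bn by (auto simp: fits_cap)
  show ?thesis
  proof (cases "p < length xs \<and> he (xs ! p) = c")
    case False
    \<comment> \<open>A stale entry of \<open>pos\<close> cannot hide a repetition: an arc with head
      \<open>c\<close> on the stack would be the one that the entry points to.\<close>
    have nc: "c \<notin> he ` set xs"
    proof
      assume "c \<in> he ` set xs"
      then obtain j where "j < length xs" "he (xs ! j) = c" by (auto simp: in_set_conv_nth)
      with stk(8)[of j] i p(1) have "p = j" by auto
      with False \<open>j < length xs\<close> \<open>he (xs ! j) = c\<close> show False by simp
    qed
    have post: "\<exists>us bs. xs = us @ bs \<and> stack s us c \<and> c \<notin> he ` set us \<and>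
        (good R d s \<or> (good R d s \<longrightarrow> good R d s) \<and> (bs = [] \<or> R * int (length bs) < weight bs * int d))"
      using st nc by (intro exI[of _ xs] exI[of _ "[]"]) simp
    show ?thesis
    proof (cases "p < length xs")
      case True
      then have x: "xs ! p < m" using stk(1) by (meson lessThan_iff nth_mem subsetD)
      have h: "s ''head'' (int (xs ! p)) = int (he (xs ! p))" using l x by (simp add: loaded_def)
      have f': "fits B (int (xs ! p))" "fits B (int (he (xs ! p)))" "fits B (int (he (xs ! p)) + 1)"
        using x he[OF x] Bn Bm by (auto simp: fits_cap)
      have "he (xs ! p) \<noteq> c" using False True by simp
      then show ?thesis
        unfolding pop_def using post True stk(7)[OF True]
        by (cases "he (xs ! p) < c") (simp_all add: f f' p(1) stk(5,6) h)
    next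
      case False
      then show ?thesis
        unfolding pop_def using post by (simp add: f p(1) stk(5,6))
    qed
  next
    case True
    then have x: "xs ! p < m" using stk(1) by (meson lessThan_iff nth_mem subsetD)
    have h: "s ''head'' (int (xs ! p)) = int c" using l x True by (simp add: loaded_def)
    define us bs where "us = take p xs" and "bs = drop p xs"
    have ab: "xs = us @ bs" "length us = p" "bs \<noteq> []" "he (hd bs) = c"
      using True by (auto simp: us_def bs_def hd_drop_conv_nth)
    have nb: "length bs = length xs - p" by (simp add: bs_def)
    \<comment> \<open>The removed segment begins with an arc of head \<open>c\<close>, and the heads
      on the stack are distinct.\<close>
    have nc: "c \<notin> he ` set us"
    proof
      assume "c \<in> he ` set us"
      moreover have "c \<in> he ` set bs" using ab(3,4) by (metis hd_in_set imageI)
      ultimately show False using stk(3) unfolding ab(1) by auto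
    qed
    obtain v where v: "linked 0 us v" "linked v bs c" using stk(2) unfolding ab(1) linked_append by blast
    then have vc: "v = c" using ab(3,4) by (cases bs) auto
    have sb: "set bs \<subseteq> {..<m}" "distinct (map he bs)" using stk(1,3) unfolding ab(1) by auto
    have "weight xs = weight us + weight bs" unfolding ab(1) by simp
    then have ps: "s ''ps'' (int (length xs)) = weight xs" "s ''ps'' (int p) = weight us" "weight xs - weight us = weight bs"
      using stk(11)[of "length xs"] stk(11)[of p] True by (simp_all add: us_def)
    have wb: "\<bar>weight xs\<bar> \<le> M * int n" "\<bar>weight us\<bar> \<le> M * int n" "\<bar>weight bs\<bar> \<le> M * int n"
    proof -
      have *: "\<bar>weight zs\<bar> \<le> M * int n" if "set zs \<subseteq> {..<m}" "length zs \<le> n" for zs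
      proof -
        have "M * int (length zs) \<le> M * int n" using that M by (intro mult_left_mono) auto
        then show ?thesis using weight_bounds[OF that(1)] by linarith
      qed
      show "\<bar>weight xs\<bar> \<le> M * int n" "\<bar>weight us\<bar> \<le> M * int n" "\<bar>weight bs\<bar> \<le> M * int n"
        using stk(1) len *[of xs] *[of us] *[of bs] ab(1) by auto
    qed
    have nM: "M * int n < cap B"
      using spacious_le[OF B, of "int n" 1 M] M by (simp add: mult.commute)
    have RM: "1 + int K * M < cap B"
    proof -
      have "1 * ((int K + 1) * (M + 1)) < cap B" using M by (intro spacious_le[OF B]) auto
      then show ?thesis using M by (simp add: algebra_simps)
    qed
    have f1: "fits B (weight xs)" "fits B (weight us)" "fits B (weight bs)" "fits B R"
      using wb nM R(2) RM unfolding fits_cap by linarith+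
    have "\<bar>weight bs * int d\<bar> \<le> (M * int n) * int d"
      unfolding abs_mult using wb(3) by (intro mult_mono) (use M in auto)
    also have "\<dots> = int n * (int d * M)" by simp
    also have "\<dots> < cap B" using d M by (intro spacious_le[OF B]) auto
    finally have f2: "fits B (weight bs * int d)" by (simp add: fits_cap)
    have lb: "int (length xs) - int p = int (length bs)" using True nb by simp
    have lb': "length bs \<le> n" using nb len by simp
    have "\<bar>R * int (length bs)\<bar> \<le> (1 + int K * M) * int n"
      unfolding abs_mult using R(2) lb' M by (intro mult_mono) auto
    moreover have "(1 + int K * M) * int n + 1 < cap B"
    proof -
      have "(int n + 1) * ((int K + 1) * (M + 1)) < cap B" using M by (intro spacious_le[OF B]) auto
      moreover have "(1 + int K * M) * int n + 1 \<le> (int n + 1) * ((int K + 1) * (M + 1))"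
      proof -
        have "(1 + int K * M) * int n + 1 \<le> (1 + int K * M) * int n + (1 + int K * M)" using M by simp
        also have "\<dots> = (int n + 1) * (1 + int K * M)" by (simp add: algebra_simps)
        also have "\<dots> \<le> (int n + 1) * ((int K + 1) * (M + 1))"
          using M by (intro mult_left_mono) (auto simp: algebra_simps)
        finally show ?thesis .
      qed
      ultimately show ?thesis by linarith
    qed
    ultimately have f3: "fits B (R * int (length bs))" "fits B (R * int (length bs) + 1)"
      unfolding fits_cap by linarith+
    have f4: "fits B (int (length bs))" "fits B (int d)" "fits B (int (xs ! p))" "fits B (int c + 1)"
    proof -
      have "1 * (int d * 1) < cap B" using d M by (intro spacious_le[OF B]) auto
      then show "fits B (int (length bs))" "fits B (int d)" "fits B (int (xs ! p))" "fits B (int c + 1)"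
        using lb' Bn Bm x stk(4) by (auto simp: fits_cap)
    qed
    have stx: "fits B (s ''st'' (int j))" if "j < length xs" for j
    proof -
      have "xs ! j < m" using that stk(1) by (meson lessThan_iff nth_mem subsetD)
      then show ?thesis using stk(7)[OF that] Bm by (simp add: fits_cap)
    qed
    have usx: "us ! j = xs ! j" "j < length xs" "take j us = take j xs" if "j < length us" for j
      using that unfolding ab(1) by (simp_all add: nth_append)
    have stack': "stack (s'(''T'' := (s' ''T'')(0 := int p))) us c" if "agree {''len'', ''j'', ''out''} s s'" for s'
    proof -
      have e: "s' ''y'' = s ''y''" "s' ''st'' = s ''st''" "s' ''pos'' = s ''pos''" "s' ''ps'' = s ''ps''"
        using that by (auto simp: agree_def)
      have "set us \<subseteq> {..<m}" "distinct (map he us)" using stk(1,3) unfolding ab(1) by auto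
      moreover have "weight (take j us) = s ''ps'' (int j)" if "j \<le> length us" for j
        using stk(11)[of j] that by (simp add: ab(1))
      ultimately show ?thesis
        unfolding stack_def using v(1) vc stk(4,6,9,10) ab(2) stk(7,8)[OF usx(2)] by (simp add: e usx(1))
    qed
    have rev: "rev bs ! j = xs ! (length xs - 1 - j)" if "j < length bs" for j
    proof -
      have "length xs - 1 - j = length us + (length bs - Suc j)" using that unfolding ab(1) by simp
      then show ?thesis using that unfolding ab(1) by (simp only: nth_append_length_plus rev_nth)
    qed
    have stj: "s ''st'' (int (length xs - 1 - j)) = int (rev bs ! j)" if "j < length bs" for j
      using stk(7)[of "length xs - 1 - j"] that unfolding rev[OF that] nb by simp
    have c1: "\<not> int c < int c" "int p < int (length xs)" "int c < int c + 1" using True by auto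
    show ?thesis
    \<comment> \<open>The added 1 turns the strict integer comparison into the non-strict one
      demanded by \<open>good\<close>.\<close>
    proof (cases "weight bs * int d < R * int (length bs) + 1")
      case False
      then have "R * int (length bs) < weight bs * int d" by simp
      then have "\<exists>us bs. xs = us @ bs \<and> stack (s(''T'' := (s ''T'')(0 := int p))) us c \<and> c \<notin> he ` set us \<and>
        (good R d (s(''T'' := (s ''T'')(0 := int p))) \<or>
         (good R d s \<longrightarrow> good R d (s(''T'' := (s ''T'')(0 := int p)))) \<and> (bs = [] \<or> R * int (length bs) < weight bs * int d))"
        using stack'[of s] ab(1) nc by (intro exI[of _ us] exI[of _ bs]) (simp add: good_def)
      then show ?thesis
        unfolding pop_def using False
        by (simp add: f f1 f2 f3 f4 p(1) stk(5,6) stk(7)[of p] True h R(1) d(1) ps lb c1)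
    next
      case less: True
      have copy: "runs B \<rho> copy s (\<lambda>u s'. u \<le> 40 * (n + 1) \<and> agree {''len'', ''j'', ''out''} s s' \<and>
         s' ''len'' 0 = int (length bs) \<and> (\<forall>j<length bs. s' ''out'' (int j) = int (rev bs ! j)))"
      proof (rule runs_mono[OF runs_copy[OF stk(5) p(1) _ len stx]])
        show "p < length xs" using True by simp
        show "int n + 1 < cap B" using Bn by simp
        fix u :: nat and s' assume "u \<le> 40 * (n + 1) \<and> agree {''len'', ''j'', ''out''} s s' \<and>
          s' ''len'' 0 = int (length xs - p) \<and>
          (\<forall>j<length xs - p. s' ''out'' (int j) = s ''st'' (int (length xs - 1 - j)))"
        then show "u \<le> 40 * (n + 1) \<and> agree {''len'', ''j'', ''out''} s s' \<and>
          s' ''len'' 0 = int (length bs) \<and> (\<forall>j<length bs. s' ''out'' (int j) = int (rev bs ! j))"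
          using stj unfolding nb[symmetric] by simp
      qed
      have post: "agree {''T'', ''len'', ''j'', ''out''} s s' \<and>
         (\<exists>us bs. xs = us @ bs \<and> stack (s'(''T'' := (s' ''T'')(0 := int p))) us c \<and> c \<notin> he ` set us \<and>
        (good R d (s'(''T'' := (s' ''T'')(0 := int p))) \<or>
         (good R d s \<longrightarrow> good R d (s'(''T'' := (s' ''T'')(0 := int p)))) \<and> (bs = [] \<or> R * int (length bs) < weight bs * int d)))"
        if "agree {''len'', ''j'', ''out''} s s'" "s' ''len'' 0 = int (length bs)"
          "\<forall>j<length bs. s' ''out'' (int j) = int (rev bs ! j)" for s'
      proof
        show "agree {''T'', ''len'', ''j'', ''out''} s s'" using that(1) by (auto simp: agree_def)
        have "good R d (s'(''T'' := (s' ''T'')(0 := int p)))"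
          unfolding good_def using ab(3) sb v(2) vc less that(2,3)
          by (intro exI[of _ bs] exI[of _ c]) simp
        then show "\<exists>us bs. xs = us @ bs \<and> stack (s'(''T'' := (s' ''T'')(0 := int p))) us c \<and> c \<notin> he ` set us \<and>
          (good R d (s'(''T'' := (s' ''T'')(0 := int p))) \<or>
           (good R d s \<longrightarrow> good R d (s'(''T'' := (s' ''T'')(0 := int p)))) \<and> (bs = [] \<or> R * int (length bs) < weight bs * int d))"
          using stack'[OF that(1)] ab(1) nc by blast
      qed
      show ?thesis
        unfolding pop_def using less
        apply (simp add: f f1 f2 f3 f4 p(1) stk(5,6) stk(7)[of p] True h R(1) d(1) ps lb c1)
        apply (rule runs_mono[OF copy])
        subgoal premises q for u s'
        proof -
          have "s' ''i'' 0 = int p" using q agreeD[of _ s s' "''i''"] p(1) by auto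
          then show ?thesis using post[of s'] q f by simp
        qed
        done
    qed
  qed
qed


lemma runs_push:
  assumes l: "loaded s" and st: "stack s xs c" and c: "c \<notin> he ` set xs"
    and t: "table K 0 (grid n (s ''F'')) (grid n (s ''Q''))" and neg: "grid n (s ''F'') (Suc k) c < 0"
    and k: "s ''k'' 0 = int (Suc k)" "Suc k \<le> K" and u: "s ''u'' 0 = int (Suc k) * int n"
    and B: "spacious K B" and M: "1 \<le> M"
  shows "runs B \<rho> push s (\<lambda>t s'. t \<le> 70 \<and>
     agree {''e'', ''st'', ''pos'', ''ps'', ''T'', ''y'', ''u'', ''k'', ''i''} s s' \<and>
     s' ''k'' 0 = int k \<and> s' ''u'' 0 = int k * int n \<and>
     (\<exists>e<m. grid n (s ''F'') k (te e) < 0 \<and> grid n (s ''F'') (Suc k) c = grid n (s ''F'') k (te e) + \<omega> e \<and>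
        stack s' (xs @ [e]) (te e) \<and> s' ''i'' 0 = s' ''pos'' (int (te e))))"
proof -
  have stk: "set xs \<subseteq> {..<m}" "linked 0 xs c" "distinct (map he xs)" "c < n"
     "s ''T'' 0 = int (length xs)" "s ''y'' 0 = int c"
     "\<And>j. j < length xs \<Longrightarrow> s ''st'' (int j) = int (xs ! j)" "\<And>j. j < length xs \<Longrightarrow> s ''pos'' (int (he (xs ! j))) = int j"
     "\<And>v. 0 \<le> s ''pos'' v" "\<And>v. s ''pos'' v \<le> int n"
     "\<And>j. j \<le> length xs \<Longrightarrow> s ''ps'' (int j) = weight (take j xs)"
    using st unfolding stack_def by auto
  have len: "length xs \<le> n" using length_stack[OF st] .
  obtain e where e: "e < m" "grid n (s ''Q'') (Suc k) c = int e" "he e = c" "grid n (s ''F'') k (te e) < 0"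
    "grid n (s ''F'') (Suc k) c = grid n (s ''F'') k (te e) + \<omega> e"
    using t neg stk(4) unfolding table_def by blast
  have Q: "s ''Q'' (int (Suc k) * int n + int c) = int e" using e(2) stk(4) by (simp add: grid_eq)
  have a: "s ''tail'' (int e) = int (te e)" "s ''b'' (int e) = \<omega> e + s ''g'' 0"
    "\<bar>s ''b'' (int e)\<bar> \<le> M" "0 \<le> s ''g'' 0" "s ''g'' 0 \<le> M" "s ''n'' 0 = int n"
    using l e(1) by (auto simp: loaded_def algebra_simps)
  have Bn: "int n + 2 < cap B"
  proof -
    have "(int n + 2) * (1 * 1) < cap B" using M by (intro spacious_le[OF B]) auto
    then show ?thesis by simp
  qed
  have Bm: "int m < cap B" using B by (simp add: spacious_def)
  have kn: "int (Suc k) * int n + int c < cap B" "int (Suc k) * int n < cap B" "int k * int n < cap B" "int (Suc k) < cap B"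
  proof -
    have "int n * ((int (Suc k) + 1) * 1) < cap B" using k M by (intro spacious_le[OF B]) auto
    moreover have "0 \<le> int k * int n" by simp
    ultimately show "int (Suc k) * int n + int c < cap B" "int (Suc k) * int n < cap B" "int k * int n < cap B"
      using stk(4) by (simp_all add: algebra_simps)
    have "1 * (int (Suc k) * 1) < cap B" using k M by (intro spacious_le[OF B]) auto
    then show "int (Suc k) < cap B" by simp
  qed
  have psx: "s ''ps'' (int (length xs)) = weight xs" using stk(11)[of "length xs"] by simp
  have nM: "M * int n + M < cap B"
  proof -
    have "(int n + 1) * (1 * M) < cap B" using M by (intro spacious_le[OF B]) auto
    then show ?thesis by (simp add: algebra_simps)
  qed
  have wx: "\<bar>weight xs\<bar> \<le> M * int n"
  proof -
    have "M * int (length xs) \<le> M * int n" using len M by (intro mult_left_mono) auto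
    then show ?thesis using weight_bounds[OF stk(1)] by linarith
  qed
  have "0 \<le> M * int n" using M by simp
  then have f: "fits B (weight xs)" "fits B (weight xs + (\<omega> e + s ''g'' 0))" "fits B (weight xs + \<omega> e)"
    "fits B (\<omega> e + s ''g'' 0)" "fits B (s ''g'' 0)"
    using wx nM a(2-5) \<omega>[OF e(1)] unfolding fits_cap by linarith+
  have f2: "fits B 0" "fits B 1" "fits B (int (length xs))" "fits B (int (length xs) + 1)" "fits B (int c)"
    "fits B (int e)" "fits B (int (te e))" "fits B (int n)" "fits B (int (Suc k))" "fits B (int k)"
    "fits B (int (Suc k) * int n)" "fits B (int k * int n)" "fits B (int (Suc k) * int n + int c)"
    using len stk(4) te[OF e(1)] e(1) Bn Bm kn unfolding fits_cap by auto
  have f3: "fits B (s ''pos'' v)" for v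
    using stk(9,10)[of v] Bn len unfolding fits_cap by auto
  let ?st = "(s ''st'')(int (length xs) := int e)" and ?pos = "(s ''pos'')(int c := int (length xs))"
    and ?ps = "(s ''ps'')(int (length xs) + 1 := weight xs + \<omega> e)"
  have stack': "stack s' (xs @ [e]) (te e)"
    if "s' ''st'' = ?st" "s' ''pos'' = ?pos" "s' ''ps'' = ?ps" "s' ''T'' 0 = int (length xs) + 1" "s' ''y'' 0 = int (te e)" for s'
  proof -
    \<comment> \<open>No arc on the stack has head \<open>c\<close>, so writing the
      \<open>pos\<close> entry of \<open>c\<close> leaves the entries of the stacked heads
      intact.\<close>
    have "he (xs ! j) \<noteq> c" if "j < length xs" for j using c that by auto
    then have "\<forall>j<length (xs @ [e]). ?st (int j) = int ((xs @ [e]) ! j) \<and> ?pos (int (he ((xs @ [e]) ! j))) = int j"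
      using stk(7,8) e(3) by (auto simp: nth_append less_Suc_eq)
    moreover have "\<forall>j\<le>length (xs @ [e]). ?ps (int j) = weight (take j (xs @ [e]))"
      using stk(11) by (auto simp: le_Suc_eq)
    moreover have "linked 0 (xs @ [e]) (te e)" using stk(2) e(3) by (auto simp: linked_append)
    moreover have "\<forall>v. 0 \<le> ?pos v \<and> ?pos v \<le> int n" using stk(9,10) len by simp
    ultimately show ?thesis
      unfolding stack_def that using stk(1,3) c e(1,3) te[OF e(1)] by simp
  qed
  have kn': "int (Suc k) * int n - int n = int k * int n" "int (Suc k) - 1 = int k" by (simp_all add: algebra_simps)
  have "runs B \<rho> push s (\<lambda>t s'. t \<le> 70 \<and>
     agree {''e'', ''st'', ''pos'', ''ps'', ''T'', ''y'', ''u'', ''k'', ''i''} s s' \<and>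
     s' ''k'' 0 = int k \<and> s' ''u'' 0 = int k * int n \<and>
     s' ''st'' = ?st \<and> s' ''pos'' = ?pos \<and> s' ''ps'' = ?ps \<and> s' ''T'' 0 = int (length xs) + 1 \<and>
     s' ''y'' 0 = int (te e) \<and> s' ''i'' 0 = ?pos (int (te e)))"
    unfolding push_def
    by (simp add: f3 k(1) u stk(5,6) Q a(1,2,6) f f2 psx kn' del: of_nat_Suc)
  then show ?thesis
  proof (rule runs_mono, elim conjE, intro conjI)
    fix u :: nat and s' assume *: "s' ''st'' = ?st" "s' ''pos'' = ?pos" "s' ''ps'' = ?ps" "s' ''T'' 0 = int (length xs) + 1"
      "s' ''y'' 0 = int (te e)" "s' ''i'' 0 = ?pos (int (te e))"
    have "s' ''i'' 0 = s' ''pos'' (int (te e))" unfolding * ..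
    with e(1,4,5) stack'[OF *(1-5)]
    show "\<exists>e<m. grid n (s ''F'') k (te e) < 0 \<and> grid n (s ''F'') (Suc k) c = grid n (s ''F'') k (te e) + \<omega> e \<and>
        stack s' (xs @ [e]) (te e) \<and> s' ''i'' 0 = s' ''pos'' (int (te e))"
      by blast
  qed
qed

text \<open>As long as no good cycle is output, the removed cycles taken together have a mean
  strictly above \<open>R / d\<close>, unless nothing was removed yet; these are the last two
  disjuncts of the invariant. At the end everything is removed, with total weight \<open>R\<close>
  and total length \<open>d\<close>, and strictness would give \<open>R * d < R * d\<close>.\<close>

lemma runs_follow:
  assumes l: "loaded s" and t: "table K 0 (grid n (s ''F'')) (grid n (s ''Q''))"
    and d: "s ''d'' 0 = int d" "0 < d" "d \<le> K" and b: "grid n (s ''F'') d 0 < 0"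
    and R: "s ''R'' 0 = R" "R = grid n (s ''F'') d 0 + 1"
    and z: "s ''pos'' = (\<lambda>_. 0)" "s ''ps'' 0 = 0"
    and B: "spacious K B" and M: "1 \<le> M"
  shows "runs B \<rho> follow s (\<lambda>t s'. t \<le> 200 * ((K + 1) * (n + 1)) \<and> good R d s')"
proof -
  let ?G = "grid n (s ''F'')"
  define I where "I = (\<lambda>i (s'::store). i \<le> d \<and> s' ''k'' 0 = int (d - i) \<and> s' ''u'' 0 = int (d - i) * int n \<and>
     (\<exists>xs c. stack s' xs c \<and> c \<notin> he ` set xs \<and> ?G (d - i) c < 0 \<and>
       (good R d s' \<or> length xs = i \<and> weight xs = ?G d 0 - ?G (d - i) c \<or>
         R * (int i - int (length xs)) < (?G d 0 - ?G (d - i) c - weight xs) * int d)))"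
  define s0 where "s0 = s(''T'' := (s ''T'')(0 := 0), ''y'' := (s ''y'')(0 := 0), ''k'' := (s ''k'')(0 := int d),
     ''u'' := (s ''u'')(0 := int d * int n))"
  have G: "- 1 - int l * M \<le> ?G l v" "?G l v \<le> 0" if "v < n" for l v
    using t that unfolding table_def by blast+
  have Rb: "\<bar>R\<bar> \<le> 1 + int K * M"
  proof -
    have "0 \<le> int d * M" "int d * M \<le> int K * M" using M d by (auto intro!: mult_right_mono)
    then show ?thesis using G[OF n, of d] b unfolding R by linarith
  qed
  have w: "writes follow_body = {''e'', ''st'', ''pos'', ''ps'', ''T'', ''y'', ''u'', ''k'', ''i'', ''len'', ''j'', ''out''}"
    unfolding follow_body_def push_def pop_def copy_def copy_body_def by auto
  let ?c = "1 + ops (Lit 0) + ops (var ''k'')"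
  have f: "fits B 0" "fits B (int n)" "fits B (int d * int n)" and fd: "\<And>j. j \<le> d \<Longrightarrow> fits B (int j)"
  proof -
    have "0 * (0 * 0) < cap B" using M by (intro spacious_le[OF B]) auto
    then show "fits B 0" by (simp add: fits_cap)
    have "int n * (1 * 1) < cap B" using M by (intro spacious_le[OF B]) auto
    then show "fits B (int n)" by (simp add: fits_cap)
    have "int n * (int d * 1) < cap B" using M d by (intro spacious_le[OF B]) auto
    then show "fits B (int d * int n)" by (simp add: fits_cap mult.commute)
    fix j assume "j \<le> d"
    then have "1 * (int j * 1) < cap B" using M d by (intro spacious_le[OF B]) auto
    then show "fits B (int j)" by (simp add: fits_cap)
  qed
  have loop: "runs B \<rho> (While_less (Lit 0) (var ''k'') follow_body) s0
    (\<lambda>u s'. u \<le> d * (40 * (n + 1) + 130 + ?c) + ?c \<and> agree (writes follow_body) s0 s' \<and> I d s')"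
  proof (rule runs_for)
    have "stack s0 [] 0" unfolding stack_def using n z by (simp add: s0_def)
    then show "I 0 s0" unfolding I_def using b
      by (intro conjI exI[of _ "[]"] exI[of _ "0::nat"]) (auto simp: s0_def)
    fix i s' assume p: "I i s'" "agree (writes follow_body) s0 s'" "i \<le> d"
    have "loaded s0" using l by (simp add: loaded_def s0_def)
    then have l': "loaded s'" using p(2) by (rule loaded_agree) (simp add: w)
    have e: "s' ''F'' = s ''F''" "s' ''Q'' = s ''Q''" "s' ''R'' 0 = R" "s' ''d'' 0 = int d"
      using agreeD[OF p(2), of "''F''"] agreeD[OF p(2), of "''Q''"] agreeD[OF p(2), of "''R''"]
        agreeD[OF p(2), of "''d''"] R d by (simp_all add: w s0_def)
    obtain xs c where k: "s' ''k'' 0 = int (d - i)" "s' ''u'' 0 = int (d - i) * int n"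
      and st: "stack s' xs c" "c \<notin> he ` set xs" "?G (d - i) c < 0"
      and q: "good R d s' \<or> length xs = i \<and> weight xs = ?G d 0 - ?G (d - i) c \<or>
         R * (int i - int (length xs)) < (?G d 0 - ?G (d - i) c - weight xs) * int d"
      using p(1) unfolding I_def by blast
    have "runs B \<rho> follow_body s' (\<lambda>t s''. t \<le> 40 * (n + 1) + 130 \<and> I (Suc i) s'')" if "i < d"
    proof -
      have di: "d - i = Suc (d - Suc i)" using that by simp
      have kK: "Suc (d - Suc i) \<le> K" using d by simp
      show ?thesis
        unfolding follow_body_def runs_Seq
      proof (rule runs_mono[OF runs_push[OF l' st(1,2) _ _ _ kK _ B M]])
        fix t1 :: nat and s1 assume a1: "t1 \<le> 70 \<and>
         agree {''e'', ''st'', ''pos'', ''ps'', ''T'', ''y'', ''u'', ''k'', ''i''} s' s1 \<and>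
         s1 ''k'' 0 = int (d - Suc i) \<and> s1 ''u'' 0 = int (d - Suc i) * int n \<and>
         (\<exists>e<m. grid n (s' ''F'') (d - Suc i) (te e) < 0 \<and>
            grid n (s' ''F'') (Suc (d - Suc i)) c = grid n (s' ''F'') (d - Suc i) (te e) + \<omega> e \<and>
            stack s1 (xs @ [e]) (te e) \<and> s1 ''i'' 0 = s1 ''pos'' (int (te e)))"
        then obtain x where x: "x < m" "?G (d - Suc i) (te x) < 0" "?G (d - i) c = ?G (d - Suc i) (te x) + \<omega> x"
          "stack s1 (xs @ [x]) (te x)" "s1 ''i'' 0 = s1 ''pos'' (int (te x))"
          unfolding di e by auto
        have ag1: "agree {''e'', ''st'', ''pos'', ''ps'', ''T'', ''y'', ''u'', ''k'', ''i''} s' s1" using a1 by blast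
        have l1: "loaded s1" using l' ag1 by (rule loaded_agree) simp
        have e1: "s1 ''R'' 0 = R" "s1 ''d'' 0 = int d" "s1 ''len'' = s' ''len''" "s1 ''out'' = s' ''out''"
          using e ag1 by (auto simp: agree_def)
        have g1: "good R d s1 \<longleftrightarrow> good R d s'" unfolding good_def e1 by simp
        show "runs B \<rho> pop s1 (\<lambda>t' s''. t1 + t' \<le> 40 * (n + 1) + 130 \<and> I (Suc i) s'')"
        proof (rule runs_mono[OF runs_pop[OF l1 x(4,5) e1(1) Rb e1(2) d(3) B M]])
          fix t2 :: nat and s2 assume a2: "t2 \<le> 40 * (n + 1) + 60 \<and> agree {''T'', ''len'', ''j'', ''out''} s1 s2 \<and>
           (\<exists>us bs. xs @ [x] = us @ bs \<and> stack s2 us (te x) \<and> te x \<notin> he ` set us \<and>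
              (good R d s2 \<or> (good R d s1 \<longrightarrow> good R d s2) \<and>
                (bs = [] \<or> R * int (length bs) < weight bs * int d)))"
          then obtain us bs where u: "xs @ [x] = us @ bs" "stack s2 us (te x)" "te x \<notin> he ` set us"
            "good R d s2 \<or> (good R d s1 \<longrightarrow> good R d s2) \<and> (bs = [] \<or> R * int (length bs) < weight bs * int d)"
            by blast
          have e2: "s2 ''k'' 0 = int (d - Suc i)" "s2 ''u'' 0 = int (d - Suc i) * int n"
            using a1 a2 by (auto simp: agree_def)
          have len: "int (length xs) + 1 = int (length us) + int (length bs)"
            using arg_cong[OF u(1), of length] by simp
          have wt: "weight xs + \<omega> x = weight us + weight bs"
            using arg_cong[OF u(1), of weight] by simp
          have "good R d s2 \<or> length us = Suc i \<and> weight us = ?G d 0 - ?G (d - Suc i) (te x) \<or>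
             R * (int (Suc i) - int (length us)) < (?G d 0 - ?G (d - Suc i) (te x) - weight us) * int d"
          proof (cases "good R d s2")
            case False
            have q': "length xs = i \<and> weight xs = ?G d 0 - ?G (d - i) c \<or>
              R * (int i - int (length xs)) < (?G d 0 - ?G (d - i) c - weight xs) * int d"
              using u(4) q g1 False by blast
            have b': "bs = [] \<or> R * int (length bs) < weight bs * int d"
              using u(4) False by blast
            have 1: "int (Suc i) - int (length us) = (int i - int (length xs)) + int (length bs)" using len by simp
            have 2: "?G d 0 - ?G (d - Suc i) (te x) - weight us = (?G d 0 - ?G (d - i) c - weight xs) + weight bs"
              using wt x(3) by simp
            show ?thesis
            proof (cases "bs = []")
              case True
              from q' show ?thesis
              proof
                assume "length xs = i \<and> weight xs = ?G d 0 - ?G (d - i) c"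
                then have "length us = Suc i" "weight us = ?G d 0 - ?G (d - Suc i) (te x)"
                  using len wt x(3) True by simp_all
                then show ?thesis by blast
              next
                assume "R * (int i - int (length xs)) < (?G d 0 - ?G (d - i) c - weight xs) * int d"
                then show ?thesis unfolding 1 2 using True by simp
              qed
            next
              case False
              with b' have "R * int (length bs) < weight bs * int d" by blast
              \<comment> \<open>Both remaining alternatives of the invariant imply the non-strict
                inequality; the heavy cycle just removed makes it strict.\<close>
              moreover have "R * (int i - int (length xs)) \<le> (?G d 0 - ?G (d - i) c - weight xs) * int d"
                using q' by (elim disjE) simp_all
              ultimately show ?thesis unfolding 1 2 by (simp add: distrib_left distrib_right)
            qed
          qed (rule disjI1)
          then show "t1 + t2 \<le> 40 * (n + 1) + 130 \<and> I (Suc i) s2"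
            using a1 a2 u(2,3) x(2) e2 that unfolding I_def
            by (intro conjI exI[of _ us] exI[of _ "te x"]) (simp_all del: of_nat_diff)
        qed
      qed (use st(3) k t in \<open>simp_all only: e di\<close>)
    qed
    moreover have "0 < int (d - i) \<longleftrightarrow> i < d" using p(3) by auto
    ultimately show "safe B \<rho> s' (Lit 0) \<and> safe B \<rho> s' (var ''k'') \<and>
      (val \<rho> s' (Lit 0) < val \<rho> s' (var ''k'') \<longleftrightarrow> i < d) \<and>
      (i < d \<longrightarrow> runs B \<rho> follow_body s' (\<lambda>t s''. t \<le> 40 * (n + 1) + 130 \<and> I (Suc i) s''))"
      using fd[of "d - i"] by (simp add: k f del: of_nat_diff)
  qed
  have fin: "good R d s'" if last: "I d s'" for s'
  proof -
    obtain xs c where st: "stack s' xs c" "c \<notin> he ` set xs" "?G 0 c < 0"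
      and q: "good R d s' \<or> length xs = d \<and> weight xs = ?G d 0 - ?G 0 c \<or>
         R * (int d - int (length xs)) < (?G d 0 - ?G 0 c - weight xs) * int d"
      using last unfolding I_def diff_self_eq_0 by blast
    have cn: "c < n" using st(1) by (simp add: stack_def)
    \<comment> \<open>Level 0 is finite only at vertex 0, so the trace ends there. An arc at the
      bottom of the stack would have head 0, whereas the current vertex is no head of a stacked arc;
      so the stack is empty.\<close>
    then have c: "c = 0" "?G 0 c = - 1" using t st(3) unfolding table_def by (metis less_irrefl)+
    have "xs = []"
    proof (cases xs)
      case (Cons x ys)
      then have "he x = 0" using st(1) by (auto simp: stack_def)
      with st(2) Cons c show ?thesis by simp
    qed simp
    with q c d(2) R(2) show ?thesis by simp
  qed
  \<comment> \<open>Every step may copy a cycle of up to \<open>n\<close> arcs. This is absorbed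
    later by \<open>n \<le> m\<close>.\<close>
  have time: "d * (40 * (n + 1) + 130 + ?c) + ?c + 40 \<le> 200 * ((K + 1) * (n + 1))"
  proof -
    have "d * (40 * (n + 1) + 130 + ?c) \<le> K * (200 * (n + 1))" using d by (intro mult_mono) auto
    then show ?thesis by (simp add: algebra_simps)
  qed
  have n': "s ''n'' 0 = int n" using l by (simp add: loaded_def)
  show ?thesis
    unfolding follow_def
    apply (simp add: f fd[of d] n' d(1) flip: s0_def)
    apply (rule runs_mono[OF loop])
    apply (use fin time in auto)
    done
qed

end

section \<open>Windows of a closed walk\<close>

lemma sum_shift_periodic:
  fixes g :: "nat \<Rightarrow> 'a::ab_group_add"
  assumes "\<And>t. g (t + L) = g t"
  shows "(\<Sum>i<L. g (i + t)) = (\<Sum>i<L. g i)"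
proof (induction t)
  case (Suc t)
  have "(\<Sum>i<Suc L. g (i + t)) = g t + (\<Sum>i<L. g (i + Suc t))"
    using sum.lessThan_Suc_shift[of "\<lambda>i. g (i + t)" L] by simp
  moreover have "(\<Sum>i<Suc L. g (i + t)) = (\<Sum>i<L. g (i + t)) + g t"
    using assms[of t] by (simp add: add.commute)
  ultimately show ?case using Suc.IH by simp
qed simp

text \<open>Averaging over the \<open>L\<close> starting points: every position of the window runs
  through a full period, so the windows add up to \<open>j\<close> times the sum of the period and
  cannot all lie above average. \<open>j\<close> may exceed \<open>L\<close>, in which case the
  window winds round several times.\<close>

lemma light_window:
  fixes g :: "nat \<Rightarrow> int"
  assumes per: "\<And>t. g (t + L) = g t" and L: "0 < L"
  shows "\<exists>i<L. (\<Sum>t<j. g (i + t)) * int L \<le> int j * (\<Sum>i<L. g i)"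
proof (rule ccontr)
  let ?S = "\<Sum>i<L. g i"
  assume "\<not> ?thesis"
  then have "(\<Sum>i<L. int j * ?S) < (\<Sum>i<L. (\<Sum>t<j. g (i + t)) * int L)"
    using L by (intro sum_strict_mono) (auto simp: not_le)
  also have "\<dots> = (\<Sum>t<j. \<Sum>i<L. g (i + t)) * int L"
    by (subst sum.swap) (simp add: sum_distrib_right)
  also have "\<dots> = int j * ?S * int L"
    by (simp add: sum_shift_periodic[of g, OF per])
  finally show False by (simp add: mult.commute mult.left_commute)
qed

context wf_digraph begin

text \<open>The index modulo the length includes the step from the last arc to the first, so a
  closed walk can be read as an infinite periodic one.\<close>

lemma closed_awalk_next:
  assumes "awalk u C u" "C \<noteq> []"
  shows "head G (C ! (t mod length C)) = tail G (C ! (Suc t mod length C))"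
proof -
  let ?L = "length C"
  have c: "cas u C u" using assms by auto
  define i where "i = t mod ?L"
  have i: "i < ?L" using assms by (simp add: i_def)
  have eq: "map (tail G) C @ [head G (last C)] = tail G (hd C) # map (head G) C"
    using awalk_verts_conv[of u C] awalk_verts_conv'[OF c] assms(2) by simp
  have h: "head G (C ! i) = (map (tail G) C @ [head G (last C)]) ! Suc i"
    unfolding eq using i by simp
  show ?thesis
  proof (cases "Suc i < ?L")
    case True
    then have "Suc t mod ?L = Suc i" by (metis i_def mod_Suc nat_neq_iff)
    with h True show ?thesis by (simp add: nth_append flip: i_def)
  next
    case False
    then have l: "Suc i = ?L" using i by simp
    then have "Suc t mod ?L = 0" by (metis i_def mod_Suc)
    moreover have "head G (last C) = u" "tail G (hd C) = u"
      using assms c awlast_of_awalk[OF assms(1)] by (auto simp: awalk_verts_conv cas_simp NOMATCH_def)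
    ultimately show ?thesis using h l assms(2) by (simp add: nth_append hd_conv_nth flip: i_def)
  qed
qed

lemma light_subwalk:
  fixes \<alpha> :: "'b \<Rightarrow> int"
  assumes "awalk u C u" "C \<noteq> []"
  obtains v q v' where "awalk v q v'" "length q = j"
    "sum_list (map \<alpha> q) * int (length C) \<le> int j * sum_list (map \<alpha> C)"
proof -
  let ?L = "length C"
  define f where "f = (\<lambda>t. C ! (t mod ?L))"
  have "(\<Sum>i<?L. \<alpha> (f i)) = sum_list (map \<alpha> C)"
    unfolding f_def by (simp add: sum_list_sum_nth atLeast0LessThan)
  moreover have "\<exists>i<?L. (\<Sum>t<j. \<alpha> (f (i + t))) * int ?L \<le> int j * (\<Sum>i<?L. \<alpha> (f i))"
    using light_window[of "\<lambda>t. \<alpha> (f t)" ?L j] assms(2) by (simp add: f_def)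
  ultimately obtain i where i: "(\<Sum>t<j. \<alpha> (f (i + t))) * int ?L \<le> int j * sum_list (map \<alpha> C)"
    by auto
  have f: "f t \<in> arcs G" for t
    using assms unfolding f_def by (metis awalkE' length_greater_0_conv mod_less_divisor nth_mem subsetD)
  have "awalk (tail G (f i)) (map (\<lambda>t. f (i + t)) [0..<j]) (tail G (f (i + j)))"
  proof (induction j)
    case 0
    then show ?case using f by (simp add: awalk_Nil_iff)
  next
    case (Suc j)
    have "awalk (tail G (f (i + j))) [f (i + j)] (tail G (f (i + Suc j)))"
      using arc_implies_awalk[OF f[of "i + j"]] closed_awalk_next[OF assms, of "i + j"] unfolding f_def by simp
    with Suc show ?case by (simp del: awalk_append_iff add: awalk_appendI)
  qed
  moreover have "sum_list (map \<alpha> (map (\<lambda>t. f (i + t)) [0..<j])) = (\<Sum>t<j. \<alpha> (f (i + t)))"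
    by (simp add: interv_sum_list_conv_sum_set_nat atLeast0LessThan comp_def)
  ultimately show thesis using i that by (metis diff_zero length_map length_upt)
qed

end

section \<open>Graphs given by arc lists\<close>

locale arc_list =
  fixes n :: nat and es :: "(nat \<times> nat) list"
  assumes es: "es \<noteq> []" and fin: "fin_digraph (graph_of n es)" and conn: "strongly_connected (graph_of n es)"
begin

sublocale fin_digraph "graph_of n es" by (fact fin)

abbreviation "H \<equiv> graph_of n es"

lemma H_simps [simp]: "verts H = {..<n}" "arcs H = set es" "tail H = fst" "head H = snd"
  by (simp_all add: graph_of_def)

lemma arc_less: "e < length es \<Longrightarrow> fst (es ! e) < n" "e < length es \<Longrightarrow> snd (es ! e) < n"
  using tail_in_verts[of "es ! e"] head_in_verts[of "es ! e"] by simp_all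

lemma n_pos: "0 < n"
  using arc_less(1)[of 0] es by (cases n) auto

lemma connected: "u < n \<Longrightarrow> v < n \<Longrightarrow> \<exists>p. awalk u p v"
  using conn unfolding strongly_connected_def by (simp add: reachable_awalk)

text \<open>Every vertex has an outgoing arc: the first arc of a walk to the tail of some arc, or
  that arc itself if the walk is empty. This lets \<open>O(n)\<close> work per step count as
  \<open>O(m)\<close>.\<close>

lemma n_le: "n \<le> length es"
proof -
  have "\<exists>a\<in>set es. fst a = v" if v: "v < n" for v
  proof -
    have hd: "hd es \<in> set es" using es by simp
    then have "fst (hd es) < n" using tail_in_verts[of "hd es"] by simp
    then obtain p where p: "awalk v p (fst (hd es))" using connected v by blast
    then show ?thesis using hd by (cases p) (auto simp: awalk_simps)
  qed
  then have "{..<n} \<subseteq> fst ` set es" by force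
  then have "n \<le> card (fst ` set es)" using card_mono[of "fst ` set es" "{..<n}"] by simp
  also have "\<dots> \<le> length es" using card_image_le[of "set es" fst] card_length[of es] by simp
  finally show ?thesis .
qed

text \<open>Without repeated arcs \<open>m\<close> is polynomial in \<open>n\<close>, so arc indices
  fit into words of logarithmic length.\<close>

lemma length_es_le: "distinct es \<Longrightarrow> length es \<le> n * n"
proof -
  assume "distinct es"
  then have "length es = card (set es)" by (simp add: distinct_card)
  also have "\<dots> \<le> card ({..<n} \<times> {..<n})"
    using tail_in_verts head_in_verts by (intro card_mono) auto
  finally show ?thesis by simp
qed

text \<open>Loop removal turns any walk into a path of fewer than \<open>n\<close> arcs. This bounds
  the diameter and with it the round counters of the search.\<close>

lemma hop_dist_walk:
  assumes "u < n" "v < n"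
  obtains p where "awalk u p v" "length p = hop_dist H u v" "length p < n"
proof -
  obtain q where "awalk u q v" using connected assms by blast
  then have "\<exists>k p. awalk u p v \<and> length p = k" by blast
  then have "\<exists>p. awalk u p v \<and> length p = hop_dist H u v"
    unfolding hop_dist_def by (rule LeastI_ex)
  then obtain p where p: "awalk u p v" "length p = hop_dist H u v" by blast
  have ap: "apath u (awalk_to_apath q) v" using \<open>awalk u q v\<close> by (rule apath_awalk_to_apath)
  then have "hop_dist H u v \<le> length (awalk_to_apath q)"
    unfolding hop_dist_def by (intro Least_le) (auto intro: awalkI_apath)
  also have "\<dots> < n" using length_apath_less[OF ap] by simp
  finally show thesis using that p by simp
qed

lemma diameter:
  "u < n \<Longrightarrow> v < n \<Longrightarrow> hop_dist H u v \<le> diameter_hops H" "diameter_hops H \<le> n"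
proof -
  let ?A = "{hop_dist H u v | u v. u \<in> verts H \<and> v \<in> verts H}"
  have A: "?A = (\<lambda>(u, v). hop_dist H u v) ` ({..<n} \<times> {..<n})" by auto
  then have fin: "finite ?A" by (simp only:) blast
  show "hop_dist H u v \<le> diameter_hops H" if "u < n" "v < n"
    unfolding diameter_hops_def using fin that by (intro Max_ge) auto
  have "x \<le> n" if x: "x \<in> ?A" for x
  proof -
    obtain u v where uv: "x = hop_dist H u v" "u < n" "v < n" using x by auto
    obtain p where "awalk u p v" "length p = hop_dist H u v" "length p < n" using hop_dist_walk[OF uv(2,3)] .
    then show ?thesis using uv by simp
  qed
  moreover have "?A \<noteq> {}" using n_pos by auto
  ultimately show "diameter_hops H \<le> n" unfolding diameter_hops_def using fin by (intro Max.boundedI) auto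
qed

lemma finite_cycles: "finite {p. cycle p}"
proof (rule finite_subset)
  show "{p. cycle p} \<subseteq> {p. set p \<subseteq> set es \<and> distinct p}"
    by (auto simp: cycle_conv awalk_def)
  show "finite {p. set p \<subseteq> set es \<and> distinct p}" by (rule finite_subset_distinct) simp
qed

text \<open>Strong connectivity closes any arc by a walk from its head back to its tail, and the
  closed walk contains a cycle; so the minimum ranges over a nonempty finite set and is
  attained.\<close>

lemma minimal_cycle:
  obtains u C where "awalk u C u" "C \<noteq> []" "mean_weight w C = min_mean_cycle H w"
proof -
  have a: "hd es \<in> set es" using es by simp
  then have "fst (hd es) < n" "snd (hd es) < n" using tail_in_verts[of "hd es"] head_in_verts[of "hd es"] by simp_all
  then obtain q where "awalk (snd (hd es)) q (fst (hd es))" using connected by blast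
  with a have "awalk (fst (hd es)) (hd es # q) (fst (hd es))" by (simp add: awalk_Cons_iff)
  then have "closed_w (hd es # q)" unfolding closed_w_def by auto
  then have "{p. cycle p} \<noteq> {}" using closed_w_imp_cycle by blast
  then have "min_mean_cycle H w \<in> mean_weight w ` {p. cycle p}"
    unfolding min_mean_cycle_def using finite_cycles by (intro Min_in) auto
  then show thesis using that unfolding cycle_def by auto
qed

end

section \<open>Search levels, tables and stacks in terms of walks\<close>

context arc_list begin

abbreviation "src e \<equiv> fst (es ! e)"
abbreviation "dst e \<equiv> snd (es ! e)"

lemma reach_from_0: "awalk 0 p v \<Longrightarrow> v \<in> reach (length es) src dst (length p)"
proof (induction p arbitrary: v rule: rev_induct)
  case Nil
  then show ?case by (simp add: awalk_Nil_iff)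
next
  case (snoc a p)
  then have a: "awalk 0 p (fst a)" "a \<in> set es" "v = snd a"
    by (auto simp: awalk_simps simp del: awalk_verts_conv)
  obtain e where e: "e < length es" "es ! e = a" using a(2) by (auto simp: in_set_conv_nth)
  with snoc.IH[OF a(1)] a(3) show ?case by (auto intro!: image_eqI[of _ _ e])
qed

lemma reach_to_0: "awalk v p 0 \<Longrightarrow> v \<in> reach (length es) dst src (length p)"
proof (induction p arbitrary: v)
  case Nil
  then show ?case by (simp add: awalk_Nil_iff)
next
  case (Cons a p)
  then have a: "awalk (snd a) p 0" "a \<in> set es" "v = fst a" by (auto simp: awalk_simps)
  obtain e where e: "e < length es" "es ! e = a" using a(2) by (auto simp: in_set_conv_nth)
  with Cons.IH[OF a(1)] a(3) show ?case by (auto intro!: image_eqI[of _ _ e])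
qed

lemma walk_from_0: "v \<in> reach (length es) src dst k \<Longrightarrow> \<exists>p. awalk 0 p v \<and> length p \<le> k"
proof (induction k arbitrary: v)
  case 0
  then show ?case using n_pos by (auto simp: awalk_Nil_iff)
next
  case (Suc k)
  show ?case
  proof (cases "v \<in> reach (length es) src dst k")
    case True
    then show ?thesis using Suc.IH le_Suc_eq by blast
  next
    case False
    with Suc.prems obtain e where e: "e < length es" "src e \<in> reach (length es) src dst k" "v = dst e" by auto
    then obtain p where "awalk 0 p (src e)" "length p \<le> k" using Suc.IH by blast
    moreover have "awalk (src e) [es ! e] (dst e)" using arc_implies_awalk[of "es ! e"] e(1) by simp
    ultimately show ?thesis using e(3) awalk_appendI by (intro exI[of _ "p @ [es ! e]"]) (auto simp del: awalk_append_iff)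
  qed
qed

lemma walk_to_0: "v \<in> reach (length es) dst src k \<Longrightarrow> \<exists>p. awalk v p 0 \<and> length p \<le> k"
proof (induction k arbitrary: v)
  case 0
  then show ?case using n_pos by (auto simp: awalk_Nil_iff)
next
  case (Suc k)
  show ?case
  proof (cases "v \<in> reach (length es) dst src k")
    case True
    then show ?thesis using Suc.IH le_Suc_eq by blast
  next
    case False
    with Suc.prems obtain e where e: "e < length es" "dst e \<in> reach (length es) dst src k" "v = src e" by auto
    then obtain p where "awalk (dst e) p 0" "length p \<le> k" using Suc.IH by blast
    then show ?thesis using e by (intro exI[of _ "es ! e # p"]) (auto simp: awalk_Cons_iff)
  qed
qed

lemma reach_full:
  "{..<n} \<subseteq> reach (length es) src dst (diameter_hops H)" "{..<n} \<subseteq> reach (length es) dst src (diameter_hops H)"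
proof -
  show "{..<n} \<subseteq> reach (length es) src dst (diameter_hops H)"
  proof
    fix v assume "v \<in> {..<n}"
    then have v: "v < n" by simp
    obtain p where "awalk 0 p v" "length p = hop_dist H 0 v" "length p < n" using hop_dist_walk[OF n_pos v] .
    then show "v \<in> reach (length es) src dst (diameter_hops H)"
      using reach_from_0 reach_mono diameter(1)[OF n_pos v] by (metis subsetD)
  qed
  show "{..<n} \<subseteq> reach (length es) dst src (diameter_hops H)"
  proof
    fix v assume "v \<in> {..<n}"
    then have v: "v < n" by simp
    obtain p where "awalk v p 0" "length p = hop_dist H v 0" "length p < n" using hop_dist_walk[OF v n_pos] .
    then show "v \<in> reach (length es) dst src (diameter_hops H)"
      using reach_to_0 reach_mono diameter(1)[OF v n_pos] by (metis subsetD)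
  qed
qed

lemma arc_data:
  assumes "\<And>e. e < length es \<Longrightarrow> - M \<le> \<omega> e" "\<And>e. e < length es \<Longrightarrow> \<omega> e < 0"
  shows "arc_data (length es) n src dst \<omega> M"
  using assms arc_less n_pos by unfold_locales auto

text \<open>Completeness of the table, by induction on the last arc of the walk. That finite cells
  come from actual walks is not shown here; it is the business of the parent pointers.\<close>

lemma table_walk:
  assumes ad: "arc_data (length es) n src dst \<omega> M"
    and t: "arc_data.table (length es) n src dst \<omega> M K 0 T P"
    and \<gamma>: "\<And>e. e < length es \<Longrightarrow> \<omega> e = \<gamma> (es ! e)"
  shows "awalk 0 p v \<Longrightarrow> length p \<le> K \<Longrightarrow> T (length p) v < 0 \<and> T (length p) v \<le> sum_list (map \<gamma> p) - 1"
proof (induction p arbitrary: v rule: rev_induct)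
  interpret A: arc_data "length es" n src dst \<omega> M by (fact ad)
  case Nil
  then show ?case using t n_pos unfolding A.table_def by (simp add: awalk_Nil_iff)
next
  interpret A: arc_data "length es" n src dst \<omega> M by (fact ad)
  case (snoc a p)
  then have a: "awalk 0 p (fst a)" "a \<in> set es" "v = snd a" "length p < K" by (auto simp: awalk_simps)
  obtain e where e: "e < length es" "es ! e = a" using a(2) by (auto simp: in_set_conv_nth)
  have "T (length p) (src e) < 0" using snoc.IH[OF a(1)] a(4) e by simp
  then have "T (Suc (length p)) (dst e) \<le> T (length p) (src e) + \<omega> e"
    using t a(4) e(1) unfolding A.table_def by blast
  with snoc.IH[OF a(1)] a(3,4) e \<gamma>[OF e(1)] A.\<omega>(2)[OF e(1)] show ?case by simp
qed

lemma linked_awalk: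
  assumes ad: "arc_data (length es) n src dst \<omega> M"
  shows "arc_data.linked src dst a ys b \<Longrightarrow> set ys \<subseteq> {..<length es} \<Longrightarrow> a < n \<Longrightarrow>
    awalk b (map ((!) es) (rev ys)) a"
proof (induction ys arbitrary: a)
  interpret A: arc_data "length es" n src dst \<omega> M by (fact ad)
  case Nil
  then show ?case by (simp add: awalk_Nil_iff)
next
  interpret A: arc_data "length es" n src dst \<omega> M by (fact ad)
  case (Cons y ys)
  then have "awalk b (map ((!) es) (rev ys)) (src y)" using arc_less(1)[of y] by auto
  moreover have "awalk (src y) [es ! y] a" using arc_implies_awalk[of "es ! y"] Cons.prems by simp
  ultimately show ?case by (simp add: awalk_appendI del: awalk_append_iff)
qed

text \<open>The vertices of a walk without the first one are the heads of its arcs, so distinct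
  heads are exactly what turns a nonempty closed walk into a cycle.\<close>

lemma good_cycle:
  assumes ad: "arc_data (length es) n src dst \<omega> M"
    and good: "arc_data.good (length es) src dst \<omega> R d s"
    and \<gamma>: "\<And>e. e < length es \<Longrightarrow> \<omega> e = \<gamma> (es ! e)"
  obtains \<sigma> where "outputs es s \<sigma>" "cycle \<sigma>" "sum_list (map \<gamma> \<sigma>) * int d \<le> R * int (length \<sigma>)"
proof -
  interpret A: arc_data "length es" n src dst \<omega> M by (fact ad)
  obtain ys v where ys: "ys \<noteq> []" "set ys \<subseteq> {..<length es}" "A.linked v ys v" "distinct (map dst ys)"
    "A.weight ys * int d \<le> R * int (length ys)" "s ''len'' 0 = int (length ys)"
    "\<forall>j<length ys. s ''out'' (int j) = int (rev ys ! j)"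
    using good unfolding A.good_def by blast
  define \<sigma> where "\<sigma> = map ((!) es) (rev ys)"
  have "v < n" using ys(1-3) arc_less(2)[of "hd ys"] by (cases ys) auto
  then have w: "awalk v \<sigma> v" unfolding \<sigma>_def using linked_awalk[OF ad ys(3,2)] by simp
  then have "cas v \<sigma> v" by auto
  moreover have "map snd \<sigma> = rev (map dst ys)" unfolding \<sigma>_def by (simp add: rev_map comp_def)
  ultimately have "distinct (tl (awalk_verts v \<sigma>))"
    using ys(4) awalk_verts_conv'[of v \<sigma> v] by simp
  then have "cycle \<sigma>" using w ys(1) unfolding cycle_def \<sigma>_def by auto
  moreover have "outputs es s \<sigma>"
  proof -
    have "rev ys ! j < length es" if "j < length ys" for j
      using ys(2) that nth_mem[of j "rev ys"] by auto
    then show ?thesis unfolding outputs_def \<sigma>_def using ys(6,7) by simp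
  qed
  moreover have "sum_list (map \<gamma> \<sigma>) = A.weight ys"
  proof -
    have "map (\<lambda>e. \<gamma> (es ! e)) ys = map \<omega> ys" using ys(2) \<gamma> by (intro map_cong) (auto simp: subset_iff)
    moreover have "sum_list (map \<gamma> \<sigma>) = sum_list (map (\<lambda>e. \<gamma> (es ! e)) ys)"
      unfolding \<sigma>_def by (simp add: rev_map[symmetric] comp_def)
    ultimately show ?thesis by (simp only:)
  qed
  ultimately show thesis using that ys(5) by (simp add: \<sigma>_def)
qed

text \<open>
  A walk from \<open>0\<close> to a minimum mean cycle, along a light window of it of length \<open>j\<close>, and back to \<open>0\<close>.
\<close>

lemma light_closed_walk:
  fixes \<alpha> :: "nat \<times> nat \<Rightarrow> int"
  assumes C: "awalk u C u" "C \<noteq> []"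
    and r: "{..<n} \<subseteq> reach (length es) src dst r1" "{..<n} \<subseteq> reach (length es) dst src r2"
    and \<alpha>: "\<And>a. a \<in> set es \<Longrightarrow> \<alpha> a \<le> W"
  obtains q where "awalk 0 q 0" "j \<le> length q" "length q \<le> j + r1 + r2"
    "sum_list (map \<alpha> q) * int (length C) \<le>
       (int (length q) - int j) * W * int (length C) + int j * sum_list (map \<alpha> C)"
proof -
  obtain v q v' where q: "awalk v q v'" "length q = j"
    "sum_list (map \<alpha> q) * int (length C) \<le> int j * sum_list (map \<alpha> C)"
    using light_subwalk[OF C] .
  have "v < n" "v' < n" using q(1) awalk_hd_in_verts awalk_last_in_verts by fastforce+
  then obtain a b where a: "awalk 0 a v" "length a \<le> r1" and b: "awalk v' b 0" "length b \<le> r2"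
    using r walk_from_0 walk_to_0 by (metis lessThan_iff subsetD)
  have up: "sum_list (map \<alpha> p) \<le> int (length p) * W" if "set p \<subseteq> set es" for p
    using that
  proof (induction p)
    case (Cons x p)
    then show ?case using \<alpha>[of x] by (auto simp: algebra_simps)
  qed simp
  have "set a \<subseteq> set es" "set b \<subseteq> set es" using a(1) b(1) by (auto simp: awalk_def)
  then have "sum_list (map \<alpha> (a @ q @ b)) \<le> (int (length (a @ q @ b)) - int j) * W + sum_list (map \<alpha> q)"
    using up[of a] up[of b] q(2) by (simp add: algebra_simps)
  then have "sum_list (map \<alpha> (a @ q @ b)) * int (length C) \<le>
      ((int (length (a @ q @ b)) - int j) * W + sum_list (map \<alpha> q)) * int (length C)"
    by (intro mult_right_mono) auto
  also have "\<dots> = (int (length (a @ q @ b)) - int j) * W * int (length C) + sum_list (map \<alpha> q) * int (length C)"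
    by (simp add: distrib_right)
  finally have "sum_list (map \<alpha> (a @ q @ b)) * int (length C) \<le>
       (int (length (a @ q @ b)) - int j) * W * int (length C) + int j * sum_list (map \<alpha> C)"
    using q(3) by linarith
  moreover have "awalk 0 (a @ q @ b) 0" using a b q by (auto intro!: awalk_appendI simp del: awalk_append_iff)
  moreover have "j \<le> length (a @ q @ b)" "length (a @ q @ b) \<le> j + r1 + r2" using a b q by auto
  ultimately show thesis using that by blast
qed

text \<open>Everything is measured in units of \<open>1 / pr\<close>. The at most \<open>D\<close>
  connecting arcs exceed the optimal mean \<open>pr * \<mu>\<close> by at most \<open>2 * W\<close>
  each, and the choice of \<open>j\<close> spreads this to at most
  \<open>pr * \<epsilon> / 2\<close> per arc of the walk. Passing from floors back to weights costs
  1 per arc, again at most \<open>pr * \<epsilon> / 2\<close>.\<close>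

lemma mean_weight_approx:
  fixes \<alpha> :: "nat \<times> nat \<Rightarrow> int" and pr :: real and W R :: int
  assumes \<alpha>: "\<And>a. a \<in> set es \<Longrightarrow> \<alpha> a = \<lfloor>pr * w a\<rfloor>" "\<And>a. a \<in> set es \<Longrightarrow> \<bar>\<alpha> a\<bar> \<le> W"
    and pr: "0 < pr" "2 \<le> pr * \<epsilon>"
    and r: "{..<n} \<subseteq> reach (length es) src dst r1" "{..<n} \<subseteq> reach (length es) dst src r2" "r1 + r2 \<le> D" "0 \<le> W"
    and j: "0 < j" "4 * real D * real_of_int W \<le> real j * (pr * \<epsilon>)"
    and best: "\<And>q. awalk 0 q 0 \<Longrightarrow> 0 < length q \<Longrightarrow> length q \<le> j + D \<Longrightarrow>
       R * int (length q) \<le> sum_list (map (\<lambda>a. \<alpha> a - (W + 1)) q) * int d"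
    and d: "0 < d"
    and \<sigma>: "cycle \<sigma>" "sum_list (map (\<lambda>a. \<alpha> a - (W + 1)) \<sigma>) * int d \<le> R * int (length \<sigma>)"
  shows "mean_weight w \<sigma> \<le> min_mean_cycle H w + \<epsilon>"
proof -
  obtain u C where C: "awalk u C u" "C \<noteq> []" "mean_weight w C = min_mean_cycle H w"
    using minimal_cycle .
  define \<mu> where "\<mu> = min_mean_cycle H w"
  obtain q where q: "awalk 0 q 0" "j \<le> length q" "length q \<le> j + r1 + r2"
    "sum_list (map \<alpha> q) * int (length C) \<le>
       (int (length q) - int j) * W * int (length C) + int j * sum_list (map \<alpha> C)"
    using light_closed_walk[OF C(1,2) r(1,2), of \<alpha> W j] \<alpha>(2) by (metis abs_le_D1)
  let ?k = "length q" and ?l = "length \<sigma>" and ?L = "length C"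
  have k: "0 < ?k" "?k \<le> j + D" using q j r(3) by auto
  have l: "0 < ?l" using \<sigma>(1) by (auto simp: cycle_def)
  have L: "0 < ?L" using C by simp
  have shift: "sum_list (map (\<lambda>a. \<alpha> a - (W + 1)) p) = sum_list (map \<alpha> p) - (W + 1) * int (length p)" for p
    by (induction p) (simp_all add: algebra_simps)
  have "(sum_list (map \<alpha> \<sigma>) - (W + 1) * int ?l) * int ?k * int d \<le> (R * int ?l) * int ?k"
    using mult_right_mono[OF \<sigma>(2)[unfolded shift], of "int ?k"] by (simp add: mult.assoc mult.commute[of "int d"])
  also have "\<dots> = (R * int ?k) * int ?l" by simp
  also have "\<dots> \<le> ((sum_list (map \<alpha> q) - (W + 1) * int ?k) * int d) * int ?l"
    using best[OF q(1) k] unfolding shift by (intro mult_right_mono) auto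
  finally have "(sum_list (map \<alpha> \<sigma>) - (W + 1) * int ?l) * int ?k * int d
     \<le> (sum_list (map \<alpha> q) - (W + 1) * int ?k) * int ?l * int d" by (simp add: mult.commute mult.left_commute)
  then have "(sum_list (map \<alpha> \<sigma>) - (W + 1) * int ?l) * int ?k \<le> (sum_list (map \<alpha> q) - (W + 1) * int ?k) * int ?l"
    using d by simp
  \<comment> \<open>The shift contributes \<open>(W + 1) * k * l\<close> to both sides and
    cancels.\<close>
  then have "sum_list (map \<alpha> \<sigma>) * int ?k \<le> sum_list (map \<alpha> q) * int ?l" by (simp add: algebra_simps)
  then have 1: "real_of_int (sum_list (map \<alpha> \<sigma>)) * ?k \<le> real_of_int (sum_list (map \<alpha> q)) * ?l"
    by (metis of_int_le_iff of_int_mult of_int_of_nat_eq)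
  have cost: "awalk_cost w p = sum_list (map w p)" for p by (simp add: awalk_cost_def)
  have lower: "real_of_int (sum_list (map \<alpha> p)) \<le> pr * sum_list (map w p)"
    and upper: "pr * sum_list (map w p) \<le> real_of_int (sum_list (map \<alpha> p)) + length p"
    and absW: "- (W * int (length p)) \<le> sum_list (map \<alpha> p)" if "set p \<subseteq> set es" for p
    using that
  proof (induction p)
    case (Cons a p)
    {
      case 1
      have "real_of_int (\<alpha> a) \<le> pr * w a" using 1 \<alpha>(1)[of a] by simp
      with Cons.IH(1) 1 show ?case by (simp add: distrib_left)
    next
      case 2
      have "pr * w a \<le> \<alpha> a + 1" using 2 \<alpha>(1)[of a] by simp
      with Cons.IH(2) 2 show ?case by (simp add: distrib_left)
    next
      case 3
      have "- W \<le> \<alpha> a" using 3 \<alpha>(2)[of a] by auto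
      with Cons.IH(3) 3 show ?case by (simp add: algebra_simps)
    }
  qed simp_all
  have sub: "set C \<subseteq> set es" "set \<sigma> \<subseteq> set es" using C(1) \<sigma>(1) by (auto simp: awalk_def cycle_def)
  have mC: "sum_list (map w C) = \<mu> * ?L" using C(3) L unfolding mean_weight_def cost \<mu>_def by (simp add: field_simps)
  have aC: "real_of_int (sum_list (map \<alpha> C)) \<le> pr * \<mu> * ?L" using lower[OF sub(1)] mC by simp
  have "- (real_of_int W * ?L) \<le> pr * \<mu> * ?L"
    using absW[OF sub(1)] aC by (metis of_int_le_iff of_int_minus of_int_mult of_int_of_nat_eq order_trans)
  then have "- real_of_int W * ?L \<le> pr * \<mu> * ?L" by simp
  \<comment> \<open>The optimum is at least \<open>- W\<close> as well, so an arc of weight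
    \<open>W\<close> lies at most \<open>2 * W\<close> above it.\<close>
  then have low: "- real_of_int W \<le> pr * \<mu>" by (rule mult_right_le_imp_le) (use L in simp)
  have "real_of_int (sum_list (map \<alpha> q)) * ?L \<le> (real ?k - real j) * W * ?L + real j * sum_list (map \<alpha> C)"
  proof -
    have "real_of_int (sum_list (map \<alpha> q) * int ?L) \<le>
      real_of_int ((int ?k - int j) * W * int ?L + int j * sum_list (map \<alpha> C))" using q(4) by (simp only: of_int_le_iff)
    then show ?thesis by simp
  qed
  also have "\<dots> \<le> (real ?k - real j) * W * ?L + real j * (pr * \<mu> * ?L)"
    using aC by (intro add_left_mono mult_left_mono) auto
  also have "\<dots> = ((real ?k - real j) * W + real j * (pr * \<mu>)) * ?L" by (simp add: algebra_simps)
  finally have "real_of_int (sum_list (map \<alpha> q)) \<le> (real ?k - real j) * W + real j * (pr * \<mu>)"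
    by (rule mult_right_le_imp_le) (use L in simp)
  also have "\<dots> = real ?k * (pr * \<mu>) + (real ?k - real j) * (W - pr * \<mu>)" by (simp add: algebra_simps)
  also have "\<dots> \<le> real ?k * (pr * \<mu>) + real D * (2 * W)"
  proof -
    have "(real ?k - real j) * (W - pr * \<mu>) \<le> (real ?k - real j) * (2 * W)"
      using low q(2) by (intro mult_left_mono) auto
    also have "\<dots> \<le> real D * (2 * W)" using q(2) k(2) r(4) by (intro mult_right_mono) auto
    finally show ?thesis by simp
  qed
  also have "\<dots> \<le> real ?k * (pr * \<mu>) + real ?k * (pr * \<epsilon> / 2)"
  proof -
    have "real j * (pr * \<epsilon>) \<le> real ?k * (pr * \<epsilon>)" using q(2) pr by (intro mult_right_mono) auto
    then show ?thesis using j(2) by simp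
  qed
  finally have 2: "real_of_int (sum_list (map \<alpha> q)) \<le> real ?k * (pr * \<mu> + pr * \<epsilon> / 2)"
    by (simp add: distrib_left)
  have "pr * sum_list (map w \<sigma>) * ?k \<le> (real_of_int (sum_list (map \<alpha> \<sigma>)) + ?l) * ?k"
    using upper[OF sub(2)] by (intro mult_right_mono) auto
  also have "\<dots> \<le> (real_of_int (sum_list (map \<alpha> q)) + ?k) * ?l" using 1 by (simp add: algebra_simps)
  also have "\<dots> \<le> (real ?k * (pr * \<mu> + pr * \<epsilon> / 2) + ?k) * ?l" using 2 by (intro mult_right_mono) auto
  also have "\<dots> = (pr * \<mu> + pr * \<epsilon> / 2 + 1) * ?l * ?k" by (simp add: algebra_simps)
  finally have "pr * sum_list (map w \<sigma>) \<le> (pr * \<mu> + pr * \<epsilon> / 2 + 1) * ?l"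
    by (rule mult_right_le_imp_le) (use k(1) in simp)
  also have "\<dots> \<le> (pr * \<mu> + pr * \<epsilon>) * ?l" using pr(2) by (intro mult_right_mono) auto
  also have "\<dots> = pr * ((\<mu> + \<epsilon>) * ?l)" by (simp add: algebra_simps)
  finally have "sum_list (map w \<sigma>) \<le> (\<mu> + \<epsilon>) * ?l" using pr(1) by simp
  then show ?thesis using l unfolding mean_weight_def cost \<mu>_def by (simp add: field_simps)
qed

end

section \<open>The complete program\<close>

text \<open>\<open>I\<close> exceeds \<open>p / \<epsilon>\<close>, so the quotient plus 1 is at
  least \<open>4 * D * W / (p * \<epsilon>)\<close>, the window length demanded by the error
  estimate. \<open>K\<close> adds to it the \<open>D\<close> arcs allowed for the connections to and
  from 0.\<close>

definition params :: prog where
  "params =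
     put ''D'' (var ''r1'' [+] var ''r2'') ;;
     put ''I'' (Fix ''inv_eps'' (Lit 0) (var ''s'') [+] Lit 1) ;;
     put ''K'' (var ''D'' [+] Op Quot (Lit 4 [*] var ''D'' [*] var ''W'' [*] var ''I'') (var ''p'' [*] var ''p'') [+] Lit 1) ;;
     put ''g'' (var ''W'' [+] Lit 1)"

definition min_mean_prog :: prog where
  "min_mean_prog =
     scan ;; precision ;; scan ;;
     search ''tail'' ''head'' ''l1'' ''r1'' ;; search ''head'' ''tail'' ''l2'' ''r2'' ;;
     params ;; walks ;; select ;; follow"

lemma runs_params:
  fixes D k :: nat and W p I :: int
  assumes s: "s ''r1'' 0 + s ''r2'' 0 = int D" "0 \<le> s ''r1'' 0" "0 \<le> s ''r2'' 0" "s ''W'' 0 = W" "s ''p'' 0 = p" "s ''s'' 0 = int k"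
    and I: "\<lfloor>2 ^ k * \<rho> ''inv_eps'' 0\<rfloor> + 1 = I" "1 \<le> I" and W: "0 \<le> W" and p: "0 < p"
    and B: "k \<le> B" "int k < cap B" "4 * int D * W * I < cap B" "p * p < cap B" "4 * int D < cap B" "4 * int D * W < cap B"
      "int D + 4 * int D * W * I div (p * p) + 1 < cap B" "W + 1 < cap B" "I < cap B" "4 < cap B" "p < cap B"
  shows "runs B \<rho> params s (\<lambda>t s'. t \<le> 100 \<and> agree {''D'', ''I'', ''K'', ''g''} s s' \<and>
     s' ''K'' 0 = int D + 4 * int D * W * I div (p * p) + 1 \<and> s' ''g'' 0 = W + 1)"
proof -
  have "0 \<le> 4 * int D * W" "0 \<le> 4 * int D * W * I" using W I by auto
  moreover have "0 \<le> 4 * int D * W * I div (p * p)"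
    using calculation p by (intro pos_imp_zdiv_nonneg_iff[THEN iffD2]) auto
  ultimately have f: "fits B 0" "fits B 1" "fits B 4" "fits B (int D)" "fits B (s ''r1'' 0)" "fits B (s ''r2'' 0)"
    "fits B W" "fits B p" "fits B (int k)" "fits B I" "fits B (4 * int D)" "fits B (4 * int D * W)"
    "fits B (4 * int D * W * I)" "fits B (p * p)" "fits B (4 * int D * W * I div (p * p))"
    "fits B (int D + 4 * int D * W * I div (p * p))" "fits B (int D + 4 * int D * W * I div (p * p) + 1)" "fits B (W + 1)"
    "fits B (I - 1)"
    using B s(1-3) I W p unfolding fits_cap by auto
  have I': "\<lfloor>2 ^ k * \<rho> ''inv_eps'' 0\<rfloor> = I - 1" using I by simp
  show ?thesis
    unfolding params_def using f B(1) by (simp add: s I')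
qed

section \<open>Sizes of the parameters and of the running time\<close>

lemma abs_floor_mult_le:
  fixes x p c :: real
  assumes "- c \<le> x" "x \<le> c" "0 \<le> p"
  shows "\<bar>\<lfloor>p * x\<rfloor>\<bar> \<le> \<lceil>p * c\<rceil>"
proof -
  have "p * x \<le> p * c" "- (p * c) \<le> p * x"
    using assms mult_left_mono[of x c p] mult_left_mono[of "- c" x p] by auto
  then show ?thesis by linarith
qed

text \<open>\<open>W\<close> is bounded through both arguments of the minimum: \<open>wmax\<close>
  yields the claimed time, while \<open>A + 1 \<le> p\<close> controls the rounding terms even when
  \<open>wmax\<close> is far above the actual weights.\<close>

locale scaling =
  fixes n D :: nat and \<epsilon> wmax X :: real and A W p I J :: int
  assumes \<epsilon>: "0 < \<epsilon>" and wmax: "0 \<le> wmax" and X: "X = 2 + real n + 1 / \<epsilon> + wmax"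
    and A: "0 \<le> A" "A \<le> \<lceil>wmax\<rceil>"
    and p: "4 * (\<lfloor>1 / \<epsilon>\<rfloor> + 1) + A \<le> p" "p < 2 * (4 * (\<lfloor>1 / \<epsilon>\<rfloor> + 1) + A)"
    and W: "0 \<le> W" "W \<le> \<lceil>real_of_int p * min wmax (real_of_int A + 1)\<rceil>"
    and I: "I = \<lfloor>real_of_int p * (1 / \<epsilon>)\<rfloor> + 1"
    and D: "2 \<le> D" "D \<le> 2 * (n + 1)"
    and J: "J = 4 * int D * W * I div (p * p) + 1"
begin

lemma X2: "2 \<le> X" "1 / \<epsilon> \<le> X - 2" "wmax \<le> X - 2" "real n + 2 \<le> X"
  using \<epsilon> wmax unfolding X by auto

lemma pow_X: "i \<le> j \<Longrightarrow> X ^ i \<le> X ^ j"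
  using X2 by (intro power_increasing) auto

lemma p_ge: "4 * (1 / \<epsilon>) \<le> real_of_int p" "4 \<le> p" "real_of_int A + 1 \<le> real_of_int p"
proof -
  have "1 / \<epsilon> \<le> real_of_int (\<lfloor>1 / \<epsilon>\<rfloor> + 1)" by linarith
  moreover have "real_of_int (4 * (\<lfloor>1 / \<epsilon>\<rfloor> + 1) + A) \<le> real_of_int p" using p(1) by (simp only: of_int_le_iff)
  moreover have "0 \<le> \<lfloor>1 / \<epsilon>\<rfloor>" using \<epsilon> by simp
  ultimately show "4 * (1 / \<epsilon>) \<le> real_of_int p" "4 \<le> p" "real_of_int A + 1 \<le> real_of_int p"
    using A p(1) by (simp_all, linarith+)
qed

lemma p_le: "real_of_int p \<le> 8 * X"
proof -
  have "real_of_int p \<le> real_of_int (2 * (4 * (\<lfloor>1 / \<epsilon>\<rfloor> + 1) + A))" using p(2) by (simp only: of_int_le_iff)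
  also have "\<dots> \<le> 8 * (1 / \<epsilon>) + 8 + 2 * (wmax + 1)"
  proof -
    have "real_of_int A \<le> wmax + 1" using A(2) by linarith
    moreover have "real_of_int (2 * (4 * (\<lfloor>1 / \<epsilon>\<rfloor> + 1) + A)) = 8 * real_of_int \<lfloor>1 / \<epsilon>\<rfloor> + 8 + 2 * real_of_int A"
      by simp
    moreover have "2 * (wmax + 1) = 2 * wmax + 2" by simp
    ultimately show ?thesis using of_int_floor_le[of "1 / \<epsilon>"] by linarith
  qed
  also have "\<dots> \<le> 8 * X" using \<epsilon> wmax unfolding X by simp
  finally show ?thesis .
qed

lemma p_eps: "2 \<le> real_of_int p * \<epsilon>"
proof -
  have "4 * (1 / \<epsilon>) * \<epsilon> \<le> real_of_int p * \<epsilon>" using p_ge(1) \<epsilon> by (intro mult_right_mono) auto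
  then show ?thesis using \<epsilon> by simp
qed

lemma W_le: "real_of_int W \<le> real_of_int p * wmax + 1" "real_of_int W \<le> real_of_int p * min wmax (real_of_int p) + 1"
proof -
  have 1: "real_of_int W \<le> real_of_int p * min wmax (real_of_int A + 1) + 1" using W(2) by linarith
  have "real_of_int p * min wmax (real_of_int A + 1) \<le> real_of_int p * min wmax (real_of_int p)"
    using p_ge by (intro mult_left_mono) auto
  with 1 show 2: "real_of_int W \<le> real_of_int p * min wmax (real_of_int p) + 1" by linarith
  have "real_of_int p * min wmax (real_of_int p) \<le> real_of_int p * wmax"
    using p_ge by (intro mult_left_mono) auto
  with 2 show "real_of_int W \<le> real_of_int p * wmax + 1" by linarith
qed

lemma I_bounds: "real_of_int p * (1 / \<epsilon>) \<le> real_of_int I" "real_of_int I \<le> real_of_int p * (1 / \<epsilon>) + 1" "1 \<le> I"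
proof -
  show "real_of_int p * (1 / \<epsilon>) \<le> real_of_int I" "real_of_int I \<le> real_of_int p * (1 / \<epsilon>) + 1"
    unfolding I by linarith+
  have "0 \<le> real_of_int p * (1 / \<epsilon>)" using \<epsilon> p_ge by simp
  then show "1 \<le> I" unfolding I by simp
qed

lemma J_bounds:
  "1 \<le> J" "4 * real D * real_of_int W \<le> real_of_int J * (real_of_int p * \<epsilon>)"
  "real_of_int J \<le> 4 * real D * real_of_int W * real_of_int I / (real_of_int p)\<^sup>2 + 1"
proof -
  let ?N = "4 * int D * W * I"
  have N: "0 \<le> ?N" "0 < p * p" using W I_bounds p_ge by auto
  then have "0 \<le> ?N div (p * p)" by (simp add: pos_imp_zdiv_nonneg_iff)
  then show "1 \<le> J" unfolding J by simp
  have q: "real_of_int (?N div (p * p)) = \<lfloor>real_of_int ?N / real_of_int (p * p)\<rfloor>"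
    by (simp only: floor_divide_of_int_eq)
  then show "real_of_int J \<le> 4 * real D * real_of_int W * real_of_int I / (real_of_int p)\<^sup>2 + 1"
    unfolding J using of_int_floor_le[of "real_of_int ?N / real_of_int (p * p)"] by (simp add: power2_eq_square)
  have "real_of_int ?N / real_of_int (p * p) \<le> real_of_int J"
    unfolding J using q by (simp del: of_int_mult)
  moreover have pp: "0 < real_of_int (p * p)" using N by (simp only: of_int_0_less_iff)
  ultimately have "real_of_int ?N \<le> real_of_int J * real_of_int (p * p)" by (simp add: field_simps)
  moreover have "4 * real D * real_of_int W * (real_of_int p * (1 / \<epsilon>)) \<le> real_of_int ?N"
  proof -
    have "4 * real D * real_of_int W * (real_of_int p * (1 / \<epsilon>)) \<le> 4 * real D * real_of_int W * real_of_int I"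
      using I_bounds(1) W(1) by (intro mult_left_mono) auto
    then show ?thesis by simp
  qed
  ultimately have "4 * real D * real_of_int W * (real_of_int p * (1 / \<epsilon>)) \<le> real_of_int J * real_of_int (p * p)" by linarith
  then have "4 * real D * real_of_int W * (1 / \<epsilon>) * real_of_int p \<le> (real_of_int J * real_of_int p) * real_of_int p"
    by (simp add: algebra_simps)
  then have "4 * real D * real_of_int W * (1 / \<epsilon>) \<le> real_of_int J * real_of_int p"
    by (rule mult_right_le_imp_le) (use p_ge in simp)
  then have "4 * real D * real_of_int W * (1 / \<epsilon>) * \<epsilon> \<le> real_of_int J * real_of_int p * \<epsilon>"
    using \<epsilon> by (intro mult_right_mono) auto
  then show "4 * real D * real_of_int W \<le> real_of_int J * (real_of_int p * \<epsilon>)" using \<epsilon> by simp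
qed

text \<open>In the expansion of \<open>(p * v + 1) * (p / \<epsilon> + 1)\<close> each lower term is
  at most \<open>p ^ 2\<close>, because \<open>p\<close> dominates \<open>v\<close> and
  \<open>1 / \<epsilon>\<close>; this is why \<open>A\<close> enters the choice of the precision.
  Hence \<open>J\<close> is at most 17 times \<open>D * max 1 (wmax / \<epsilon>)\<close>, and the
  summand \<open>D\<close> brings this to 18.\<close>

lemma J_time: "real D + real_of_int J \<le> 18 * real D * max 1 (wmax / \<epsilon>)"
proof -
  let ?p = "real_of_int p" and ?v = "min wmax (real_of_int p)"
  have p0: "4 \<le> ?p" using p_ge by simp
  have v: "0 \<le> ?v" "?v \<le> wmax" "?v \<le> ?p" using wmax p0 by auto
  have "real_of_int W * real_of_int I \<le> (?p * ?v + 1) * (?p * (1 / \<epsilon>) + 1)"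
    using W_le(2) I_bounds W v p0 by (intro mult_mono) auto
  also have "\<dots> = ?p\<^sup>2 * (?v * (1 / \<epsilon>)) + ?p * ?v + ?p * (1 / \<epsilon>) + 1"
    by (simp add: algebra_simps power2_eq_square)
  also have "\<dots> \<le> ?p\<^sup>2 * (wmax * (1 / \<epsilon>)) + ?p * ?p + ?p * ?p + ?p * ?p"
  proof -
    have "?v * (1 / \<epsilon>) \<le> wmax * (1 / \<epsilon>)" using v \<epsilon> by (intro mult_right_mono) auto
    then have "?p\<^sup>2 * (?v * (1 / \<epsilon>)) \<le> ?p\<^sup>2 * (wmax * (1 / \<epsilon>))" by (intro mult_left_mono) auto
    moreover have "1 / \<epsilon> \<le> ?p" using p_ge(1) \<epsilon> p0 by (smt (verit) zero_less_divide_1_iff)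
    then have "?p * (1 / \<epsilon>) \<le> ?p * ?p" using p0 by (intro mult_left_mono) auto
    moreover have "?p * ?v \<le> ?p * ?p" using v p0 by (intro mult_left_mono) auto
    moreover have "1 * 1 \<le> ?p * ?p" using p0 by (intro mult_mono) auto
    ultimately show ?thesis by linarith
  qed
  also have "\<dots> = ?p\<^sup>2 * (wmax / \<epsilon> + 3)" by (simp add: algebra_simps power2_eq_square)
  finally have WI: "real_of_int W * real_of_int I \<le> ?p\<^sup>2 * (wmax / \<epsilon> + 3)" .
  have "4 * real D * real_of_int W * real_of_int I \<le> 4 * real D * (?p\<^sup>2 * (wmax / \<epsilon> + 3))"
    unfolding mult.assoc using WI by (intro mult_left_mono) auto
  then have "4 * real D * real_of_int W * real_of_int I / ?p\<^sup>2 \<le> 4 * real D * (wmax / \<epsilon> + 3)"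
    using p0 by (simp add: divide_le_eq algebra_simps)
  then have "real_of_int J \<le> 4 * real D * (wmax / \<epsilon> + 3) + 1" using J_bounds(3) by linarith
  also have "\<dots> \<le> 4 * real D * (4 * max 1 (wmax / \<epsilon>)) + real D * max 1 (wmax / \<epsilon>)"
  proof -
    have "1 * 1 \<le> real D * max 1 (wmax / \<epsilon>)" using D by (intro mult_mono) auto
    moreover have "4 * real D * (wmax / \<epsilon> + 3) \<le> 4 * real D * (4 * max 1 (wmax / \<epsilon>))"
      by (intro mult_left_mono) auto
    ultimately show ?thesis by linarith
  qed
  finally have "real_of_int J \<le> 17 * (real D * max 1 (wmax / \<epsilon>))" by simp
  moreover have "real D * 1 \<le> real D * max 1 (wmax / \<epsilon>)" by (intro mult_left_mono) auto
  ultimately show ?thesis by simp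
qed

text \<open>Since \<open>2 \<le> X\<close>, each constant factor 2 is paid for by one more power of
  \<open>X\<close>. The exponents are generous.\<close>

lemma sizes:
  "real_of_int p \<le> X ^ 4" "real_of_int W \<le> X ^ 5" "real_of_int I \<le> X ^ 5" "real D \<le> X ^ 2"
  "real_of_int (4 * int D * W * I) \<le> X ^ 14" "real D + real_of_int J \<le> X ^ 16"
proof -
  have two: "2 ^ i * X ^ j \<le> X ^ (i + j)" for i j
    unfolding power_add using X2 by (intro mult_right_mono power_mono) auto
  show pX: "real_of_int p \<le> X ^ 4" using p_le two[of 3 1] by simp
  have sq: "8 * X * (X - 2) + 1 \<le> X ^ 5"
  proof -
    have "8 * X * (X - 2) + 1 \<le> 8 * X ^ 2" using X2(1) by (simp add: power2_eq_square algebra_simps)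
    also have "\<dots> \<le> X ^ 5" using two[of 3 2] by simp
    finally show ?thesis .
  qed
  have "real_of_int p * wmax \<le> 8 * X * (X - 2)" using p_le X2 wmax p_ge by (intro mult_mono) auto
  then show W5: "real_of_int W \<le> X ^ 5" using W_le(1) sq by linarith
  have "real_of_int p * (1 / \<epsilon>) \<le> 8 * X * (X - 2)" using p_le X2 \<epsilon> p_ge by (intro mult_mono) auto
  then show I5: "real_of_int I \<le> X ^ 5" using I_bounds(2) sq by linarith
  have "real D \<le> 2 * (real n + 1)" using of_nat_mono[OF D(2), where 'a = real] by simp
  also have "\<dots> \<le> 2 * X" using X2 by simp
  also have "\<dots> \<le> X ^ 2" unfolding power2_eq_square using X2 by (intro mult_right_mono) auto
  finally show D2: "real D \<le> X ^ 2" .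
  have "4 * real D * real_of_int W * real_of_int I \<le> X ^ 2 * X ^ 2 * X ^ 5 * X ^ 5"
    using D2 W5 I5 W I_bounds X2 two[of 2 0] by (intro mult_mono) auto
  also have "\<dots> = X ^ 14" by (simp flip: power_add)
  finally show N: "real_of_int (4 * int D * W * I) \<le> X ^ 14" by simp
  have "4 * real D * real_of_int W * real_of_int I / (real_of_int p)\<^sup>2 \<le> X ^ 14"
  proof -
    have "1 * 1 \<le> real_of_int p * real_of_int p" using p_ge by (intro mult_mono) auto
    then have "4 * real D * real_of_int W * real_of_int I / (real_of_int p)\<^sup>2 \<le> 4 * real D * real_of_int W * real_of_int I / 1"
      using W I_bounds by (intro divide_left_mono) (auto simp: power2_eq_square)
    also have "\<dots> \<le> X ^ 14" using N by simp
    finally show ?thesis .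
  qed
  then have "real D + real_of_int J \<le> X ^ 2 + X ^ 14 + 1" using J_bounds(3) D2 by linarith
  also have "\<dots> \<le> X ^ 14 + X ^ 14 + X ^ 14 + X ^ 14"
    using pow_X[of 2 14] pow_X[of 0 14] by (simp add: power_0)
  also have "\<dots> \<le> X ^ 16" using two[of 2 14] by simp
  finally show "real D + real_of_int J \<le> X ^ 16" .
qed

end

text \<open>The logarithm \<open>L\<close> pays for the doublings in \<open>precision\<close>; the
  other phases are bounded by multiples of \<open>m * \<Delta> * Y\<close>. The coefficients of
  \<open>Z\<close> add up to 52400.\<close>

lemma time_bound:
  fixes m n d k K t :: nat and \<Delta> Y L :: real
  assumes m: "1 \<le> m" "n \<le> m" and \<Delta>: "1 \<le> \<Delta>" "real d \<le> \<Delta>" and Y: "1 \<le> Y" and L: "1 \<le> L"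
    and k: "real k \<le> 4 * L" and K: "real K \<le> 72 * \<Delta> * Y"
    and t: "t \<le> (60 * m + 40) + (40 * k + 40) + (60 * m + 40) + 200 * ((d + 1) * (m + 1)) + 100 +
      100 * (K + 1) * (m + 1) + 100 * (K + 1) + 200 * ((K + 1) * (n + 1))"
  shows "real t \<le> 60000 * real m * \<Delta> * Y * L"
proof -
  define Z where "Z = real m * \<Delta> * Y * L"
  have up: "a * b * c * e \<le> Z" if "0 \<le> a" "0 \<le> b" "0 \<le> c" "0 \<le> e" "a \<le> real m" "b \<le> \<Delta>" "c \<le> Y" "e \<le> L" for a b c e
    unfolding Z_def using that by (intro mult_mono) auto
  have 1: "1 \<le> Z" "real m \<le> Z" "L \<le> Z" using up[of 1 1 1 1] up[of "real m" 1 1 1] up[of 1 1 1 L] m \<Delta> Y L by auto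
  have 2: "real m * \<Delta> \<le> Z" "real m * \<Delta> * Y \<le> Z" "\<Delta> * Y \<le> Z"
    using up[of "real m" \<Delta> 1 1] up[of "real m" \<Delta> Y 1] up[of 1 \<Delta> Y 1] m \<Delta> Y L by auto
  have "1 * 1 \<le> \<Delta> * Y" using \<Delta> Y by (intro mult_mono) auto
  then have K1: "real K + 1 \<le> 73 * (\<Delta> * Y)" using K by simp
  have "(real d + 1) * (real m + 1) \<le> (2 * \<Delta>) * (2 * real m)" using \<Delta> m by (intro mult_mono) auto
  moreover have "(2 * \<Delta>) * (2 * real m) = 4 * (real m * \<Delta>)" by simp
  ultimately have 3: "(real d + 1) * (real m + 1) \<le> 4 * Z" using 2(1) by linarith
  have "(real K + 1) * (real m + 1) \<le> (73 * (\<Delta> * Y)) * (2 * real m)" using K1 m \<Delta> Y by (intro mult_mono) auto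
  then have 4: "(real K + 1) * (real m + 1) \<le> 146 * Z" using 2(2) by (simp add: algebra_simps)
  have "(real K + 1) * (real n + 1) \<le> (real K + 1) * (real m + 1)" using m by (intro mult_left_mono) auto
  then have 5: "(real K + 1) * (real n + 1) \<le> 146 * Z" using 4 by linarith
  have "real t \<le> (60 * real m + 40) + (40 * real k + 40) + (60 * real m + 40) + 200 * ((real d + 1) * (real m + 1)) + 100 +
      100 * ((real K + 1) * (real m + 1)) + 100 * (real K + 1) + 200 * ((real K + 1) * (real n + 1))"
    using of_nat_mono[OF t, where 'a = real] by (simp add: algebra_simps)
  also have "\<dots> \<le> 60000 * Z"
  proof -
    have "60 * a + 40 + (40 * b + 40) + (60 * a + 40) + 200 * c + 100 + 100 * e + 100 * (f + 1) + 200 * g \<le> 60000 * Z"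
      if "a \<le> Z" "b \<le> 4 * Z" "c \<le> 4 * Z" "e \<le> 146 * Z" "f + 1 \<le> 73 * Z" "g \<le> 146 * Z" for a b c e f g :: real
      using that 1(1) by simp
    then show ?thesis using 1 2 3 4 5 K1 k by simp
  qed
  finally show ?thesis by (simp add: Z_def)
qed

text \<open>The exponent 44 is one more than the largest one needed, \<open>X ^ 43\<close> for the
  products in \<open>select\<close>; the extra power makes the comparison with \<open>cap B\<close>
  strict.\<close>

lemma cap_ge:
  assumes "2 \<le> X" and B: "B = nat \<lceil>44 * log 2 X\<rceil>"
  shows "X ^ 44 \<le> real_of_int (cap B)" "real B \<le> 45 * log 2 X" "44 * log 2 X \<le> real B" "1 \<le> log 2 X"
proof -
  show L: "1 \<le> log 2 X" using assms(1) by (simp add: le_log_iff)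
  show B1: "44 * log 2 X \<le> real B" unfolding B by linarith
  show "real B \<le> 45 * log 2 X" unfolding B using L by linarith
  have "X ^ 44 = 2 powr (log 2 (X ^ 44))" using assms(1) by simp
  also have "\<dots> = 2 powr (44 * log 2 X)" using assms(1) by (simp add: log_nat_power)
  also have "\<dots> \<le> 2 powr real B" using B1 by simp
  also have "\<dots> = real_of_int (cap B)" by (simp add: cap_def powr_realpow)
  finally show "X ^ 44 \<le> real_of_int (cap B)" .
qed

section \<open>Composition of the phases\<close>

lemma runsE:
  assumes "runs B \<rho> P s Q"
  obtains t s' where "exec B \<rho> P s t s'" "Q t s'"
  using assms unfolding runs_def by blast

context arc_list begin

lemma min_mean_prog_correct:
  assumes dist: "distinct es" and w: "\<forall>e\<in>set es. w e \<in> {- wmax..wmax}" and \<epsilon>: "0 < \<epsilon>"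
  shows "\<exists>B t s \<sigma>.
        exec B (input_reals es w \<epsilon>) min_mean_prog (input_store n es) t s \<and>
        outputs es s \<sigma> \<and> cycle \<sigma> \<and>
        mean_weight w \<sigma> \<le> min_mean_cycle H w + \<epsilon> \<and>
        real t \<le> real 60000 * real (length es) * max 1 (real (diameter_hops H))
                   * max 1 (wmax / \<epsilon>) * polylog 1 n \<epsilon> wmax \<and>
        real B \<le> real 60000 * polylog 1 n \<epsilon> wmax"
proof -
  define X where "X = 2 + real n + 1 / \<epsilon> + wmax"
  define B where "B = nat \<lceil>44 * log 2 X\<rceil>"
  define m where "m = length es"
  define d where "d = diameter_hops H"
  let ?\<rho> = "input_reals es w \<epsilon>" and ?s0 = "input_store n es"
  have wb: "- wmax \<le> w (es ! i)" "w (es ! i) \<le> wmax" if "i < m" for i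
    using w that by (auto simp: m_def)
  have m: "1 \<le> m" "n \<le> m" "m \<le> n * n" using es n_le length_es_le[OF dist] by (auto simp: m_def Suc_le_eq)
  have wmax: "0 \<le> wmax" using wb[of 0] m by linarith
  have d: "d \<le> n" using diameter(2) by (simp add: d_def)
  have X2: "2 \<le> X" "1 / \<epsilon> \<le> X - 2" "wmax \<le> X - 2" "real n + 2 \<le> X" "0 \<le> 1 / \<epsilon>"
    using \<epsilon> wmax unfolding X_def by auto
  note cap = cap_ge[OF X2(1) B_def]
  have X_less: "z < cap B" if "real_of_int z \<le> X ^ 43" for z
  proof -
    have "X ^ 43 < X ^ 44" using X2 by (intro power_strict_increasing) auto
    then show ?thesis using that cap(1) by linarith
  qed
  have pow: "X ^ i \<le> X ^ j" if "i \<le> j" for i j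
    using X2 that by (intro power_increasing) auto
  have two: "2 ^ i * X ^ j \<le> X ^ (i + j)" for i j
    unfolding power_add using X2 by (intro mult_right_mono power_mono) auto
  have X_small: "real_of_int z \<le> X ^ i \<Longrightarrow> i \<le> 43 \<Longrightarrow> z < cap B" for z i
    using X_less pow[of i 43] by (meson order_trans)

  have Bm: "int m < cap B"
  proof (rule X_small[of _ 2])
    have "real m \<le> real n * real n" using of_nat_mono[OF m(3), where 'a = real] by simp
    also have "\<dots> \<le> X * X" using X2 by (intro mult_mono) auto
    finally show "real_of_int (int m) \<le> X ^ 2" by (simp add: power2_eq_square)
  qed simp
  have Bn: "int n + 2 < cap B" using X2 by (intro X_small[of _ 1]) auto
  have B2: "2 \<le> cap B" "4 < cap B" using X_small[of 4 3] two[of 3 0] by auto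

  have in0: "?s0 ''n'' 0 = int n" "?s0 ''m'' 0 = int m"
    "\<And>e. e < m \<Longrightarrow> ?s0 ''tail'' (int e) = int (src e)" "\<And>e. e < m \<Longrightarrow> ?s0 ''head'' (int e) = int (dst e)"
    by (auto simp: input_store_def m_def)
  have zero: "?s0 x = (\<lambda>_. 0)" if "x \<notin> {''n'', ''m'', ''tail'', ''head''}" for x
    using that by (auto simp: input_store_def fun_eq_iff)
  have \<rho>: "\<And>i. i < m \<Longrightarrow> ?\<rho> ''w'' (int i) = w (es ! i)" "?\<rho> ''inv_eps'' 0 = 1 / \<epsilon>"
    by (auto simp: input_reals_def m_def)

  define E where "E = \<lfloor>1 / \<epsilon>\<rfloor>"
  have E0: "0 \<le> E" using \<epsilon> by (simp add: E_def)
  have cw: "real_of_int \<lceil>wmax\<rceil> \<le> X" "0 \<le> \<lceil>wmax\<rceil>"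
    using X2 wmax of_int_ceiling_le_add_one[of wmax] by linarith+
  have "runs B ?\<rho> scan ?s0 (\<lambda>t s'. t \<le> 60 * m + 40 \<and> agree {''i'', ''W'', ''x'', ''b''} ?s0 s' \<and>
     s' ''W'' 0 \<le> \<lceil>wmax\<rceil> \<and> 0 \<le> s' ''W'' 0 \<and>
     (\<forall>i<m. s' ''b'' (int i) = \<lfloor>w (es ! i)\<rfloor> \<and> \<bar>\<lfloor>w (es ! i)\<rfloor>\<bar> \<le> s' ''W'' 0))"
  proof (rule runs_scan[where k = 0])
    show "\<bar>\<lfloor>w (es ! i)\<rfloor>\<bar> \<le> \<lceil>wmax\<rceil>" if "i < m" for i
      using abs_floor_mult_le[OF wb[OF that], of 1] by simp
    show "\<lceil>wmax\<rceil> < cap B" using cw by (intro X_small[of _ 1]) auto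
  qed (use in0 zero \<rho> Bm B2 cw in auto)
  then obtain t1 s1 where x1: "exec B ?\<rho> scan ?s0 t1 s1" "t1 \<le> 60 * m + 40"
    and a1: "agree {''i'', ''W'', ''x'', ''b''} ?s0 s1"
    and r1: "s1 ''W'' 0 \<le> \<lceil>wmax\<rceil>" "0 \<le> s1 ''W'' 0" "\<And>i. i < m \<Longrightarrow> \<bar>\<lfloor>w (es ! i)\<rfloor>\<bar> \<le> s1 ''W'' 0"
    by (elim runsE) blast

  define A where "A = s1 ''W'' 0"
  have A: "0 \<le> A" "A \<le> \<lceil>wmax\<rceil>" using r1 by (auto simp: A_def)
  have fl: "\<lfloor>?\<rho> ''inv_eps'' 0\<rfloor> = E" by (simp add: \<rho>(2) E_def)
  have s10: "s1 ''s'' 0 = 0" using agreeD[OF a1, of "''s''"] zero by simp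
  have cap2: "2 * (4 * (E + 1) + A) \<le> cap B"
  proof -
    have "real_of_int (2 * (4 * (E + 1) + A)) \<le> 8 * (1 / \<epsilon>) + 8 + 2 * X"
    proof -
      have "real_of_int (2 * (4 * (E + 1) + A)) = 8 * real_of_int E + 8 + 2 * real_of_int A" by simp
      moreover have "real_of_int E \<le> 1 / \<epsilon>" "real_of_int A \<le> X" using A(2) cw(1) unfolding E_def by linarith+
      ultimately show ?thesis by linarith
    qed
    also have "\<dots> \<le> 2 ^ 4 * X ^ 1" using X2 by simp
    also have "\<dots> \<le> X ^ 5" using two[of 4 1] by simp
    finally show ?thesis using X_small[of _ 5] by fastforce
  qed
  obtain k where k: "4 * (E + 1) + A \<le> 2 ^ k" "2 ^ k < 2 * (4 * (E + 1) + A)"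
    and run2: "runs B ?\<rho> precision s1 (\<lambda>t s'. t \<le> 40 * k + 40 \<and> agree {''p'', ''s''} s1 s' \<and>
       s' ''s'' 0 = int k \<and> s' ''p'' 0 = 2 ^ k)"
    by (rule runs_precision[where s = s1 and V = A and E = E and \<rho> = "?\<rho>" and B = B, OF s10 A_def[symmetric] fl A(1) E0 cap2])
  obtain t2 s2 where x2: "exec B ?\<rho> precision s1 t2 s2" "t2 \<le> 40 * k + 40"
    and a2: "agree {''p'', ''s''} s1 s2" and r2: "s2 ''s'' 0 = int k" "s2 ''p'' 0 = 2 ^ k"
    using run2 by (elim runsE) blast

  define p :: int where "p = 2 ^ k"
  define w' where "w' = min wmax (real_of_int A + 1)"
  define U where "U = \<lceil>real_of_int p * w'\<rceil>"
  have p0: "1 \<le> p" by (simp add: p_def)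
  have w'0: "0 \<le> w'" using wmax A by (simp add: w'_def)
  have "0 \<le> real_of_int p * w'" using p0 w'0 by (intro mult_nonneg_nonneg) auto
  then have U0: "0 \<le> U" unfolding U_def by linarith
  define I where "I = \<lfloor>real_of_int p * (1 / \<epsilon>)\<rfloor> + 1"
  \<comment> \<open>\<open>D\<close> and the maximum of the second scan do not exist yet. A
    provisional instance with the values 2 and \<open>U\<close> already provides the sizes of
    \<open>p\<close> and \<open>U\<close> that this scan relies on.\<close>
  interpret S0: scaling n 2 \<epsilon> wmax X A U p I "4 * int 2 * U * I div (p * p) + 1"
    using \<epsilon> wmax A U0 k n_pos by unfold_locales (auto simp: X_def E_def p_def U_def w'_def I_def)
  have kL: "real k \<le> 4 * log 2 X"
  proof -
    have "real k = log 2 (real_of_int p)" by (simp add: p_def)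
    also have "\<dots> \<le> log 2 (X ^ 4)" using S0.sizes(1) p0 by (intro log_mono) auto
    also have "\<dots> = 4 * log 2 X" using X2 by (simp add: log_nat_power)
    finally show ?thesis .
  qed
  have kB: "k \<le> B" using kL cap(3,4) by linarith
  have kcap: "int k < cap B"
  proof -
    have "int k < p" unfolding p_def by simp
    then show ?thesis using X_small[OF S0.sizes(1)] by simp
  qed
  define \<alpha> where "\<alpha> = (\<lambda>a. \<lfloor>real_of_int p * w a\<rfloor>)"
  have abs_le: "\<bar>\<alpha> (es ! i)\<bar> \<le> U" if i: "i < m" for i
  proof -
    \<comment> \<open>\<open>A\<close> bounds only the floors of the weights, hence the loss of
      1.\<close>
    have "\<bar>w (es ! i)\<bar> \<le> real_of_int A + 1" using r1(3)[OF i] unfolding A_def by linarith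
    then have "- w' \<le> w (es ! i)" "w (es ! i) \<le> w'" using wb[OF i] by (auto simp: w'_def)
    then show ?thesis unfolding \<alpha>_def U_def using abs_floor_mult_le p0 by simp
  qed
  have "runs B ?\<rho> scan s2 (\<lambda>t s'. t \<le> 60 * m + 40 \<and> agree {''i'', ''W'', ''x'', ''b''} s2 s' \<and>
     s' ''W'' 0 \<le> U \<and> 0 \<le> s' ''W'' 0 \<and>
     (\<forall>i<m. s' ''b'' (int i) = \<alpha> (es ! i) \<and> \<bar>\<alpha> (es ! i)\<bar> \<le> s' ''W'' 0))"
  proof (rule runs_scan[where k = k])
    show "s2 ''m'' 0 = int m" using agreeD[OF a2, of "''m''"] agreeD[OF a1, of "''m''"] in0 by simp
    show "U < cap B" using S0.sizes(2) by (rule X_small) simp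
    show "\<lfloor>2 ^ k * ?\<rho> ''w'' (int i)\<rfloor> = \<alpha> (es ! i)" if "i < m" for i
      using \<rho>(1)[OF that] by (simp add: \<alpha>_def p_def)
  qed (use r2 Bm B2 kB kcap abs_le U0 in auto)
  then obtain t3 s3 where x3: "exec B ?\<rho> scan s2 t3 s3" "t3 \<le> 60 * m + 40"
    and a3: "agree {''i'', ''W'', ''x'', ''b''} s2 s3"
    and r3: "s3 ''W'' 0 \<le> U" "0 \<le> s3 ''W'' 0" "\<And>i. i < m \<Longrightarrow> s3 ''b'' (int i) = \<alpha> (es ! i)"
      "\<And>i. i < m \<Longrightarrow> \<bar>\<alpha> (es ! i)\<bar> \<le> s3 ''W'' 0"
    by (elim runsE) blast

  let ?X3 = "{''i'', ''W'', ''x'', ''b'', ''p'', ''s''}"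
  have b3: "agree ?X3 ?s0 s3" using a1 a2 a3 by (auto simp: agree_def)
  have reach_n: "{..<n} \<subseteq> reach m src dst d" "{..<n} \<subseteq> reach m dst src d"
    using reach_full by (simp_all add: m_def d_def)
  have arcs: "\<And>e. e < m \<Longrightarrow> src e < n" "\<And>e. e < m \<Longrightarrow> dst e < n" using arc_less by (auto simp: m_def)
  have "runs B ?\<rho> (search ''tail'' ''head'' ''l1'' ''r1'') s3 (\<lambda>t s'. t \<le> 100 * ((d + 1) * (m + 1)) \<and>
      agree {''l1'', ''c'', ''i'', ''r1''} s3 s' \<and>
      (\<exists>k\<le>d. s' ''r1'' 0 = int k + 1 \<and> {..<n} \<subseteq> reach m src dst k))"
    using agreeD[OF b3, of "''m''"] agreeD[OF b3, of "''n''"] agreeD[OF b3, of "''tail''"]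
      agreeD[OF b3, of "''head''"] agreeD[OF b3, of "''l1''"] in0 zero arcs n_pos reach_n Bm Bn d
    by (intro runs_search) auto
  then obtain t4 s4 k1 where x4: "exec B ?\<rho> (search ''tail'' ''head'' ''l1'' ''r1'') s3 t4 s4" "t4 \<le> 100 * ((d + 1) * (m + 1))"
    and a4: "agree {''l1'', ''c'', ''i'', ''r1''} s3 s4"
    and r4: "k1 \<le> d" "s4 ''r1'' 0 = int k1 + 1" "{..<n} \<subseteq> reach m src dst k1"
    by (elim runsE) blast
  let ?X4 = "{''i'', ''W'', ''x'', ''b'', ''p'', ''s'', ''l1'', ''c'', ''r1''}"
  have b4: "agree ?X4 ?s0 s4" using b3 a4 by (auto simp: agree_def)
  have "runs B ?\<rho> (search ''head'' ''tail'' ''l2'' ''r2'') s4 (\<lambda>t s'. t \<le> 100 * ((d + 1) * (m + 1)) \<and>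
      agree {''l2'', ''c'', ''i'', ''r2''} s4 s' \<and>
      (\<exists>k\<le>d. s' ''r2'' 0 = int k + 1 \<and> {..<n} \<subseteq> reach m dst src k))"
    using agreeD[OF b4, of "''m''"] agreeD[OF b4, of "''n''"] agreeD[OF b4, of "''tail''"]
      agreeD[OF b4, of "''head''"] agreeD[OF b4, of "''l2''"] in0 zero arcs n_pos reach_n Bm Bn d
    by (intro runs_search) auto
  then obtain t5 s5 k2 where x5: "exec B ?\<rho> (search ''head'' ''tail'' ''l2'' ''r2'') s4 t5 s5" "t5 \<le> 100 * ((d + 1) * (m + 1))"
    and a5: "agree {''l2'', ''c'', ''i'', ''r2''} s4 s5"
    and r5: "k2 \<le> d" "s5 ''r2'' 0 = int k2 + 1" "{..<n} \<subseteq> reach m dst src k2"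
    by (elim runsE) blast
  let ?X5 = "{''i'', ''W'', ''x'', ''b'', ''p'', ''s'', ''l1'', ''c'', ''r1'', ''l2'', ''r2''}"
  have b5: "agree ?X5 ?s0 s5" using b4 a5 by (auto simp: agree_def)
  have c5: "agree {''l1'', ''c'', ''i'', ''r1'', ''l2'', ''r2''} s3 s5" using a4 a5 by (auto simp: agree_def)

  \<comment> \<open>The search counts levels from 1, so \<open>r1\<close> and \<open>r2\<close>
    exceed the levels \<open>k1\<close> and \<open>k2\<close> by 1 each.\<close>
  define D where "D = k1 + k2 + 2"
  define W where "W = s3 ''W'' 0"
  define J where "J = 4 * int D * W * I div (p * p) + 1"
  interpret S: scaling n D \<epsilon> wmax X A W p I J
    using \<epsilon> wmax A r3(1,2) k r4(1) r5(1) d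
    by unfold_locales (auto simp: X_def E_def p_def U_def w'_def I_def W_def D_def J_def)
  define j where "j = nat J"
  define K where "K = D + j"
  have j: "0 < j" "int j = J" using S.J_bounds(1) by (auto simp: j_def)
  have Jj: "real_of_int J = real j" using j(2) by (metis of_int_of_nat_eq)
  have K16: "real K \<le> X ^ 16" using S.sizes(6) unfolding Jj by (simp add: K_def)
  have e5: "s5 ''W'' 0 = W" "s5 ''p'' 0 = p" "s5 ''s'' 0 = int k" "s5 ''r1'' 0 = int k1 + 1"
    using agreeD[OF c5, of "''W''"] agreeD[OF c5, of "''p''"] agreeD[OF c5, of "''s''"]
      agreeD[OF a3, of "''p''"] agreeD[OF a3, of "''s''"] agreeD[OF a5, of "''r1''"] r2 r4
    by (simp_all add: W_def p_def)
  have DW: "real_of_int (4 * int D * W) \<le> X ^ 9" "real_of_int (4 * int D) \<le> X ^ 4"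
  proof -
    have "4 * real D * W \<le> X ^ 2 * X ^ 2 * X ^ 5"
      using S.sizes(2,4) S.W two[of 2 0] X2 by (intro mult_mono) auto
    then show "real_of_int (4 * int D * W) \<le> X ^ 9" by (simp flip: power_add)
    have "4 * real D \<le> X ^ 2 * X ^ 2" using S.sizes(4) two[of 2 0] X2 by (intro mult_mono) auto
    then show "real_of_int (4 * int D) \<le> X ^ 4" by (simp flip: power_add)
  qed
  have pp: "real_of_int (p * p) \<le> X ^ 8"
  proof -
    have "real_of_int p * real_of_int p \<le> X ^ 4 * X ^ 4" using S.sizes(1) p0 X2 by (intro mult_mono) auto
    then show ?thesis by (simp flip: power_add)
  qed
  have W1: "real_of_int (W + 1) \<le> X ^ 6"
    using S.sizes(2) two[of 1 5] pow[of 0 5] by simp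
  have KJ: "int D + 4 * int D * W * I div (p * p) + 1 = int K" using j(2) by (simp add: K_def J_def)
  have "runs B ?\<rho> params s5 (\<lambda>t s'. t \<le> 100 \<and> agree {''D'', ''I'', ''K'', ''g''} s5 s' \<and>
     s' ''K'' 0 = int D + 4 * int D * W * I div (p * p) + 1 \<and> s' ''g'' 0 = W + 1)"
  proof (rule runs_params)
    show "s5 ''r1'' 0 + s5 ''r2'' 0 = int D" using e5 r5 by (simp add: D_def)
    show "\<lfloor>2 ^ k * ?\<rho> ''inv_eps'' 0\<rfloor> + 1 = I" using \<rho>(2) by (simp add: I_def p_def)
    show "4 * int D * W * I < cap B" using S.sizes(5) by (rule X_small) simp
    show "p * p < cap B" using pp by (rule X_small) simp
    show "4 * int D * W < cap B" using DW(1) by (rule X_small) simp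
    show "4 * int D < cap B" using DW(2) by (rule X_small) simp
    show "int D + 4 * int D * W * I div (p * p) + 1 < cap B" unfolding KJ using K16 by (intro X_small[of _ 16]) auto
    show "W + 1 < cap B" using W1 by (rule X_small) simp
    show "I < cap B" using S.sizes(3) by (rule X_small) simp
    show "p < cap B" using S.sizes(1) by (rule X_small) simp
  qed (use e5 r5 S.I_bounds S.W p0 kB kcap B2 in auto)
  then obtain t6 s6 where x6: "exec B ?\<rho> params s5 t6 s6" "t6 \<le> 100"
    and a6: "agree {''D'', ''I'', ''K'', ''g''} s5 s6" and r6: "s6 ''K'' 0 = int K" "s6 ''g'' 0 = W + 1"
    unfolding KJ by (elim runsE) blast
  let ?X6 = "{''i'', ''W'', ''x'', ''b'', ''p'', ''s'', ''l1'', ''c'', ''r1'', ''l2'', ''r2'', ''D'', ''I'', ''K'', ''g''}"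
  have b6: "agree ?X6 ?s0 s6" using b5 a6 by (auto simp: agree_def)
  have c6: "s6 ''b'' = s3 ''b''" using agreeD[OF a6, of "''b''"] agreeD[OF c5, of "''b''"] by simp

  define \<gamma> where "\<gamma> = (\<lambda>a. \<alpha> a - (W + 1))"
  define M where "M = 2 * W + 1"
  have M: "1 \<le> M" using S.W by (simp add: M_def)
  have \<alpha>W: "\<bar>\<alpha> (es ! i)\<bar> \<le> W" if "i < m" for i using r3(4)[OF that] by (simp add: W_def)
  have ad: "arc_data m n src dst (\<lambda>e. \<gamma> (es ! e)) M"
    unfolding m_def
  proof (rule arc_data)
    fix e assume "e < length es"
    then have "\<bar>\<alpha> (es ! e)\<bar> \<le> W" using \<alpha>W by (simp add: m_def)
    then show "- M \<le> \<gamma> (es ! e)" "\<gamma> (es ! e) < 0" unfolding \<gamma>_def M_def by linarith+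
  qed
  interpret A: arc_data m n src dst "\<lambda>e. \<gamma> (es ! e)" M by (fact ad)
  have i6: "s6 ''m'' 0 = int m" "s6 ''n'' 0 = int n" "s6 ''tail'' = ?s0 ''tail''" "s6 ''head'' = ?s0 ''head''"
    using agreeD[OF b6, of "''m''"] agreeD[OF b6, of "''n''"] agreeD[OF b6, of "''tail''"] agreeD[OF b6, of "''head''"]
      in0(1,2) by simp_all
  have loaded6: "A.loaded s6"
    unfolding A.loaded_def i6 r6(2) c6
  proof (intro conjI allI impI)
    fix e assume e: "e < m"
    show "?s0 ''tail'' (int e) = int (src e)" "?s0 ''head'' (int e) = int (dst e)" using in0(3,4)[OF e] .
    show "s3 ''b'' (int e) - (W + 1) = \<gamma> (es ! e)" using r3(3)[OF e] by (simp add: \<gamma>_def)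
    show "\<bar>s3 ''b'' (int e)\<bar> \<le> M" using r3(3)[OF e] \<alpha>W[OF e] S.W(1) unfolding M_def by linarith
  qed (use S.W(1) in \<open>auto simp: M_def\<close>)
  have M7: "real_of_int M + 1 \<le> X ^ 7"
  proof -
    have "real_of_int M + 1 \<le> 2 * X ^ 5 + 2 * X ^ 5" using S.sizes(2) pow[of 0 5] by (simp add: M_def)
    then show ?thesis using two[of 2 5] by simp
  qed
  have K18: "real K + 2 \<le> X ^ 18"
  proof -
    have "real K + 2 \<le> X ^ 16 + X ^ 16 + X ^ 16" using K16 pow[of 0 16] by simp
    then show ?thesis using two[of 2 16] X2 zero_le_power[of X 16] by simp
  qed
  have roomy: "A.roomy K B"
    unfolding A.roomy_def
  proof (intro conjI)
    have "(real K + 2) * real n \<le> X ^ 18 * X ^ 1" using K18 X2 by (intro mult_mono) auto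
    then show "(int K + 2) * int n < cap B" by (intro X_small[of _ 19]) (simp_all flip: power_add power_Suc2)
    have "2 + (real K + 1) * real_of_int M \<le> 2 * X ^ 25"
    proof -
      have "(real K + 1) * real_of_int M \<le> X ^ 18 * X ^ 7" using K18 M7 M X2 by (intro mult_mono) auto
      moreover have "2 \<le> X ^ 25" using X2 pow[of 1 25] by simp
      ultimately show ?thesis by (simp flip: power_add)
    qed
    \<comment> \<open>The critical size of the whole run: the exponents 25 and 18 add up to 43, and
      the factor 2 is paid by the slack in the bound on \<open>K + 1\<close>.\<close>
    then have "(2 + (real K + 1) * real_of_int M) * (real K + 1) \<le> (2 * X ^ 25) * (X ^ 18 / 2)"
    proof (rule mult_mono)
      have "2 * (real K + 1) \<le> 2 * (X ^ 16 + X ^ 16)" using K16 pow[of 0 16] by simp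
      then show "real K + 1 \<le> X ^ 18 / 2" using two[of 2 16] by simp
    qed (use X2 in auto)
    then show "(2 + (int K + 1) * M) * (int K + 1) < cap B" by (intro X_small[of _ 43]) (simp_all flip: power_add)
    show "int m < cap B" by (fact Bm)
  qed
  have spacious: "A.spacious K B"
    unfolding A.spacious_def
  proof (intro conjI)
    have "(real n + 2) * ((real K + 2) * (real_of_int M + 1)) \<le> X ^ 1 * (X ^ 18 * X ^ 7)"
      using K18 M7 X2 M by (intro mult_mono) auto
    then show "(int n + 2) * ((int K + 2) * (M + 1)) < cap B"
      by (intro X_small[of _ 26]) (simp_all flip: power_add power_Suc)
    show "int m < cap B" by (fact Bm)
  qed

  have z6: "s6 ''F'' = (\<lambda>_. 0)" "s6 ''Q'' = (\<lambda>_. 0)"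
    using agreeD[OF b6, of "''F''"] agreeD[OF b6, of "''Q''"] zero by simp_all
  obtain t7 s7 where x7: "exec B ?\<rho> walks s6 t7 s7" "t7 \<le> 100 * (K + 1) * (m + 1)"
    and a7: "agree {''y'', ''x'', ''z'', ''F'', ''Q'', ''i'', ''k'', ''u'', ''v''} s6 s7"
    and r7: "A.table K 0 (grid n (s7 ''F'')) (grid n (s7 ''Q''))"
    using A.runs_walks[OF loaded6 r6(1) z6 roomy M, of ?\<rho>] by (elim runsE) blast
  have loaded7: "A.loaded s7" using loaded6 a7 by (rule A.loaded_agree) simp
  have K7: "s7 ''K'' 0 = int K" using agreeD[OF a7, of "''K''"] r6(1) by simp
  let ?T = "grid n (s7 ''F'')"
  obtain t8 s8 dd where x8: "exec B ?\<rho> select s7 t8 s8" "t8 \<le> 100 * (K + 1)"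
    and a8: "agree {''d'', ''R'', ''k'', ''u''} s7 s8" and r8: "s8 ''d'' 0 = int dd" "best K ?T (s8 ''R'' 0) dd"
    using A.runs_select[OF loaded7 K7 r7 roomy M, of ?\<rho>] by (elim runsE) blast
  have loaded8: "A.loaded s8" using loaded7 a8 by (rule A.loaded_agree) simp
  define R where "R = s8 ''R'' 0"

  have closed: "?T (length q) 0 < 0" "R * int (length q) \<le> sum_list (map \<gamma> q) * int dd"
    "R * int (length q) \<le> (?T (length q) 0 + 1) * int dd"
    if q: "awalk 0 q 0" "0 < length q" "length q \<le> K" for q
  proof -
    have g: "?T (length q) 0 < 0 \<and> ?T (length q) 0 \<le> sum_list (map \<gamma> q) - 1"
      using table_walk[of "\<lambda>e. \<gamma> (es ! e)" M K ?T "grid n (s7 ''Q'')" \<gamma> q 0] ad r7 q by (simp add: m_def)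
    then show "?T (length q) 0 < 0" by blast
    show 1: "R * int (length q) \<le> (?T (length q) 0 + 1) * int dd"
    proof -
      have "length q \<in> {1..K}" using q(2,3) by (simp add: Suc_le_eq)
      then show ?thesis using r8(2) g unfolding best_def R_def by blast
    qed
    have "(?T (length q) 0 + 1) * int dd \<le> sum_list (map \<gamma> q) * int dd"
      using g by (intro mult_right_mono) auto
    with 1 show "R * int (length q) \<le> sum_list (map \<gamma> q) * int dd" by linarith
  qed
  have \<alpha>set: "\<bar>\<alpha> a\<bar> \<le> W" if "a \<in> set es" for a using \<alpha>W that by (auto simp: in_set_conv_nth m_def)
  \<comment> \<open>Some closed walk must have been selected: the light walk through 0 is
    admissible, and against the ratio \<open>1 / 0\<close> its length would have to be at most
    0.\<close>
  have dd: "0 < dd"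
  proof (rule ccontr)
    assume "\<not> 0 < dd"
    then have R1: "dd = 0" "R = 1" using r8(2) unfolding best_def R_def by auto
    obtain u C where C: "awalk u C u" "C \<noteq> []" "mean_weight w C = min_mean_cycle H w" using minimal_cycle .
    obtain q where q: "awalk 0 q 0" "j \<le> length q" "length q \<le> j + k1 + k2"
      using light_closed_walk[OF C(1,2), of k1 k2 \<alpha> W j] r4(3) r5(3) \<alpha>set by (metis abs_le_D1 m_def)
    then have "0 < length q" "length q \<le> K" using j(1) by (auto simp only: K_def D_def)
    then show False using closed(3)[OF q(1)] R1 by simp
  qed
  then have r8': "dd \<le> K" "?T dd 0 < 0" "R = ?T dd 0 + 1" using r8(2) unfolding best_def R_def by auto
  have F8: "s8 ''F'' = s7 ''F''" "s8 ''Q'' = s7 ''Q''"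
    using agreeD[OF a8, of "''F''"] agreeD[OF a8, of "''Q''"] by simp_all
  have z8: "s8 ''pos'' = (\<lambda>_. 0)" "s8 ''ps'' 0 = 0"
    using agreeD[OF a8, of "''pos''"] agreeD[OF a7, of "''pos''"] agreeD[OF b6, of "''pos''"]
      agreeD[OF a8, of "''ps''"] agreeD[OF a7, of "''ps''"] agreeD[OF b6, of "''ps''"] zero by simp_all
  have t8: "A.table K 0 (grid n (s8 ''F'')) (grid n (s8 ''Q''))" and n8: "grid n (s8 ''F'') dd 0 < 0"
    and R8: "R = grid n (s8 ''F'') dd 0 + 1" unfolding F8 using r7 r8' by auto
  obtain t9 s9 where x9: "exec B ?\<rho> follow s8 t9 s9" "t9 \<le> 200 * ((K + 1) * (n + 1))"
    and r9: "A.good R dd s9"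
    using A.runs_follow[OF loaded8 t8 r8(1) dd r8'(1) n8 R_def[symmetric] R8 z8 spacious M, of ?\<rho>] by (elim runsE) blast
  obtain \<sigma> where \<sigma>: "outputs es s9 \<sigma>" "cycle \<sigma>" "sum_list (map \<gamma> \<sigma>) * int dd \<le> R * int (length \<sigma>)"
    using good_cycle[OF ad[unfolded m_def] r9[unfolded m_def], of \<gamma>] by auto

  have "mean_weight w \<sigma> \<le> min_mean_cycle H w + \<epsilon>"
  proof (rule mean_weight_approx[where \<alpha> = \<alpha> and pr = "real_of_int p" and W = W and R = R and ?r1.0 = k1 and ?r2.0 = k2 and D = D and j = j and d = dd])
    show "4 * real D * real_of_int W \<le> real j * (real_of_int p * \<epsilon>)" using S.J_bounds(2) unfolding Jj .
    show "R * int (length q) \<le> sum_list (map (\<lambda>a. \<alpha> a - (W + 1)) q) * int dd"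
      if "awalk 0 q 0" "0 < length q" "length q \<le> j + D" for q
      using closed(2)[of q] that by (simp add: K_def \<gamma>_def)
  qed (use \<alpha>set p0 S.p_eps r4(3) r5(3) S.W j dd \<sigma> in \<open>auto simp: \<alpha>_def D_def \<gamma>_def m_def\<close>)
  moreover have "exec B ?\<rho> min_mean_prog ?s0 (t1 + (t2 + (t3 + (t4 + (t5 + (t6 + (t7 + (t8 + t9)))))))) s9"
    unfolding min_mean_prog_def
    by (rule exec.Seq[OF x1(1) exec.Seq[OF x2(1) exec.Seq[OF x3(1) exec.Seq[OF x4(1) exec.Seq[OF x5(1) exec.Seq[OF x6(1) exec.Seq[OF x7(1) exec.Seq[OF x8(1) x9(1)]]]]]]]])
  moreover have "real (t1 + (t2 + (t3 + (t4 + (t5 + (t6 + (t7 + (t8 + t9)))))))) \<le>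
     60000 * real m * max 1 (real d) * max 1 (wmax / \<epsilon>) * log 2 X"
  proof (rule time_bound[where k = k and K = K and d = d and n = n])
    \<comment> \<open>\<open>D\<close> is at most \<open>2 * d + 2\<close>; the factor 4 obtained
      from this times the 18 of \<open>J_time\<close> is the 72 of the estimate.\<close>
    have D4: "real D \<le> 4 * max 1 (real d)" using r4(1) r5(1) by (simp add: D_def)
    have "real K \<le> 18 * real D * max 1 (wmax / \<epsilon>)"
      using S.J_time unfolding Jj by (simp add: K_def)
    also have "\<dots> \<le> 18 * (4 * max 1 (real d)) * max 1 (wmax / \<epsilon>)"
      using D4 by (intro mult_right_mono mult_left_mono) auto
    finally show "real K \<le> 72 * max 1 (real d) * max 1 (wmax / \<epsilon>)" by simp
  qed (use m kL cap(4) x1(2) x2(2) x3(2) x4(2) x5(2) x6(2) x7(2) x8(2) x9(2) in auto)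
  moreover have "real B \<le> 60000 * log 2 X" using cap(2,4) by linarith
  ultimately show ?thesis
    using \<sigma>(1,2)
    unfolding polylog_def power_one_right X_def[symmetric] m_def[symmetric] d_def[symmetric] of_nat_numeral
    by blast
qed

end

theorem theorem6p7:
  shows "\<exists>P :: prog. \<exists>C k :: nat.
    \<forall>(n :: nat) (es :: (nat \<times> nat) list) (w :: (nat \<times> nat) weight_fun) (wmax :: real) (\<epsilon> :: real).
      distinct es \<longrightarrow> es \<noteq> [] \<longrightarrow>
      fin_digraph (graph_of n es) \<longrightarrow>
      strongly_connected (graph_of n es) \<longrightarrow>
      (\<forall>e\<in>set es. w e \<in> {- wmax..wmax}) \<longrightarrow>
      0 < \<epsilon> \<longrightarrow>
      (\<exists>B t s \<sigma>.
        exec B (input_reals es w \<epsilon>) P (input_store n es) t s \<and>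
        outputs es s \<sigma> \<and>
        pre_digraph.cycle (graph_of n es) \<sigma> \<and>
        mean_weight w \<sigma> \<le> min_mean_cycle (graph_of n es) w + \<epsilon> \<and>
        real t \<le> real C * real (length es) * max 1 (real (diameter_hops (graph_of n es)))
                   * max 1 (wmax / \<epsilon>) * polylog k n \<epsilon> wmax \<and>
        real B \<le> real C * polylog k n \<epsilon> wmax)"
proof (rule exI[of _ min_mean_prog], rule exI[of _ 60000], rule exI[of _ 1], intro allI impI)
  fix n es and w :: "(nat \<times> nat) weight_fun" and wmax \<epsilon> :: real
  assume "distinct es" "es \<noteq> []" "fin_digraph (graph_of n es)" "strongly_connected (graph_of n es)"
    "\<forall>e\<in>set es. w e \<in> {- wmax..wmax}" "0 < \<epsilon>"
  then show "\<exists>B t s \<sigma>.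
        exec B (input_reals es w \<epsilon>) min_mean_prog (input_store n es) t s \<and>
        outputs es s \<sigma> \<and>
        pre_digraph.cycle (graph_of n es) \<sigma> \<and>
        mean_weight w \<sigma> \<le> min_mean_cycle (graph_of n es) w + \<epsilon> \<and>
        real t \<le> real 60000 * real (length es) * max 1 (real (diameter_hops (graph_of n es)))
                   * max 1 (wmax / \<epsilon>) * polylog 1 n \<epsilon> wmax \<and>
        real B \<le> real 60000 * polylog 1 n \<epsilon> wmax"
    by (intro arc_list.min_mean_prog_correct arc_list.intro)
qed

end
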